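(* Let $H$ be a finite-dimensional Hopf algebra over a field $\Bbbk$, $\Lambda\in H$ a non-zero left integral and $a\in\mathrm{Gr}(H)$ the distinguished group-like element. (i) If $H$ is semisimple and $a=1$, then the linear map $N\to N$, $n\mapsto\Lambda\triangleright n$, induces for all left-left Yetter--Drinfeld modules $N$ over $H$ a natural isomorphism $$\upsilon_N:\mathrm{Bit}_H^H(\Bbbk_\varepsilon^a,N)=\mathrm{Bit}_H^H(\Bbbk_\varepsilon^1,N)\to\mathrm{Hom}_{D(H)}({}_\varepsilon^1\Bbbk,N).$$ (ii) Otherwise, the functors $\mathrm{Bit}_H^H(\Bbbk_\varepsilon^a,-)$ and $\mathrm{Hom}_{D(H)}({}_\varepsilon^1\Bbbk,-)$ on the category of left-left Yetter--Drinfeld modules over $H$ are not isomorphic.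
   Context: A left integral is $\Lambda\in H$ with $h\Lambda=\varepsilon(h)\Lambda$ for all $h\in H$. The distinguished group-like element $a\in\mathrm{Gr}(H)$ is the element with $\lambda\beta=\beta(a)\lambda$ for every left integral $\lambda$ of $H^*$ and every $\beta\in H^*$. A left-left Yetter--Drinfeld module over $H$ is a left module and left comodule $N$ with $(h\triangleright n)_{|-1|}\otimes(h\triangleright n)_{|0|}=h_{(1)}n_{|-1|}S(h_{(3)})\otimes h_{(2)}\triangleright n_{|0|}$; these are the same as left modules over the Drinfeld double $D(H)$, and $\mathrm{Hom}_{D(H)}$ denotes morphisms of Yetter--Drinfeld modules. For $g\in\mathrm{Gr}(H)$ and a character $\zeta:H\to\Bbbk$, $\Bbbk_\zeta^g$ is $\Bbbk$ with right action $\lambda\triangleleft h=\zeta(h)\lambda$ and right coaction $\lambda\mapsto\lambda\otimes g$; ${}_\zeta^g\Bbbk$ is the left-left version. For a right-right module-comodule $X$ and a left-left module-comodule $N$ over $H$, the bitensor product $\mathrm{Bit}_H^H(X,N)$ is the image of the composite $X\square_HN\hookrightarrow X\otimes N\twoheadrightarrow X\otimes_HN$ of the inclusion of the cotensor product and the projection onto the tensor product over $H$. Thus $\mathrm{Bit}_H^H(\Bbbk_\varepsilon^a,N)$ is identified with the set of classes in $N/(\ker\varepsilon)N$ having a representative $n$ with coaction $n\mapsto a\otimes n$, and $\mathrm{Hom}_{D(H)}({}_\varepsilon^1\Bbbk,N)$ is identified with $\{n\in N\mid\delta(n)=1\otimes n,\ h\triangleright n=\varepsilon(h)n\ \forall h\in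 H\}$; under these identifications $\upsilon_N([n])=\Lambda\triangleright n$. *)

theory Defs
  imports Complex_Main "HOL-Library.Poly_Mapping"
begin

section \<open>Tensors as formal sums\<close>

text \<open>
  Tensors are handled through representatives: an element of \<open>V \<otimes> W\<close> is given by a formal
  \<open>k\<close>-linear combination of pairs \<open>(v, w)\<close>, and two formal sums are the same tensor iff their
  difference lies in the subspace spanned by the bilinearity relations (\<open>null2\<close>).
  The triple tensor product is treated in the same way (\<open>null3\<close>).  Throughout, a vector space is a
  subspace \<open>V\<close> of a type with scalar multiplication \<open>s\<close>.
\<close>

definition fs_scale :: "'k::field \<Rightarrow> ('x \<Rightarrow>\<^sub>0 'k) \<Rightarrow> ('x \<Rightarrow>\<^sub>0 'k)" where
  "fs_scale c = Poly_Mapping.map ((*) c)"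

lemma lookup_fs_scale [simp]: "Poly_Mapping.lookup (fs_scale c t) x = c * Poly_Mapping.lookup t x"
  by (simp add: fs_scale_def Poly_Mapping.map.rep_eq when_def)

interpretation free: vector_space "fs_scale :: 'k::field \<Rightarrow> ('x \<Rightarrow>\<^sub>0 'k) \<Rightarrow> ('x \<Rightarrow>\<^sub>0 'k)"
  by unfold_locales (auto intro!: poly_mapping_eqI simp: lookup_add algebra_simps)

abbreviation gen :: "'x \<Rightarrow> ('x \<Rightarrow>\<^sub>0 'k::field)" where
  "gen x \<equiv> Poly_Mapping.single x 1"

definition lin_ext :: "('k::field \<Rightarrow> 'v \<Rightarrow> 'v::ab_group_add) \<Rightarrow> ('x \<Rightarrow> 'v) \<Rightarrow> ('x \<Rightarrow>\<^sub>0 'k) \<Rightarrow> 'v" where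
  "lin_ext s f t = (\<Sum>x\<in>Poly_Mapping.keys t. s (Poly_Mapping.lookup t x) (f x))"

text \<open>The relations expressing that \<open>v \<mapsto> gen (\<iota> v)\<close> is linear on \<open>V\<close>.\<close>

definition slot_rels ::
  "('k::field \<Rightarrow> 'v \<Rightarrow> 'v::ab_group_add) \<Rightarrow> 'v set \<Rightarrow> ('v \<Rightarrow> 'x) \<Rightarrow> ('x \<Rightarrow>\<^sub>0 'k) set" where
  "slot_rels s V \<iota> =
     {gen (\<iota> (v + w)) - (gen (\<iota> v) + gen (\<iota> w)) |v w. v \<in> V \<and> w \<in> V} \<union>
     {gen (\<iota> (s c v)) - fs_scale c (gen (\<iota> v)) |c v. v \<in> V}"

definition null2 ::
  "('k::field \<Rightarrow> 'v \<Rightarrow> 'v::ab_group_add) \<Rightarrow> 'v set \<Rightarrow> ('k \<Rightarrow> 'w \<Rightarrow> 'w::ab_group_add) \<Rightarrow> 'w set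
   \<Rightarrow> ('v \<times> 'w \<Rightarrow>\<^sub>0 'k) set" where
  "null2 s V s' W = free.span
     ((\<Union>w\<in>W. slot_rels s V (\<lambda>v. (v, w))) \<union> (\<Union>v\<in>V. slot_rels s' W (\<lambda>w. (v, w))))"

definition null3 ::
  "('k::field \<Rightarrow> 'v \<Rightarrow> 'v::ab_group_add) \<Rightarrow> 'v set \<Rightarrow> ('k \<Rightarrow> 'w \<Rightarrow> 'w::ab_group_add) \<Rightarrow> 'w set
   \<Rightarrow> ('k \<Rightarrow> 'z \<Rightarrow> 'z::ab_group_add) \<Rightarrow> 'z set \<Rightarrow> ('v \<times> 'w \<times> 'z \<Rightarrow>\<^sub>0 'k) set" where
  "null3 s V s' W s'' Z = free.span
     ((\<Union>w\<in>W. \<Union>z\<in>Z. slot_rels s V (\<lambda>v. (v, w, z))) \<union>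
      (\<Union>v\<in>V. \<Union>z\<in>Z. slot_rels s' W (\<lambda>w. (v, w, z))) \<union>
      (\<Union>v\<in>V. \<Union>w\<in>W. slot_rels s'' Z (\<lambda>z. (v, w, z))))"

text \<open>Linearity on \<open>V\<close> of a map whose values are only meant modulo the subspace \<open>R\<close>.\<close>

definition linear_mod ::
  "('k \<Rightarrow> 'v \<Rightarrow> 'v::ab_group_add) \<Rightarrow> 'v set \<Rightarrow> ('k \<Rightarrow> 'w \<Rightarrow> 'w::ab_group_add) \<Rightarrow> 'w set
   \<Rightarrow> ('v \<Rightarrow> 'w) \<Rightarrow> bool" where
  "linear_mod s V s' R f \<longleftrightarrow>
     (\<forall>x\<in>V. \<forall>y\<in>V. f (x + y) - (f x + f y) \<in> R) \<and> (\<forall>c. \<forall>x\<in>V. f (s c x) - s' c (f x) \<in> R)"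

abbreviation linear_on ::
  "('k \<Rightarrow> 'v \<Rightarrow> 'v::ab_group_add) \<Rightarrow> 'v set \<Rightarrow> ('k \<Rightarrow> 'w \<Rightarrow> 'w::ab_group_add)
   \<Rightarrow> ('v \<Rightarrow> 'w) \<Rightarrow> bool" where
  "linear_on s V s' f \<equiv> linear_mod s V s' {0} f"


section \<open>Hopf algebras\<close>

text \<open>The ring structure of the Hopf algebra is that of the type \<open>'h\<close>.\<close>

record (overloaded) ('k::zero, 'h) hopf =
  hscale :: "'k \<Rightarrow> 'h \<Rightarrow> 'h"
  comult :: "'h \<Rightarrow> ('h \<times> 'h \<Rightarrow>\<^sub>0 'k)"
  counit :: "'h \<Rightarrow> 'k"
  antipode :: "'h \<Rightarrow> 'h"

abbreviation null_HH :: "('k::field, 'h::ring_1) hopf \<Rightarrow> ('h \<times> 'h \<Rightarrow>\<^sub>0 'k) set" where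
  "null_HH H \<equiv> null2 (hscale H) UNIV (hscale H) UNIV"

abbreviation null_HHH :: "('k::field, 'h::ring_1) hopf \<Rightarrow> ('h \<times> 'h \<times> 'h \<Rightarrow>\<^sub>0 'k) set" where
  "null_HHH H \<equiv> null3 (hscale H) UNIV (hscale H) UNIV (hscale H) UNIV"

text \<open>\<open>h\<^sub>(\<^sub>1\<^sub>) \<otimes> h\<^sub>(\<^sub>2\<^sub>) \<otimes> h\<^sub>(\<^sub>3\<^sub>)\<close>, computed as \<open>(\<Delta> \<otimes> id) \<Delta>\<close>.\<close>

definition comult3 :: "('k::field, 'h::ring_1) hopf \<Rightarrow> 'h \<Rightarrow> ('h \<times> 'h \<times> 'h \<Rightarrow>\<^sub>0 'k)" where
  "comult3 H h = lin_ext fs_scale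
     (\<lambda>(x, y). lin_ext fs_scale (\<lambda>(x1, x2). gen (x1, x2, y)) (comult H x)) (comult H h)"

locale hopf_algebra =
  fixes H :: "('k::field, 'h::ring_1) hopf"
  assumes vector_space_H: "vector_space (hscale H)"
    and scale_mult_left: "hscale H c x * y = hscale H c (x * y)"
    and scale_mult_right: "x * hscale H c y = hscale H c (x * y)"
    and comult_linear: "linear_mod (hscale H) UNIV fs_scale (null_HH H) (comult H)"
    and comult_coassoc:
      "comult3 H h - lin_ext fs_scale
         (\<lambda>(x, y). lin_ext fs_scale (\<lambda>(y1, y2). gen (x, y1, y2)) (comult H y)) (comult H h)
       \<in> null_HHH H"
    and counit_linear: "Vector_Spaces.linear (hscale H) (*) (counit H)"
    and counit_left: "lin_ext (hscale H) (\<lambda>(x, y). hscale H (counit H x) y) (comult H h) = h"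
    and counit_right: "lin_ext (hscale H) (\<lambda>(x, y). hscale H (counit H y) x) (comult H h) = h"
    and comult_one: "comult H 1 - gen (1, 1) \<in> null_HH H"
    and comult_mult:
      "comult H (g * h) - lin_ext fs_scale
         (\<lambda>(x1, x2). lin_ext fs_scale (\<lambda>(y1, y2). gen (x1 * y1, x2 * y2)) (comult H h)) (comult H g)
       \<in> null_HH H"
    and counit_one: "counit H 1 = 1"
    and counit_mult: "counit H (g * h) = counit H g * counit H h"
    and antipode_linear: "Vector_Spaces.linear (hscale H) (hscale H) (antipode H)"
    and antipode_left:
      "lin_ext (hscale H) (\<lambda>(x, y). antipode H x * y) (comult H h) = hscale H (counit H h) 1"
    and antipode_right:
      "lin_ext (hscale H) (\<lambda>(x, y). x * antipode H y) (comult H h) = hscale H (counit H h) 1"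

definition finite_dimensional :: "('k::field \<Rightarrow> 'v \<Rightarrow> 'v::ab_group_add) \<Rightarrow> bool" where
  "finite_dimensional s \<longleftrightarrow> (\<exists>B. finite B \<and> module.span s B = UNIV)"

definition left_integral :: "('k::field, 'h::ring_1) hopf \<Rightarrow> 'h \<Rightarrow> bool" where
  "left_integral H \<Lambda> \<longleftrightarrow> (\<forall>h. h * \<Lambda> = hscale H (counit H h) \<Lambda>)"

definition group_like :: "('k::field, 'h::ring_1) hopf \<Rightarrow> 'h \<Rightarrow> bool" where
  "group_like H g \<longleftrightarrow> comult H g - gen (g, g) \<in> null_HH H \<and> counit H g = 1"

definition dual :: "('k::field, 'h::ring_1) hopf \<Rightarrow> ('h \<Rightarrow> 'k) set" where
  "dual H = {\<alpha>. Vector_Spaces.linear (hscale H) (*) \<alpha>}"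

definition conv ::
  "('k::field, 'h::ring_1) hopf \<Rightarrow> ('h \<Rightarrow> 'k) \<Rightarrow> ('h \<Rightarrow> 'k) \<Rightarrow> ('h \<Rightarrow> 'k)" where
  "conv H \<alpha> \<beta> = (\<lambda>h. lin_ext (*) (\<lambda>(x, y). \<alpha> x * \<beta> y) (comult H h))"

text \<open>The counit of the dual Hopf algebra is evaluation at \<open>1\<close>.\<close>

definition dual_left_integral :: "('k::field, 'h::ring_1) hopf \<Rightarrow> ('h \<Rightarrow> 'k) \<Rightarrow> bool" where
  "dual_left_integral H l \<longleftrightarrow> l \<in> dual H \<and> (\<forall>\<beta>\<in>dual H. conv H \<beta> l = (\<lambda>h. \<beta> 1 * l h))"

definition distinguished_group_like :: "('k::field, 'h::ring_1) hopf \<Rightarrow> 'h \<Rightarrow> bool" where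
  "distinguished_group_like H a \<longleftrightarrow> group_like H a \<and>
     (\<forall>l. dual_left_integral H l \<longrightarrow> (\<forall>\<beta>\<in>dual H. conv H l \<beta> = (\<lambda>h. \<beta> a * l h)))"

definition left_ideal :: "'h::ring_1 set \<Rightarrow> bool" where
  "left_ideal I \<longleftrightarrow> 0 \<in> I \<and> (\<forall>x\<in>I. \<forall>y\<in>I. x + y \<in> I) \<and> (\<forall>r. \<forall>x\<in>I. r * x \<in> I)"

text \<open>Semisimplicity of the left regular module: every submodule is a direct summand.\<close>

definition semisimple_ring :: "'h::ring_1 itself \<Rightarrow> bool" where
  "semisimple_ring _ \<longleftrightarrow>
     (\<forall>I::'h set. left_ideal I \<longrightarrow>
        (\<exists>J. left_ideal J \<and> I \<inter> J = {0} \<and> (\<forall>x. \<exists>i\<in>I. \<exists>j\<in>J. x = i + j)))"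


section \<open>Module-comodules and Yetter--Drinfeld modules\<close>

text \<open>
  The carrier is a subspace of the type \<open>'v\<close>; the other fields are only relevant on the carrier.
\<close>

record (overloaded) ('k::zero, 'h, 'v) left_mc =
  car :: "'v set"
  scl :: "'k \<Rightarrow> 'v \<Rightarrow> 'v"
  act :: "'h \<Rightarrow> 'v \<Rightarrow> 'v"
  coact :: "'v \<Rightarrow> ('h \<times> 'v \<Rightarrow>\<^sub>0 'k)"

record (overloaded) ('k::zero, 'h, 'v) right_mc =
  rcar :: "'v set"
  rscl :: "'k \<Rightarrow> 'v \<Rightarrow> 'v"
  ract :: "'v \<Rightarrow> 'h \<Rightarrow> 'v"
  rcoact :: "'v \<Rightarrow> ('v \<times> 'h \<Rightarrow>\<^sub>0 'k)"

abbreviation null_HN ::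
  "('k::field, 'h::ring_1) hopf \<Rightarrow> ('k, 'h, 'v::ab_group_add) left_mc \<Rightarrow> ('h \<times> 'v \<Rightarrow>\<^sub>0 'k) set" where
  "null_HN H N \<equiv> null2 (hscale H) UNIV (scl N) (car N)"

definition left_module ::
  "('k::field, 'h::ring_1) hopf \<Rightarrow> ('k, 'h, 'v::ab_group_add) left_mc \<Rightarrow> bool" where
  "left_module H N \<longleftrightarrow>
     vector_space (scl N) \<and> module.subspace (scl N) (car N) \<and>
     (\<forall>h. \<forall>n\<in>car N. act N h n \<in> car N) \<and>
     (\<forall>h. linear_on (scl N) (car N) (scl N) (act N h)) \<and>
     (\<forall>n\<in>car N. linear_on (hscale H) UNIV (scl N) (\<lambda>h. act N h n)) \<and>
     (\<forall>n\<in>car N. act N 1 n = n) \<and>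
     (\<forall>g h. \<forall>n\<in>car N. act N (g * h) n = act N g (act N h n))"

definition left_comodule ::
  "('k::field, 'h::ring_1) hopf \<Rightarrow> ('k, 'h, 'v::ab_group_add) left_mc \<Rightarrow> bool" where
  "left_comodule H N \<longleftrightarrow>
     vector_space (scl N) \<and> module.subspace (scl N) (car N) \<and>
     (\<forall>n\<in>car N. Poly_Mapping.keys (coact N n) \<subseteq> UNIV \<times> car N) \<and>
     linear_mod (scl N) (car N) fs_scale (null_HN H N) (coact N) \<and>
     (\<forall>n\<in>car N.
        lin_ext fs_scale (\<lambda>(x, m). lin_ext fs_scale (\<lambda>(x1, x2). gen (x1, x2, m)) (comult H x))
          (coact N n)
        - lin_ext fs_scale (\<lambda>(x, m). lin_ext fs_scale (\<lambda>(y, l). gen (x, y, l)) (coact N m))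
          (coact N n)
        \<in> null3 (hscale H) UNIV (hscale H) UNIV (scl N) (car N)) \<and>
     (\<forall>n\<in>car N. lin_ext (scl N) (\<lambda>(x, m). scl N (counit H x) m) (coact N n) = n)"

definition yetter_drinfeld ::
  "('k::field, 'h::ring_1) hopf \<Rightarrow> ('k, 'h, 'v::ab_group_add) left_mc \<Rightarrow> bool" where
  "yetter_drinfeld H N \<longleftrightarrow> left_module H N \<and> left_comodule H N \<and>
     (\<forall>h. \<forall>n\<in>car N.
        coact N (act N h n) -
        lin_ext fs_scale
          (\<lambda>(h1, h2, h3). lin_ext fs_scale
             (\<lambda>(x, m). gen (h1 * x * antipode H h3, act N h2 m)) (coact N n))
          (comult3 H h)
        \<in> null_HN H N)"

definition yd_hom ::
  "('k::field, 'h::ring_1) hopf \<Rightarrow> ('k, 'h, 'v::ab_group_add) left_mc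
   \<Rightarrow> ('k, 'h, 'w::ab_group_add) left_mc \<Rightarrow> ('v \<Rightarrow> 'w) set" where
  "yd_hom H M N = {f.
     (\<forall>m\<in>car M. f m \<in> car N) \<and>
     linear_on (scl M) (car M) (scl N) f \<and>
     (\<forall>h. \<forall>m\<in>car M. f (act M h m) = act N h (f m)) \<and>
     (\<forall>m\<in>car M. coact N (f m) - lin_ext fs_scale (\<lambda>(x, l). gen (x, f l)) (coact M m)
        \<in> null_HN H N)}"

definition left_char :: "('h \<Rightarrow> 'k) \<Rightarrow> 'h \<Rightarrow> ('k::field, 'h, 'k) left_mc" where
  "left_char \<zeta> g =
     \<lparr>car = UNIV, scl = (*), act = (\<lambda>h x. \<zeta> h * x), coact = (\<lambda>x. gen (g, x))\<rparr>"

definition right_char :: "('h \<Rightarrow> 'k) \<Rightarrow> 'h \<Rightarrow> ('k::field, 'h, 'k) right_mc" where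
  "right_char \<zeta> g =
     \<lparr>rcar = UNIV, rscl = (*), ract = (\<lambda>x h. \<zeta> h * x), rcoact = (\<lambda>x. gen (x, g))\<rparr>"


section \<open>The bitensor product\<close>

text \<open>Representatives in \<open>X \<otimes> N\<close> of the elements of the cotensor product.\<close>

definition cotensor ::
  "('k::field, 'h::ring_1) hopf \<Rightarrow> ('k, 'h, 'x::ab_group_add) right_mc
   \<Rightarrow> ('k, 'h, 'v::ab_group_add) left_mc \<Rightarrow> ('x \<times> 'v \<Rightarrow>\<^sub>0 'k) set" where
  "cotensor H X N = {t.
     Poly_Mapping.keys t \<subseteq> rcar X \<times> car N \<and>
     lin_ext fs_scale (\<lambda>(x, n). lin_ext fs_scale (\<lambda>(x0, h). gen (x0, h, n)) (rcoact X x)) t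
     - lin_ext fs_scale (\<lambda>(x, n). lin_ext fs_scale (\<lambda>(h, n0). gen (x, h, n0)) (coact N n)) t
     \<in> null3 (rscl X) (rcar X) (hscale H) UNIV (scl N) (car N)}"

text \<open>The relations defining \<open>X \<otimes>\<^sub>H N\<close> and the resulting classes.\<close>

definition null_over ::
  "('k::field, 'h, 'x::ab_group_add) right_mc \<Rightarrow> ('k, 'h, 'v::ab_group_add) left_mc
   \<Rightarrow> ('x \<times> 'v \<Rightarrow>\<^sub>0 'k) set" where
  "null_over X N = free.span
     (null2 (rscl X) (rcar X) (scl N) (car N) \<union>
      {gen (ract X x h, n) - gen (x, act N h n) |x h n. x \<in> rcar X \<and> n \<in> car N})"

definition tensor_class ::
  "('k::field, 'h, 'x::ab_group_add) right_mc \<Rightarrow> ('k, 'h, 'v::ab_group_add) left_mc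
   \<Rightarrow> ('x \<times> 'v \<Rightarrow>\<^sub>0 'k) \<Rightarrow> ('x \<times> 'v \<Rightarrow>\<^sub>0 'k) set" where
  "tensor_class X N t = {t + r |r. r \<in> null_over X N}"

definition bit ::
  "('k::field, 'h::ring_1) hopf \<Rightarrow> ('k, 'h, 'x::ab_group_add) right_mc
   \<Rightarrow> ('k, 'h, 'v::ab_group_add) left_mc \<Rightarrow> ('x \<times> 'v \<Rightarrow>\<^sub>0 'k) set set" where
  "bit H X N = tensor_class X N ` cotensor H X N"

text \<open>
  The map \<open>Bit(X, N) \<rightarrow> Bit(X, N')\<close> induced by \<open>id \<otimes> f\<close>; all the sets in the union coincide.
\<close>

definition bit_map ::
  "('k::field, 'h, 'x::ab_group_add) right_mc \<Rightarrow> ('k, 'h, 'w::ab_group_add) left_mc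
   \<Rightarrow> ('v \<Rightarrow> 'w) \<Rightarrow> ('x \<times> 'v \<Rightarrow>\<^sub>0 'k) set \<Rightarrow> ('x \<times> 'w \<Rightarrow>\<^sub>0 'k) set" where
  "bit_map X N' f C =
     (\<Union>t\<in>C. tensor_class X N' (lin_ext fs_scale (\<lambda>(x, n). gen (x, f n)) t))"

text \<open>
  Linear isomorphism \<open>Bit(X, N) \<rightarrow> Hom(\<^sub>\<epsilon>\<^sup>1k, N)\<close>; sums and multiples are those of classes on the
  left and pointwise on the right.
\<close>

definition bit_hom_iso ::
  "('k::field, 'h::ring_1) hopf \<Rightarrow> ('k, 'h, 'x::ab_group_add) right_mc
   \<Rightarrow> ('k, 'h, 'v::ab_group_add) left_mc \<Rightarrow> (('x \<times> 'v \<Rightarrow>\<^sub>0 'k) set \<Rightarrow> ('k \<Rightarrow> 'v)) \<Rightarrow> bool" where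
  "bit_hom_iso H X N \<phi> \<longleftrightarrow>
     bij_betw \<phi> (bit H X N) (yd_hom H (left_char (counit H) 1) N) \<and>
     (\<forall>s\<in>cotensor H X N. \<forall>t\<in>cotensor H X N.
        \<phi> (tensor_class X N (s + t)) =
        (\<lambda>x. \<phi> (tensor_class X N s) x + \<phi> (tensor_class X N t) x)) \<and>
     (\<forall>c. \<forall>t\<in>cotensor H X N.
        \<phi> (tensor_class X N (fs_scale c t)) = (\<lambda>x. scl N c (\<phi> (tensor_class X N t) x)))"

text \<open>
  Isomorphism of functors from \<open>Bit(X, -)\<close> to \<open>Hom(\<^sub>\<epsilon>\<^sup>1k, -)\<close> on the category of all
  Yetter--Drinfeld modules whose underlying space is carried by the type \<open>'v\<close>, which plays the
  role of the universe.
\<close>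

definition natural_bit_hom_iso ::
  "('k::field, 'h::ring_1) hopf \<Rightarrow> ('k, 'h, 'x::ab_group_add) right_mc
   \<Rightarrow> (('k, 'h, 'v::ab_group_add) left_mc \<Rightarrow> ('x \<times> 'v \<Rightarrow>\<^sub>0 'k) set \<Rightarrow> ('k \<Rightarrow> 'v)) \<Rightarrow> bool" where
  "natural_bit_hom_iso H X \<upsilon> \<longleftrightarrow>
     (\<forall>N. yetter_drinfeld H N \<longrightarrow> bit_hom_iso H X N (\<upsilon> N)) \<and>
     (\<forall>N N' f. yetter_drinfeld H N \<longrightarrow> yetter_drinfeld H N' \<longrightarrow> f \<in> yd_hom H N N' \<longrightarrow>
        (\<forall>C\<in>bit H X N. \<upsilon> N' (bit_map X N' f C) = f \<circ> \<upsilon> N C))"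

end

theory Submission
  imports Defs
begin

text \<open>
  Identities between tensors are tested on multilinear forms, so that all computations in Sweedler
  notation take place in the base field.

  Let \<open>H\<close> be semisimple. A left integral \<open>z\<close> with \<open>\<epsilon>(z) = 0\<close> spans a left ideal of square zero, hence
  vanishes; therefore \<open>\<epsilon>(\<Lambda>) \<noteq> 0\<close> and \<open>\<Lambda>\<close> is two-sided. The trace functional
  \<open>l(h) = tr(x \<mapsto> h S\<^sup>2(x))\<close> is a left integral of \<open>H\<^sup>*\<close> with \<open>\<Lambda>\<^sub>(\<^sub>1\<^sub>) l(\<Lambda>\<^sub>(\<^sub>2\<^sub>)) = \<epsilon>(\<Lambda>) 1\<close>, which makes the
  form \<open>l(x h)\<close> nondegenerate. If also \<open>a = 1\<close>, moving \<open>x\<close> across the two coproducts in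
  \<open>\<Lambda>\<^sub>(\<^sub>1\<^sub>) S(\<Lambda>\<^sub>(\<^sub>3\<^sub>)) l(x \<Lambda>\<^sub>(\<^sub>2\<^sub>))\<close> shows \<open>\<Lambda>\<^sub>(\<^sub>1\<^sub>) S(\<Lambda>\<^sub>(\<^sub>3\<^sub>)) \<otimes> \<Lambda>\<^sub>(\<^sub>2\<^sub>) = 1 \<otimes> \<Lambda>\<close>, so \<open>\<Lambda>\<close> maps coinvariants to
  coinvariants. The inverse of \<open>\<upsilon>\<^sub>N\<close> sends \<open>m\<close> to the class of \<open>\<epsilon>(\<Lambda>)\<^sup>-\<^sup>1 m\<close>.

  If \<open>a \<noteq> 1\<close>, the two functors already differ on the trivial module. If \<open>a = 1\<close> and \<open>H\<close> is not
  semisimple, \<open>\<epsilon>\<close> kills every left integral by Maschke's argument. Equip the left module \<open>H\<close> with the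
  coaction \<open>h \<mapsto> h\<^sub>(\<^sub>1\<^sub>) S(h\<^sub>(\<^sub>3\<^sub>)) \<otimes> h\<^sub>(\<^sub>2\<^sub>)\<close>: the morphism \<open>\<epsilon>\<close> to the trivial module then induces zero on
  \<open>Hom\<close>, but maps the class of \<open>1\<close> to a nonzero class in \<open>Bit\<close>, which contradicts naturality.
\<close>


section \<open>Linear extension of maps to formal sums\<close>

lemma vector_space_field: "vector_space ((*) :: 'k::field \<Rightarrow> 'k \<Rightarrow> 'k)"
  by unfold_locales (auto simp: algebra_simps)

lemma vector_space_fs_scale: "vector_space (fs_scale :: 'k::field \<Rightarrow> ('x \<Rightarrow>\<^sub>0 'k) \<Rightarrow> _)"
  by (rule free.vector_space_axioms)

lemma lin_ext_superset:
  assumes "vector_space s" "finite A" "Poly_Mapping.keys t \<subseteq> A"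
  shows "lin_ext s f t = (\<Sum>x\<in>A. s (Poly_Mapping.lookup t x) (f x))"
proof -
  interpret vector_space s by fact
  show ?thesis
    unfolding lin_ext_def using assms(2,3)
    by (intro sum.mono_neutral_left) (auto simp: in_keys_iff)
qed

lemma lin_ext_linear:
  fixes s :: "'k::field \<Rightarrow> 'v::ab_group_add \<Rightarrow> 'v" and f :: "'x \<Rightarrow> 'v"
  assumes "vector_space s"
  shows "Vector_Spaces.linear fs_scale s (lin_ext s f)"
proof -
  interpret vector_space s by fact
  show ?thesis
    unfolding Vector_Spaces.linear_iff
  proof (intro conjI allI assms free.vector_space_axioms)
    fix t u :: "'x \<Rightarrow>\<^sub>0 'k"
    let ?A = "Poly_Mapping.keys t \<union> Poly_Mapping.keys u"
    have "lin_ext s f v = (\<Sum>x\<in>?A. s (Poly_Mapping.lookup v x) (f x))"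
      if "v \<in> {t, u, t + u}" for v
      using that Poly_Mapping.keys_add[of t u] by (intro lin_ext_superset[OF assms]) auto
    then show "lin_ext s f (t + u) = lin_ext s f t + lin_ext s f u"
      by (simp add: lookup_add scale_left_distrib sum.distrib)
  next
    fix c and t :: "'x \<Rightarrow>\<^sub>0 'k"
    have "lin_ext s f (fs_scale c t)
        = (\<Sum>x\<in>Poly_Mapping.keys t. s (Poly_Mapping.lookup (fs_scale c t) x) (f x))"
      by (rule lin_ext_superset[OF assms]) (auto simp: in_keys_iff)
    then show "lin_ext s f (fs_scale c t) = s c (lin_ext s f t)"
      by (simp add: lin_ext_def scale_sum_right)
  qed
qed

context
  fixes s :: "'k::field \<Rightarrow> 'v::ab_group_add \<Rightarrow> 'v"
  assumes s: "vector_space s"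
begin

interpretation vector_space s by (fact s)
interpretation E: Vector_Spaces.linear fs_scale s "lin_ext s f" for f :: "'x \<Rightarrow> 'v"
  by (rule lin_ext_linear[OF s])

lemmas lin_ext_simps = E.add E.diff E.scale E.zero E.sum

lemma lin_ext_gen: "lin_ext s f (gen x) = f x"
  by (simp add: lin_ext_def)

lemma lin_ext_comp:
  "lin_ext s f (lin_ext fs_scale g t) = lin_ext s (\<lambda>x. lin_ext s f (g x)) t"
  unfolding lin_ext_def[of fs_scale] by (simp only: E.sum E.scale) (simp add: lin_ext_def)

lemma lin_ext_add_fun: "lin_ext s (\<lambda>x. f x + g x) t = lin_ext s f t + lin_ext s g t"
  by (simp add: lin_ext_def scale_right_distrib sum.distrib)

lemma lin_ext_scale_fun: "lin_ext s (\<lambda>x. s c (f x)) t = s c (lin_ext s f t)"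
  by (simp add: lin_ext_def scale_sum_right scale_scale mult.commute)

lemma lin_ext_in:
  assumes "subspace V" "\<And>x. x \<in> Poly_Mapping.keys t \<Longrightarrow> f x \<in> V"
  shows "lin_ext s f t \<in> V"
  unfolding lin_ext_def using assms by (intro subspace_sum subspace_scale)

end

lemma lin_ext_cong:
  "(\<And>x. x \<in> Poly_Mapping.keys t \<Longrightarrow> f x = g x) \<Longrightarrow> lin_ext s f t = lin_ext s g t"
  by (simp add: lin_ext_def)

lemma lin_ext_gen_id: "lin_ext fs_scale gen t = t"
proof (rule poly_mapping_eqI)
  fix x
  show "Poly_Mapping.lookup (lin_ext fs_scale gen t) x = Poly_Mapping.lookup t x"
    by (simp add: lin_ext_def lookup_sum lookup_single when_def in_keys_iff if_distrib sum.delta' 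
        cong: if_cong)
qed

lemma keys_lin_ext: 
  "Poly_Mapping.keys (lin_ext fs_scale g t) \<subseteq> (\<Union>x\<in>Poly_Mapping.keys t. Poly_Mapping.keys (g x))"
  unfolding lin_ext_def
  by (rule order_trans[OF keys_sum]) (auto simp: in_keys_iff)

lemma linear_on_iff:
  "linear_on s V s' f \<longleftrightarrow>
     (\<forall>x\<in>V. \<forall>y\<in>V. f (x + y) = f x + f y) \<and> (\<forall>c. \<forall>x\<in>V. f (s c x) = s' c (f x))"
  by (auto simp: linear_mod_def)

text \<open>Since \<open>f\<close> is linear on \<open>V\<close> only, the induction over the
  support also has to keep every partial sum inside \<open>V\<close>.\<close>

lemma linear_on_lin_ext:
  assumes s: "vector_space s" and s': "vector_space s'" and V: "module.subspace s V"
    and f: "linear_on s V s' f" and g: "\<And>x. x \<in> Poly_Mapping.keys t \<Longrightarrow> g x \<in> V"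
  shows "f (lin_ext s g t) = lin_ext s' (\<lambda>x. f (g x)) t"
proof -
  interpret s: vector_space s by fact
  interpret s': vector_space s' by fact
  have f0: "f 0 = 0"
    using f V by (metis linear_on_iff s.scale_zero_left s'.scale_zero_left s.subspace_0)
  have "f (\<Sum>x\<in>A. s (c x) (g x)) = (\<Sum>x\<in>A. s' (c x) (f (g x)))"
    if "finite A" "A \<subseteq> Poly_Mapping.keys t" for A c
    using that
  proof (induction A rule: finite_induct)
    case (insert a A)
    have "s (c a) (g a) \<in> V" "(\<Sum>x\<in>A. s (c x) (g x)) \<in> V"
      using insert g V by (auto intro!: s.subspace_sum s.subspace_scale)
    then show ?case
      using insert f g by (simp add: linear_on_iff)
  qed (simp add: f0)
  then show ?thesis by (simp add: lin_ext_def)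
qed

lemma lin_ext_swap:
  "lin_ext (*) (\<lambda>x. lin_ext (*) (\<lambda>y. f x y) u) t
   = lin_ext (*) (\<lambda>y. lin_ext (*) (\<lambda>x. f x y) t) (u :: 'y \<Rightarrow>\<^sub>0 'k::field)"
  unfolding lin_ext_def sum_distrib_left
  by (subst sum.swap) (simp add: mult.left_commute)


section \<open>Detecting relations by multilinear forms\<close>

text \<open>Adjoining \<open>x\<close> to a basis of \<open>U\<close> keeps it independent, so a
  functional may be prescribed as 0 on that basis and 1 at \<open>x\<close>.\<close>

lemma (in vector_space) separating_functional:
  assumes "subspace U" "x \<notin> U"
  obtains \<phi> where "Vector_Spaces.linear scale (*) \<phi>" "\<And>u. u \<in> U \<Longrightarrow> \<phi> u = 0" "\<phi> x = 1"
proof -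
  interpret p: vector_space_pair scale "(*) :: 'a \<Rightarrow> 'a \<Rightarrow> 'a"
    by (simp add: vector_space_pair_def vector_space_axioms vector_space_field)
  obtain B where B: "B \<subseteq> U" "independent B" "U \<subseteq> span B"
    using basis_exists[of U] by metis
  have sp: "span B = U"
    using B assms(1) by (simp add: span_minimal subset_antisym)
  have ind: "independent (insert x B)"
    using B(2) assms(2) sp by (metis independent_insert)
  obtain \<phi> where \<phi>: "Vector_Spaces.linear scale (*) \<phi>"
    "\<forall>y\<in>insert x B. \<phi> y = (if y = x then 1 else 0)"
    using p.linear_independent_extend[OF ind, of "\<lambda>y. if y = x then 1 else 0"] by auto
  have xB: "x \<notin> B" using assms(2) B(1) by auto
  have "\<phi> u = 0" if "u \<in> U" for u
  proof (rule p.linear_eq_0_on_span[OF \<phi>(1), of B])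
    show "\<phi> b = 0" if "b \<in> B" for b using \<phi>(2) xB that by auto
  qed (use that sp in auto)
  then show ?thesis using that \<phi> by auto
qed

text \<open>Every functional on the free space is the linear extension of its values on generators.
  A functional separating \<open>t\<close> from the span therefore has the form
  \<open>lin_ext\<close> of some \<open>f\<close>.\<close>

lemma span_iff_lin_ext:
  fixes t :: "'x \<Rightarrow>\<^sub>0 'k::field"
  shows "t \<in> free.span R \<longleftrightarrow>
    (\<forall>f. (\<forall>r\<in>R. lin_ext (*) f r = (0::'k)) \<longrightarrow> lin_ext (*) f t = 0)"
proof safe
  fix f assume *: "t \<in> free.span R" "\<forall>r\<in>R. lin_ext (*) f r = (0::'k)"
  interpret p: vector_space_pair "fs_scale :: 'k \<Rightarrow> ('x \<Rightarrow>\<^sub>0 'k) \<Rightarrow> _" "(*) :: 'k \<Rightarrow> 'k \<Rightarrow> 'k"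
    by (simp add: vector_space_pair_def free.vector_space_axioms vector_space_field)
  show "lin_ext (*) f t = 0"
    by (rule p.linear_eq_0_on_span[OF lin_ext_linear[OF vector_space_field], of R])
      (use * in auto)
next
  assume *: "\<forall>f. (\<forall>r\<in>R. lin_ext (*) f r = (0::'k)) \<longrightarrow> lin_ext (*) f t = 0"
  show "t \<in> free.span R"
  proof (rule ccontr)
    assume "t \<notin> free.span R"
    then obtain \<phi> :: "('x \<Rightarrow>\<^sub>0 'k) \<Rightarrow> 'k" where \<phi>: "Vector_Spaces.linear fs_scale (*) \<phi>"
        "\<And>u. u \<in> free.span R \<Longrightarrow> \<phi> u = 0" "\<phi> t = 1"
      using free.separating_functional[OF free.subspace_span] by metis
    interpret \<phi>: Vector_Spaces.linear fs_scale "(*)" \<phi> by (fact \<phi>(1))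
    have "\<phi> u = lin_ext (*) (\<lambda>x. \<phi> (gen x)) u" for u
    proof -
      have "\<phi> u = \<phi> (lin_ext fs_scale gen u)" by (simp add: lin_ext_gen_id)
      also have "\<dots> = lin_ext (*) (\<lambda>x. \<phi> (gen x)) u"
        by (simp add: lin_ext_def \<phi>.sum \<phi>.scale)
      finally show ?thesis .
    qed
    with * \<phi>(2,3) show False
      by (metis free.span_base one_neq_zero)
  qed
qed

lemma lin_ext_slot_rels:
  fixes s :: "'k::field \<Rightarrow> 'v \<Rightarrow> 'v::ab_group_add"
  shows "(\<forall>r\<in>slot_rels s V \<iota>. lin_ext (*) f r = 0) \<longleftrightarrow> linear_on s V (*) (\<lambda>v. f (\<iota> v))"
proof -
  note E = lin_ext_simps[OF vector_space_field] lin_ext_gen[OF vector_space_field]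
  have "(\<forall>r\<in>slot_rels s V \<iota>. lin_ext (*) f r = 0) \<longleftrightarrow>
    (\<forall>v\<in>V. \<forall>w\<in>V. lin_ext (*) f (gen (\<iota> (v + w)) - (gen (\<iota> v) + gen (\<iota> w))) = 0) \<and>
    (\<forall>c. \<forall>v\<in>V. lin_ext (*) f (gen (\<iota> (s c v)) - fs_scale c (gen (\<iota> v))) = 0)"
    unfolding slot_rels_def by blast
  also have "\<dots> \<longleftrightarrow> linear_on s V (*) (\<lambda>v. f (\<iota> v))"
    by (simp only: E linear_on_iff right_minus_eq)
  finally show ?thesis .
qed

text \<open>By \<open>lin_ext_slot_rels\<close>, the functions that kill the generating relations
  are exactly the bilinear forms on \<open>V\<close> and \<open>W\<close>. Being the zero tensor
  becomes a family of equations in the field.\<close>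

lemma null2_iff:
  "t \<in> null2 s V s' W \<longleftrightarrow>
     (\<forall>b. (\<forall>w\<in>W. linear_on s V (*) (\<lambda>v. b v w)) \<longrightarrow> (\<forall>v\<in>V. linear_on s' W (*) (b v)) \<longrightarrow>
        lin_ext (*) (\<lambda>(v, w). b v w) t = 0)"
  unfolding null2_def span_iff_lin_ext ball_Un ball_UN lin_ext_slot_rels
proof (intro iffI allI impI; (elim conjE)?)
  fix f
  assume "\<forall>b. (\<forall>w\<in>W. linear_on s V (*) (\<lambda>v. b v w)) \<longrightarrow> (\<forall>v\<in>V. linear_on s' W (*) (b v)) \<longrightarrow>
        lin_ext (*) (\<lambda>(v, w). b v w) t = 0"
    "\<forall>w\<in>W. linear_on s V (*) (\<lambda>v. f (v, w))" "\<forall>v\<in>V. linear_on s' W (*) (\<lambda>w. f (v, w))"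
  from this(1)[rule_format, of "curry f"] this(2,3) show "lin_ext (*) f t = 0"
    by (simp add: curry_def)
qed simp

lemma null3_iff:
  "t \<in> null3 s V s' W s'' Z \<longleftrightarrow>
     (\<forall>b. (\<forall>w\<in>W. \<forall>z\<in>Z. linear_on s V (*) (\<lambda>v. b v w z)) \<longrightarrow>
          (\<forall>v\<in>V. \<forall>z\<in>Z. linear_on s' W (*) (\<lambda>w. b v w z)) \<longrightarrow>
          (\<forall>v\<in>V. \<forall>w\<in>W. linear_on s'' Z (*) (b v w)) \<longrightarrow>
        lin_ext (*) (\<lambda>(v, w, z). b v w z) t = 0)"
  unfolding null3_def span_iff_lin_ext ball_Un ball_UN lin_ext_slot_rels
proof (intro iffI allI impI; (elim conjE)?)
  fix f
  assume "\<forall>b. (\<forall>w\<in>W. \<forall>z\<in>Z. linear_on s V (*) (\<lambda>v. b v w z)) \<longrightarrow>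
          (\<forall>v\<in>V. \<forall>z\<in>Z. linear_on s' W (*) (\<lambda>w. b v w z)) \<longrightarrow>
          (\<forall>v\<in>V. \<forall>w\<in>W. linear_on s'' Z (*) (b v w)) \<longrightarrow>
        lin_ext (*) (\<lambda>(v, w, z). b v w z) t = 0"
    "\<forall>w\<in>W. \<forall>z\<in>Z. linear_on s V (*) (\<lambda>v. f (v, w, z))"
    "\<forall>v\<in>V. \<forall>z\<in>Z. linear_on s' W (*) (\<lambda>w. f (v, w, z))"
    "\<forall>v\<in>V. \<forall>w\<in>W. linear_on s'' Z (*) (\<lambda>z. f (v, w, z))"
  from this(1)[rule_format, of "\<lambda>v w z. f (v, w, z)"] this(2-4) show "lin_ext (*) f t = 0"
    by (simp add: case_prod_unfold)
qed simp


section \<open>Sweedler calculus\<close>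

context hopf_algebra
begin

interpretation HS: vector_space "hscale H" by (rule vector_space_H)

abbreviation \<epsilon> :: "'h \<Rightarrow> 'k" where "\<epsilon> \<equiv> counit H"
abbreviation S :: "'h \<Rightarrow> 'h" where "S \<equiv> antipode H"

text \<open>Membership of \<open>dual H\<close> in equational form, so that the simplifier can prove
  it through \<open>multilinear_simps\<close>; \<open>bil\<close> and \<open>tri\<close> serve the
  same end.\<close>

definition lin :: "('h \<Rightarrow> 'k) \<Rightarrow> bool" where
  "lin \<alpha> \<longleftrightarrow> (\<forall>x y. \<alpha> (x + y) = \<alpha> x + \<alpha> y) \<and> (\<forall>c x. \<alpha> (hscale H c x) = c * \<alpha> x)"

definition bil :: "('h \<Rightarrow> 'h \<Rightarrow> 'k) \<Rightarrow> bool" where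
  "bil b \<longleftrightarrow> (\<forall>y. lin (\<lambda>x. b x y)) \<and> (\<forall>x. lin (b x))"

definition tri :: "('h \<Rightarrow> 'h \<Rightarrow> 'h \<Rightarrow> 'k) \<Rightarrow> bool" where
  "tri t \<longleftrightarrow> (\<forall>y z. lin (\<lambda>x. t x y z)) \<and> (\<forall>x. bil (t x))"

text \<open>\<open>sw b h\<close> is the sum \<open>b(h\<^sub>(\<^sub>1\<^sub>), h\<^sub>(\<^sub>2\<^sub>))\<close>.\<close>

definition sw :: "('h \<Rightarrow> 'h \<Rightarrow> 'k) \<Rightarrow> 'h \<Rightarrow> 'k" where
  "sw b h = lin_ext (*) (\<lambda>(x, y). b x y) (comult H h)"

lemma lin_dual: "\<alpha> \<in> dual H \<longleftrightarrow> lin \<alpha>"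
  by (simp add: dual_def lin_def Vector_Spaces.linear_iff vector_space_H vector_space_field)

lemma bilD: "bil b \<Longrightarrow> b (x + x') y = b x y + b x' y" "bil b \<Longrightarrow> b x (y + y') = b x y + b x y'"
  "bil b \<Longrightarrow> b (hscale H c x) y = c * b x y" "bil b \<Longrightarrow> b x (hscale H c y) = c * b x y"
  by (simp_all add: bil_def lin_def)

lemma linD: "lin \<alpha> \<Longrightarrow> \<alpha> (x + y) = \<alpha> x + \<alpha> y" "lin \<alpha> \<Longrightarrow> \<alpha> (hscale H c x) = c * \<alpha> x"
  by (simp_all add: lin_def)

lemma lin_zero: "lin \<alpha> \<Longrightarrow> \<alpha> 0 = 0"
  by (metis HS.scale_zero_left linD(2) mult_zero_left)

lemma lin_diff: "lin \<alpha> \<Longrightarrow> \<alpha> (x - y) = \<alpha> x - \<alpha> y"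
  by (metis (no_types) add_diff_cancel_right' diff_add_cancel linD(1))

lemma lin_sum: "lin \<alpha> \<Longrightarrow> \<alpha> (\<Sum>i\<in>I. f i) = (\<Sum>i\<in>I. \<alpha> (f i))"
  by (induction I rule: infinite_finite_induct) (simp_all add: lin_zero linD)

lemma lin_lin_ext: "lin \<alpha> \<Longrightarrow> \<alpha> (lin_ext (hscale H) f t) = lin_ext (*) (\<lambda>x. \<alpha> (f x)) t"
  by (simp add: lin_ext_def lin_sum linD)

text \<open>Functionals separate points. Thus identities in \<open>H\<close> can be proved by
  Sweedler computations with values in the field.\<close>

lemma lin_eqI:
  assumes "\<And>\<alpha>. lin \<alpha> \<Longrightarrow> \<alpha> x = \<alpha> y"
  shows "x = y"
proof (rule ccontr)
  assume "x \<noteq> y"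
  then have "x - y \<notin> {0}" by simp
  then obtain \<phi> where "Vector_Spaces.linear (hscale H) (*) \<phi>" "\<phi> (x - y) = 1"
    using HS.separating_functional[OF HS.subspace_single_0] by blast
  then show False
    using assms[of \<phi>] by (simp add: lin_dual[symmetric] dual_def Vector_Spaces.linear_iff)
      (metis assms diff_self lin_def lin_diff one_neq_zero)
qed

lemma lin_counit: "lin \<epsilon>"
  using counit_linear by (simp add: lin_dual[symmetric] dual_def)

lemmas counit_simps = linD[OF lin_counit] counit_one counit_mult lin_zero[OF lin_counit]
  lin_diff[OF lin_counit]

lemma antipode_add: "S (x + y) = S x + S y"
  and antipode_scale: "S (hscale H c x) = hscale H c (S x)"
  using antipode_linear by (simp_all add: Vector_Spaces.linear_iff)

lemma sw_add: "sw (\<lambda>x y. f x y + g x y) h = sw f h + sw g h"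
  by (simp add: sw_def case_prod_unfold lin_ext_add_fun[OF vector_space_field])

lemma sw_mult_left: "sw (\<lambda>x y. c * f x y) h = c * sw f h"
  by (simp add: sw_def case_prod_unfold lin_ext_scale_fun[OF vector_space_field])

lemma sw_mult_right: "sw (\<lambda>x y. f x y * c) h = sw f h * c"
  using sw_mult_left[of c f h] by (simp add: mult.commute)

lemma sw_sum: "sw (\<lambda>x y. \<Sum>i\<in>I. f i x y) h = (\<Sum>i\<in>I. sw (f i) h)"
proof -
  have "sw (\<lambda>_ _. 0) h = 0" by (simp add: sw_def lin_ext_def case_prod_unfold)
  then show ?thesis
    by (induction I rule: infinite_finite_induct) (simp_all add: sw_add)
qed

lemma sw_swap: "sw (\<lambda>x y. sw (\<lambda>u v. f x y u v) g) h = sw (\<lambda>u v. sw (\<lambda>x y. f x y u v) h) g"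
  unfolding sw_def case_prod_unfold by (rule lin_ext_swap)

lemma null_HH_iff: "t \<in> null_HH H \<longleftrightarrow> (\<forall>b. bil b \<longrightarrow> lin_ext (*) (\<lambda>(x, y). b x y) t = 0)"
  by (auto simp: null2_iff bil_def lin_def linear_on_iff)

lemma null_HHH_iff: "t \<in> null_HHH H \<longleftrightarrow> (\<forall>b. tri b \<longrightarrow> lin_ext (*) (\<lambda>(x, y, z). b x y z) t = 0)"
  by (auto simp: null3_iff tri_def bil_def lin_def linear_on_iff)

lemmas lin_ext_field_simps = lin_ext_simps[OF vector_space_field] lin_ext_gen[OF vector_space_field]
  lin_ext_comp[OF vector_space_field]

lemma lin_sw_arg:
  assumes "bil b"
  shows "lin (sw b)"
  using comult_linear assms
  by (fastforce simp: linear_mod_def null_HH_iff lin_ext_field_simps sw_def lin_def)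

lemma sw_arg_simps:
  "bil b \<Longrightarrow> sw b (x + y) = sw b x + sw b y" "bil b \<Longrightarrow> sw b (hscale H c x) = c * sw b x"
  using lin_sw_arg by (simp_all add: lin_def)

text \<open>Trilinearity makes both bracketings independent of representatives. Used in both
  directions, this brings neighbouring legs together before an antipode or counit axiom cancels
  them.\<close>

lemma sw_coassoc:
  assumes "tri b"
  shows "sw (\<lambda>p z. sw (\<lambda>x y. b x y z) p) h = sw (\<lambda>x q. sw (b x) q) h"
  using comult_coassoc[of h] assms
  by (auto simp: comult3_def null_HHH_iff lin_ext_field_simps sw_def case_prod_unfold)

lemma sw_comult3: "lin_ext (*) (\<lambda>(x, y, z). b x y z) (comult3 H h) = sw (\<lambda>p z. sw (\<lambda>x y. b x y z) p) h"
  by (simp add: comult3_def lin_ext_field_simps sw_def case_prod_unfold)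

lemma sw_counit_left: "lin \<alpha> \<Longrightarrow> sw (\<lambda>x y. \<epsilon> x * \<alpha> y) h = \<alpha> h"
  using arg_cong[OF counit_left[of h], of \<alpha>]
  by (simp add: lin_lin_ext sw_def case_prod_unfold linD)

lemma sw_counit_right: "lin \<alpha> \<Longrightarrow> sw (\<lambda>x y. \<epsilon> y * \<alpha> x) h = \<alpha> h"
  using arg_cong[OF counit_right[of h], of \<alpha>]
  by (simp add: lin_lin_ext sw_def case_prod_unfold linD)

lemma sw_one: "bil b \<Longrightarrow> sw b 1 = b 1 1"
  using comult_one by (auto simp: null_HH_iff lin_ext_field_simps sw_def)

lemma sw_mult: "bil b \<Longrightarrow> sw b (g * h) = sw (\<lambda>x y. sw (\<lambda>u v. b (x * u) (y * v)) h) g"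
  using comult_mult[of g h]
  by (auto simp: null_HH_iff lin_ext_field_simps sw_def case_prod_unfold)

lemma sw_antipode_left: "lin \<alpha> \<Longrightarrow> sw (\<lambda>x y. \<alpha> (S x * y)) h = \<epsilon> h * \<alpha> 1"
  using arg_cong[OF antipode_left[of h], of \<alpha>]
  by (simp add: lin_lin_ext sw_def case_prod_unfold linD)

lemma sw_antipode_right: "lin \<alpha> \<Longrightarrow> sw (\<lambda>x y. \<alpha> (x * S y)) h = \<epsilon> h * \<alpha> 1"
  using arg_cong[OF antipode_right[of h], of \<alpha>]
  by (simp add: lin_lin_ext sw_def case_prod_unfold linD)

lemma dual_left_integral_iff:
  "dual_left_integral H l \<longleftrightarrow>
     lin l \<and> (\<forall>\<beta> h. lin \<beta> \<longrightarrow> sw (\<lambda>x y. \<beta> x * l y) h = \<beta> 1 * l h)"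
  by (auto simp: dual_left_integral_def lin_dual conv_def sw_def fun_eq_iff)

text \<open>These rules discharge the multilinearity side conditions of the Sweedler steps.\<close>

lemmas multilinear_simps = lin_def bil_def tri_def sw_add sw_mult_left sw_mult_right sw_arg_simps
  antipode_add antipode_scale counit_simps distrib_left distrib_right scale_mult_left scale_mult_right
  mult.assoc mult.left_commute

section \<open>The antipode reverses products and coproducts\<close>

lemma antipode_one: "S 1 = 1"
proof (rule lin_eqI)
  fix \<alpha> assume \<alpha>: "lin \<alpha>"
  have "bil (\<lambda>x y. \<alpha> (S x * y))"
    using \<alpha> by (simp add: multilinear_simps)
  then show "\<alpha> (S 1) = \<alpha> 1"
    using sw_antipode_left[OF \<alpha>, of 1] by (simp add: sw_one counit_one)
qed

text \<open>With h1, h2, ... for Sweedler legs, S(g1 h1) g2 h2 S(h3) S(g3) is evaluated twice.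
  Cancelling h2 S(h3) and then g2 S(g3) leaves S(g h); cancelling S(g1 h1) against g2 h2 leaves S(h)
  S(g).\<close>

lemma antipode_mult: "S (g * h) = S h * S g"
proof (rule lin_eqI)
  fix \<alpha> assume \<alpha>: "lin \<alpha>"
  note [simp] = linD[OF \<alpha>]
  let ?F = "\<lambda>g1 g2 g3 h1 h2 h3. \<alpha> (S (g1 * h1) * (g2 * (h2 * (S h3 * S g3))))"
  have "sw (\<lambda>h2 h3. ?F g1 g2 g3 h1 h2 h3) q = \<epsilon> q * \<alpha> (S (g1 * h1) * (g2 * S g3))"
    for g1 g2 g3 h1 q
    using sw_antipode_right[of "\<lambda>z. \<alpha> (S (g1 * h1) * (g2 * (z * S g3)))" q]
    by (simp add: multilinear_simps)
  moreover have "sw (\<lambda>h1 q. \<epsilon> q * \<alpha> (S (g1 * h1) * (g2 * S g3))) h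
      = \<alpha> (S (g1 * h) * (g2 * S g3))" for g1 g2 g3
    using sw_counit_right[of "\<lambda>z. \<alpha> (S (g1 * z) * (g2 * S g3))" h]
    by (simp add: multilinear_simps)
  moreover have "sw (\<lambda>g2 g3. \<alpha> (S (g1 * h) * (g2 * S g3))) p = \<epsilon> p * \<alpha> (S (g1 * h))" for g1 p
    using sw_antipode_right[of "\<lambda>z. \<alpha> (S (g1 * h) * z)" p]
    by (simp add: multilinear_simps)
  moreover have "sw (\<lambda>g1 p. \<epsilon> p * \<alpha> (S (g1 * h))) g = \<alpha> (S (g * h))"
    using sw_counit_right[of "\<lambda>z. \<alpha> (S (z * h))" g]
    by (simp add: multilinear_simps)
  ultimately have A: "sw (\<lambda>g1 p. sw (\<lambda>g2 g3.
      sw (\<lambda>h1 q. sw (\<lambda>h2 h3. ?F g1 g2 g3 h1 h2 h3) q) h) p) g = \<alpha> (S (g * h))"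
    by simp
  \<comment> \<open>Rebracketing puts the first two legs of \<open>g\<close> and of \<open>h\<close>
    together, ready for the second evaluation.\<close>
  have "sw (\<lambda>h1 q. sw (\<lambda>h2 h3. ?F g1 g2 g3 h1 h2 h3) q) h
      = sw (\<lambda>r h3. sw (\<lambda>h1 h2. ?F g1 g2 g3 h1 h2 h3) r) h" for g1 g2 g3
    by (rule sw_coassoc[symmetric]) (simp add: multilinear_simps)
  moreover have "sw (\<lambda>g1 p. sw (\<lambda>g2 g3. sw (\<lambda>r h3. sw (\<lambda>h1 h2. ?F g1 g2 g3 h1 h2 h3) r) h) p) g
      = sw (\<lambda>s g3. sw (\<lambda>g1 g2. sw (\<lambda>r h3. sw (\<lambda>h1 h2. ?F g1 g2 g3 h1 h2 h3) r) h) s) g"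
    by (rule sw_coassoc[symmetric]) (simp add: multilinear_simps)
  moreover have "sw (\<lambda>g1 g2. sw (\<lambda>r h3. sw (\<lambda>h1 h2. ?F g1 g2 g3 h1 h2 h3) r) h) s
      = \<epsilon> s * \<alpha> (S h * S g3)" for g3 s
  proof -
    have "sw (\<lambda>g1 g2. sw (\<lambda>h1 h2. ?F g1 g2 g3 h1 h2 h3) r) s
        = \<epsilon> s * (\<epsilon> r * \<alpha> (S h3 * S g3))" for h3 r
      using sw_antipode_left[of "\<lambda>z. \<alpha> (z * (S h3 * S g3))" "s * r"]
        sw_mult[of "\<lambda>x y. \<alpha> (S x * (y * (S h3 * S g3)))" s r]
      by (simp add: multilinear_simps)
    then show ?thesis
      unfolding sw_swap[of _ h]
      using sw_counit_left[of "\<lambda>z. \<epsilon> s * \<alpha> (S z * S g3)" h]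
      by (simp add: multilinear_simps)
  qed
  moreover have "sw (\<lambda>s g3. \<epsilon> s * \<alpha> (S h * S g3)) g = \<alpha> (S h * S g)"
    using sw_counit_left[of "\<lambda>z. \<alpha> (S h * S z)" g] by (simp add: multilinear_simps)
  ultimately show "\<alpha> (S (g * h)) = \<alpha> (S h * S g)"
    using A by simp
qed

lemma counit_antipode: "\<epsilon> (S h) = \<epsilon> h"
proof -
  have "sw (\<lambda>x y. \<epsilon> (S x * y)) h = \<epsilon> h"
    using sw_antipode_left[OF lin_counit, of h] by (simp add: counit_one)
  moreover have "sw (\<lambda>x y. \<epsilon> y * \<epsilon> (S x)) h = \<epsilon> (S h)"
    by (rule sw_counit_right) (simp add: multilinear_simps)
  ultimately show ?thesis by (simp add: counit_mult mult.commute)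
qed

text \<open>This is uniqueness of convolution inverses again. In \<Delta>(S(h1)) (h2 \<otimes> h3)
  (S(h5) \<otimes> S(h4)), cancelling on the right leaves \<Delta>(S(h)), and cancelling on the left
  leaves S(h2) \<otimes> S(h1).\<close>

lemma sw_antipode:
  assumes b: "bil b"
  shows "sw b (S h) = sw (\<lambda>x y. b (S y) (S x)) h"
proof -
  note [simp] = bilD[OF b]
  \<comment> \<open>Under \<open>sw\<close> the form \<open>b\<close> occurs with one argument only,
    so its linearity is also needed in this partially applied shape.\<close>
  have "b (x + y) = (\<lambda>z. b x z + b y z)" "b (hscale H c x) = (\<lambda>z. c * b x z)" for c x y
    by (simp_all add: fun_eq_iff)
  then have [simp]: "sw (\<lambda>x. b (f x + g x)) k = sw (\<lambda>x. b (f x)) k + sw (\<lambda>x. b (g x)) k"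
    "sw (\<lambda>x. b (hscale H c (f x))) k = c * sw (\<lambda>x. b (f x)) k" for f g c k
    by (simp_all add: sw_add sw_mult_left)
  let ?F = "\<lambda>s u v z w. sw (\<lambda>s1 s2. b (s1 * (u * S w)) (s2 * (v * S z))) s"
  let ?X = "sw (\<lambda>x p. sw (\<lambda>q w. sw (\<lambda>r z. sw (\<lambda>u v. ?F (S x) u v z w) r) q) p) h"
  have "sw (\<lambda>r z. sw (\<lambda>u v. ?F s u v z w) r) q = ?F s q 1 1 w" for s w q
  proof -
    have "sw (\<lambda>r z. sw (\<lambda>u v. ?F s u v z w) r) q = sw (\<lambda>u r. sw (\<lambda>v z. ?F s u v z w) r) q"
      by (rule sw_coassoc) (simp add: multilinear_simps)
    moreover have "sw (\<lambda>v z. ?F s u v z w) r = \<epsilon> r * ?F s u 1 1 w" for u r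
      using sw_antipode_right[of "\<lambda>y. sw (\<lambda>s1 s2. b (s1 * (u * S w)) (s2 * y)) s" r]
      by (simp add: multilinear_simps antipode_one)
    moreover have "sw (\<lambda>u r. \<epsilon> r * ?F s u 1 1 w) q = ?F s q 1 1 w"
      by (rule sw_counit_right) (simp add: multilinear_simps)
    ultimately show ?thesis by simp
  qed
  moreover have "sw (\<lambda>q w. ?F s q 1 1 w) p = \<epsilon> p * sw b s" for s p
    using sw_antipode_right[of "\<lambda>y. sw (\<lambda>s1 s2. b (s1 * y) s2) s" p]
    by (simp add: multilinear_simps antipode_one)
  moreover have "sw (\<lambda>x p. \<epsilon> p * sw b (S x)) h = sw b (S h)"
    using b by (intro sw_counit_right) (simp add: multilinear_simps)
  ultimately have A: "?X = sw b (S h)"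
    by simp
  \<comment> \<open>Here \<open>x\<close> and \<open>p\<close> are regrouped so that \<Delta>(S(h1))
    meets \<Delta>(h2).\<close>
  have "?X = sw (\<lambda>x p. sw (\<lambda>r q. sw (\<lambda>z w. sw (\<lambda>u v. ?F (S x) u v z w) r) q) p) h"
  proof -
    have "sw (\<lambda>q w. sw (\<lambda>r z. sw (\<lambda>u v. ?F s u v z w) r) q) p
        = sw (\<lambda>r q. sw (\<lambda>z w. sw (\<lambda>u v. ?F s u v z w) r) q) p" for s p
      by (rule sw_coassoc) (simp add: multilinear_simps)
    then show ?thesis by simp
  qed
  also have "\<dots> = sw (\<lambda>p q. sw (\<lambda>x r. sw (\<lambda>z w. sw (\<lambda>u v. ?F (S x) u v z w) r) q) p) h"
    by (rule sw_coassoc[symmetric]) (simp add: multilinear_simps)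
  also have "\<dots> = sw (\<lambda>p q. \<epsilon> p * sw (\<lambda>z w. b (S w) (S z)) q) h"
  proof -
    have "sw (\<lambda>x r. sw (\<lambda>u v. ?F (S x) u v z w) r) p = \<epsilon> p * b (S w) (S z)" for p z w
    proof -
      let ?c = "\<lambda>x y. b (x * S w) (y * S z)"
      have c: "bil ?c" by (simp add: multilinear_simps)
      have "sw (\<lambda>u v. ?F s u v z w) r = sw ?c (s * r)" for s r
        unfolding sw_mult[OF c] by (subst sw_swap) (simp add: mult.assoc)
      then show ?thesis
        using sw_antipode_left[OF lin_sw_arg[OF c], of p] sw_one[OF c] by simp
    qed
    moreover have "sw (\<lambda>x r. sw (\<lambda>z w. sw (\<lambda>u v. ?F (S x) u v z w) r) q) p
        = sw (\<lambda>z w. sw (\<lambda>x r. sw (\<lambda>u v. ?F (S x) u v z w) r) p) q" for p q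
      by (rule sw_swap)
    ultimately show ?thesis
      by (simp add: sw_mult_left)
  qed
  also have "\<dots> = sw (\<lambda>z w. b (S w) (S z)) h"
    by (rule sw_counit_left) (simp add: multilinear_simps)
  finally show ?thesis using A by simp
qed

section \<open>Left integrals, semisimplicity and Maschke's theorem\<close>

lemma hscale_one_mult: "hscale H c 1 * x = hscale H c x" "x * hscale H c 1 = hscale H c x"
  by (simp_all add: scale_mult_left scale_mult_right)

text \<open>Scaling by \<open>c\<close> is left multiplication by
  \<open>hscale H c 1\<close>.\<close>

lemma left_ideal_subspace: "left_ideal I \<Longrightarrow> HS.subspace I"
  unfolding left_ideal_def HS.subspace_def by (metis hscale_one_mult(1))

lemma left_integralD: "left_integral H \<Lambda> \<Longrightarrow> h * \<Lambda> = hscale H (\<epsilon> h) \<Lambda>"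
  by (simp add: left_integral_def)

text \<open>The left ideal spanned by such a \<open>z\<close> squares to zero, so it cannot have a complement unless
  \<open>z = 0\<close>.\<close>

lemma semisimple_left_integral_counit:
  assumes ss: "semisimple_ring TYPE('h)" and z: "left_integral H z" "\<epsilon> z = 0"
  shows "z = 0"
proof -
  let ?I = "range (\<lambda>c. hscale H c z)"
  have "left_ideal ?I"
    unfolding left_ideal_def
  proof safe
    show "0 \<in> ?I" by (rule range_eqI[of _ _ 0]) simp
    show "hscale H c z + hscale H d z \<in> ?I" for c d
      by (rule range_eqI[of _ _ "c + d"]) (simp add: HS.scale_left_distrib)
    show "r * hscale H c z \<in> ?I" for r c
      by (rule range_eqI[of _ _ "c * \<epsilon> r"]) (simp add: scale_mult_right left_integralD[OF z(1)])
  qed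
  then obtain J where J: "left_ideal J" "?I \<inter> J = {0}" "\<forall>x. \<exists>i\<in>?I. \<exists>j\<in>J. x = i + j"
    using ss unfolding semisimple_ring_def by metis
  then obtain c j where j: "j \<in> J" "1 = hscale H c z + j"
    by (metis imageE)
  \<comment> \<open>Multiplying 1 = c z + j by \<open>z\<close> on the left removes the first
    summand, because z z = \<epsilon>(z) z = 0.\<close>
  have "z = z * (hscale H c z + j)" using j by simp
  also have "\<dots> = z * j"
    using left_integralD[OF z(1), of z] z(2) by (simp add: distrib_left scale_mult_right)
  finally have "z \<in> J" using J(1) j(1) by (metis left_ideal_def)
  moreover have "z \<in> ?I" by (rule range_eqI[of _ _ 1]) simp
  ultimately show ?thesis using J(2) by blast
qed

text \<open>The difference of the two sides is again a left integral, and its counit is zero, so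
  \<open>semisimple_left_integral_counit\<close> makes it vanish.\<close>

lemma semisimple_right_integral:
  assumes ss: "semisimple_ring TYPE('h)" and \<Lambda>: "left_integral H \<Lambda>"
  shows "\<Lambda> * h = hscale H (\<epsilon> h) \<Lambda>"
proof -
  have "left_integral H (\<Lambda> * h - hscale H (\<epsilon> h) \<Lambda>)"
    unfolding left_integral_def
    by (simp add: right_diff_distrib mult.assoc[symmetric] left_integralD[OF \<Lambda>] scale_mult_left
        scale_mult_right HS.scale_right_diff_distrib mult.commute)
  moreover have "\<epsilon> (\<Lambda> * h - hscale H (\<epsilon> h) \<Lambda>) = 0"
    by (simp add: counit_simps)
  ultimately show ?thesis
    using semisimple_left_integral_counit[OF ss] eq_iff_diff_eq_0 by blast
qed

lemma left_integral_sw: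
  assumes \<Lambda>: "left_integral H \<Lambda>" and b: "bil b"
  shows "sw (\<lambda>h1 h2. sw (\<lambda>u v. b (h1 * u) (h2 * v)) \<Lambda>) h = \<epsilon> h * sw b \<Lambda>"
  using sw_mult[OF b, of h \<Lambda>] by (simp add: left_integralD[OF \<Lambda>] sw_arg_simps[OF b])

text \<open>A linear projection \<open>p\<close> onto \<open>I\<close> is averaged to P(x) =
  \<Lambda>1 p(S(\<Lambda>2) x). This map is \<open>H\<close>-linear with values in \<open>I\<close>
  and is multiplication by \<epsilon>(\<Lambda>) on \<open>I\<close>, so its kernel is a
  complementary left ideal.\<close>

lemma maschke:
  assumes \<Lambda>: "left_integral H \<Lambda>" and nz: "\<epsilon> \<Lambda> \<noteq> 0"
  shows "semisimple_ring TYPE('h)"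
  unfolding semisimple_ring_def
proof (intro allI impI)
  fix I :: "'h set" assume I: "left_ideal I"
  note sub = left_ideal_subspace[OF I]
  obtain p where p: "Vector_Spaces.linear (hscale H) (hscale H) p" "\<And>x. p x \<in> I" "\<And>x. x \<in> I \<Longrightarrow> p x = x"
  proof -
    interpret P: vector_space_pair "hscale H" "hscale H"
      by (simp add: vector_space_pair_def HS.vector_space_axioms)
    obtain B where B: "B \<subseteq> I" "HS.independent B" "I \<subseteq> HS.span B"
      using HS.basis_exists[of I] by metis
    have sp: "HS.span B = I"
      using B sub by (simp add: HS.span_minimal subset_antisym)
    obtain p where p: "Vector_Spaces.linear (hscale H) (hscale H) p" "\<forall>b\<in>B. p b = b" "range p = HS.span B"
      using P.linear_independent_extend_subspace[OF B(2), of "\<lambda>x. x"] by auto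
    have "p x = x" if "x \<in> I" for x
      using P.linear_eq_on[OF p(1) HS.linear_id[unfolded id_def], of x B] that sp p(2) by simp
    then show ?thesis using that[OF p(1)] p(3) sp by auto
  qed
  have p_simps: "p (x + y) = p x + p y" "p (hscale H c x) = hscale H c (p x)" for x y c
    using p(1) by (simp_all add: Vector_Spaces.linear_iff)
  define P where "P x = lin_ext (hscale H) (\<lambda>(u, v). u * p (S v * x)) (comult H \<Lambda>)" for x
  have lP: "\<alpha> (P x) = sw (\<lambda>u v. \<alpha> (u * p (S v * x))) \<Lambda>" if "lin \<alpha>" for \<alpha> x
    by (simp add: P_def lin_lin_ext[OF that] sw_def case_prod_unfold)
  have PI: "P x \<in> I" for x
    unfolding P_def using I p(2)
    by (intro lin_ext_in[OF vector_space_H sub]) (auto simp: left_ideal_def)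
  have P_id: "P x = hscale H (\<epsilon> \<Lambda>) x" if "x \<in> I" for x
  proof (rule lin_eqI)
    fix \<alpha> assume \<alpha>: "lin \<alpha>"
    note [simp] = linD[OF \<alpha>]
    have "p (S v * x) = S v * x" for v
      using that I by (intro p(3)) (simp add: left_ideal_def)
    then show "\<alpha> (P x) = \<alpha> (hscale H (\<epsilon> \<Lambda>) x)"
      using sw_antipode_right[of "\<lambda>z. \<alpha> (z * x)" \<Lambda>]
      by (simp add: lP[OF \<alpha>] multilinear_simps)
  qed
  have P_mult: "P (h * x) = h * P x" for h x
  proof (rule lin_eqI)
    fix \<alpha> assume \<alpha>: "lin \<alpha>"
    note [simp] = linD[OF \<alpha>] p_simps
    \<comment> \<open>The sum h1 \<Lambda>1 p(S(h2 \<Lambda>2) h3 x) is evaluated twice: the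
      integral absorbs h1 and h2, giving P(h x), or S(h2) h3 cancels, giving h P(x).\<close>
    let ?F = "\<lambda>h1 h2 h3. sw (\<lambda>u v. \<alpha> (h1 * u * p (S (h2 * v) * (h3 * x)))) \<Lambda>"
    have "sw (\<lambda>q h3. sw (\<lambda>h1 h2. ?F h1 h2 h3) q) h = sw (\<lambda>q h3. \<epsilon> q * \<alpha> (P (h3 * x))) h"
      using left_integral_sw[OF \<Lambda>, of "\<lambda>u v. \<alpha> (u * p (S v * (k * x)))" for k]
      by (simp add: lP[OF \<alpha>] multilinear_simps)
    also have "\<dots> = \<alpha> (P (h * x))"
      unfolding lP[OF \<alpha>] by (rule sw_counit_left) (simp add: multilinear_simps)
    finally have 1: "sw (\<lambda>q h3. sw (\<lambda>h1 h2. ?F h1 h2 h3) q) h = \<alpha> (P (h * x))" .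
    have 2: "sw (\<lambda>q h3. sw (\<lambda>h1 h2. ?F h1 h2 h3) q) h = sw (\<lambda>h1 q. sw (\<lambda>h2 h3. ?F h1 h2 h3) q) h"
      by (rule sw_coassoc) (simp add: multilinear_simps)
    have 3: "sw (\<lambda>h2 h3. ?F h1 h2 h3) q = \<epsilon> q * sw (\<lambda>u v. \<alpha> (h1 * u * p (S v * x))) \<Lambda>" for h1 q
    proof -
      have "sw (\<lambda>h2 h3. \<alpha> (h1 * u * p (S (h2 * v) * (h3 * x)))) q
          = \<epsilon> q * \<alpha> (h1 * u * p (S v * x))" for u v
        using sw_antipode_left[of "\<lambda>z. \<alpha> (h1 * u * p (S v * (z * x)))" q]
        by (simp add: multilinear_simps antipode_mult)
      then show ?thesis by (subst sw_swap) (simp add: sw_mult_left)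
    qed
    have "sw (\<lambda>h1 q. \<epsilon> q * sw (\<lambda>u v. \<alpha> (h1 * u * p (S v * x))) \<Lambda>) h
        = sw (\<lambda>u v. \<alpha> (h * u * p (S v * x))) \<Lambda>"
      by (rule sw_counit_right) (simp add: multilinear_simps)
    also have "\<dots> = \<alpha> (h * P x)"
      using lP[of "\<lambda>z. \<alpha> (h * z)" x] by (simp add: multilinear_simps)
    finally show "\<alpha> (P (h * x)) = \<alpha> (h * P x)"
      using 1 2 3 by simp
  qed
  have P_add: "P (x + y) = P x + P y" for x y
    by (simp add: P_def case_prod_unfold distrib_left p_simps lin_ext_add_fun[OF vector_space_H])
  let ?J = "{x. P x = 0}"
  have P0: "P 0 = 0" using P_mult[of 0 0] by simp
  have "left_ideal ?J"
    by (simp add: left_ideal_def P0 P_add P_mult)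
  moreover have "I \<inter> ?J = {0}"
    using P_id nz P0 I by (auto simp: left_ideal_def)
  moreover have "\<exists>i\<in>I. \<exists>j\<in>?J. x = i + j" for x
  proof -
    let ?i = "hscale H (inverse (\<epsilon> \<Lambda>)) (P x)"
    have i: "?i \<in> I" using sub PI by (rule HS.subspace_scale)
    have "P (x - ?i) = P x - P ?i" using P_add[of "x - ?i" ?i] by (simp add: algebra_simps)
    then have "P (x - ?i) = 0" using P_id[OF i] nz by simp
    with i show ?thesis by (intro bexI[of _ ?i] bexI[of _ "x - ?i"]) auto
  qed
  ultimately show "\<exists>J. left_ideal J \<and> I \<inter> J = {0} \<and> (\<forall>x. \<exists>i\<in>I. \<exists>j\<in>J. x = i + j)" by blast
qed


section \<open>The trace integral of a semisimple Hopf algebra\<close>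

text \<open>The expansion is stated under an arbitrary functional, so that a basis can be inserted
  into or removed from any linear expression with values in the field.\<close>

lemma finite_dual_basis:
  assumes "finite_dimensional (hscale H)"
  obtains B and e :: "'h \<Rightarrow> 'h \<Rightarrow> 'k" where "finite B" "HS.independent B" "HS.span B = UNIV"
    "\<And>b. lin (e b)" "\<And>\<alpha> x. lin \<alpha> \<Longrightarrow> (\<Sum>b\<in>B. e b x * \<alpha> b) = \<alpha> x"
proof -
  obtain C where C: "finite C" "HS.span C = UNIV"
    using assms by (auto simp: finite_dimensional_def)
  obtain B where B: "B \<subseteq> C" "HS.independent B" "C \<subseteq> HS.span B"
    using HS.maximal_independent_subset[of C] by metis
  have fin: "finite B" using B(1) C(1) finite_subset by blast
  have sp: "HS.span B = UNIV"
    using C(2) B(3) HS.span_minimal[OF B(3) HS.subspace_span] by auto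
  define e where "e b x = HS.representation B x b" for b x
  have "lin (e b)" for b
    unfolding lin_def e_def using B(2) sp
    by (simp add: HS.representation_add HS.representation_scale)
  moreover have "(\<Sum>b\<in>B. e b x * \<alpha> b) = \<alpha> x" if \<alpha>: "lin \<alpha>" for \<alpha> x
  proof -
    have "x = (\<Sum>b\<in>B. hscale H (e b x) b)"
      unfolding e_def using HS.sum_representation_eq[OF B(2) _ fin subset_refl, of x] sp by simp
    then have "\<alpha> x = \<alpha> (\<Sum>b\<in>B. hscale H (e b x) b)" by simp
    then show ?thesis by (simp add: lin_sum[OF \<alpha>] linD(2)[OF \<alpha>])
  qed
  ultimately show ?thesis using that fin B(2) sp by blast
qed

text \<open>The functional \<open>h \<mapsto> tr(x \<mapsto> h S\<^sup>2(x))\<close>, where \<open>e\<close> is dual to the basis \<open>B\<close>.\<close>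

definition trace_integral :: "'h set \<Rightarrow> ('h \<Rightarrow> 'h \<Rightarrow> 'k) \<Rightarrow> 'h \<Rightarrow> 'k" where
  "trace_integral B e h = (\<Sum>b\<in>B. e b (h * S (S b)))"

lemma lin_trace_integral: "(\<And>b. lin (e b)) \<Longrightarrow> lin (trace_integral B e)"
  by (simp add: trace_integral_def lin_def distrib_right scale_mult_left sum.distrib sum_distrib_left)

text \<open>A form of cyclicity of the trace: the leg of \<open>h\<close> under \<beta> is rewritten
  through the basis vector, a second basis is inserted, and the first one is summed out. The
  remaining legs of the new basis vector cancel by the antipode axiom.\<close>

lemma trace_integral_left:
  assumes e: "\<And>b. lin (e b)" and dual: "\<And>\<alpha> x. lin \<alpha> \<Longrightarrow> (\<Sum>b\<in>B. e b x * \<alpha> b) = \<alpha> x"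
  shows "dual_left_integral H (trace_integral B e)"
  unfolding dual_left_integral_iff
proof (intro conjI allI impI)
  show "lin (trace_integral B e)" using e by (rule lin_trace_integral)
  fix \<beta> h assume \<beta>: "lin \<beta>"
  note [simp] = linD[OF \<beta>]
  let ?G = "\<lambda>\<gamma> z w. sw (\<lambda>x y. \<beta> (x * S z) * \<gamma> y) w"
  \<comment> \<open>For w = h S(S(z2)), the element w1 S(z1) contains S(S(z2)) S(z1) = S(z1 S(z2)),
    which collapses to a counit. The coproduct of \<open>h\<close> is thus traded for that of h
    S(S(z2)).\<close>
  have unwind: "sw (\<lambda>x y. \<beta> x * \<gamma> (y * S (S z))) h = sw (\<lambda>z1 z2. ?G \<gamma> z1 (h * S (S z2))) z"
    if \<gamma>: "lin \<gamma>" for \<gamma> z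
  proof -
    note [simp] = linD[OF \<gamma>]
    have G: "?G \<gamma> z1 (h * S (S z2))
        = sw (\<lambda>x y. sw (\<lambda>u v. \<beta> (x * (S (S u) * S z1)) * \<gamma> (y * S (S v))) z2) h" for z1 z2
      by (simp add: multilinear_simps sw_mult sw_antipode)
    have "sw (\<lambda>z1 u. \<beta> (x * (S (S u) * S z1)) * \<gamma> (y * S (S v))) p
        = \<epsilon> p * (\<beta> x * \<gamma> (y * S (S v)))" for x y v p
      using sw_antipode_right[of "\<lambda>t. \<beta> (x * S t) * \<gamma> (y * S (S v))" p]
      by (simp add: multilinear_simps antipode_mult antipode_one)
    moreover have "sw (\<lambda>p v. \<epsilon> p * (\<beta> x * \<gamma> (y * S (S v)))) z = \<beta> x * \<gamma> (y * S (S z))" for x y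
      by (rule sw_counit_left) (simp add: multilinear_simps)
    moreover have "sw (\<lambda>z1 z2. sw (\<lambda>u v. \<beta> (x * (S (S u) * S z1)) * \<gamma> (y * S (S v))) z2) z
        = sw (\<lambda>p v. sw (\<lambda>z1 u. \<beta> (x * (S (S u) * S z1)) * \<gamma> (y * S (S v))) p) z" for x y
      by (rule sw_coassoc[symmetric]) (simp add: multilinear_simps)
    ultimately have "sw (\<lambda>z1 z2. sw (\<lambda>u v. \<beta> (x * (S (S u) * S z1)) * \<gamma> (y * S (S v))) z2) z
        = \<beta> x * \<gamma> (y * S (S z))" for x y
      by simp
    moreover have "sw (\<lambda>z1 z2. ?G \<gamma> z1 (h * S (S z2))) z
        = sw (\<lambda>x y. sw (\<lambda>z1 z2. sw (\<lambda>u v. \<beta> (x * (S (S u) * S z1)) * \<gamma> (y * S (S v))) z2) z) h"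
      unfolding G by (rule sw_swap)
    ultimately show ?thesis by simp
  qed
  have "sw (\<lambda>x y. \<beta> x * trace_integral B e y) h
      = (\<Sum>b\<in>B. sw (\<lambda>x y. \<beta> x * e b (y * S (S b))) h)"
    by (simp add: trace_integral_def sum_distrib_left sw_sum)
  \<comment> \<open>The argument h S(S(z2)) is expanded in the basis, with summation index
    \<open>c\<close>.\<close>
  also have "\<dots> = (\<Sum>b\<in>B. sw (\<lambda>z1 z2. \<Sum>c\<in>B. e c (h * S (S z2)) * ?G (e b) z1 c) b)"
  proof (rule sum.cong)
    fix b
    note [simp] = linD[OF e[of b]]
    have "?G (e b) z w = (\<Sum>c\<in>B. e c w * ?G (e b) z c)" for z w
      by (rule dual[symmetric]) (simp add: multilinear_simps)
    then have "(\<lambda>z1 z2. ?G (e b) z1 (h * S (S z2)))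
        = (\<lambda>z1 z2. \<Sum>c\<in>B. e c (h * S (S z2)) * ?G (e b) z1 c)"
      by (intro ext)
    then show "sw (\<lambda>x y. \<beta> x * e b (y * S (S b))) h
        = sw (\<lambda>z1 z2. \<Sum>c\<in>B. e c (h * S (S z2)) * ?G (e b) z1 c) b"
      by (simp only: unwind[OF e])
  qed simp
  also have "\<dots> = (\<Sum>c\<in>B. \<Sum>b\<in>B. sw (\<lambda>z1 z2. e c (h * S (S z2)) * ?G (e b) z1 c) b)"
    by (subst sum.swap) (simp add: sw_sum)
  also have "\<dots> = (\<Sum>c\<in>B. \<Sum>b\<in>B. sw (\<lambda>x y. e b y * sw (\<lambda>z1 z2. e c (h * S (S z2)) * \<beta> (x * S z1)) b) c)"
  proof (intro sum.cong refl)
    fix c b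
    have "sw (\<lambda>z1 z2. e c (h * S (S z2)) * ?G (e b) z1 c) b
        = sw (\<lambda>z1 z2. sw (\<lambda>x y. e c (h * S (S z2)) * (\<beta> (x * S z1) * e b y)) c) b"
      by (simp only: sw_mult_left)
    also have "\<dots> = sw (\<lambda>x y. sw (\<lambda>z1 z2. e c (h * S (S z2)) * (\<beta> (x * S z1) * e b y)) b) c"
      by (rule sw_swap)
    also have "\<dots> = sw (\<lambda>x y. e b y * sw (\<lambda>z1 z2. e c (h * S (S z2)) * \<beta> (x * S z1)) b) c"
      unfolding sw_mult_left[symmetric] by (simp add: mult_ac)
    finally show "sw (\<lambda>z1 z2. e c (h * S (S z2)) * ?G (e b) z1 c) b
        = sw (\<lambda>x y. e b y * sw (\<lambda>z1 z2. e c (h * S (S z2)) * \<beta> (x * S z1)) b) c" .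
  qed
  \<comment> \<open>Summing over \<open>b\<close> replaces the basis vector by the second leg of
    \<open>c\<close>, so three consecutive legs of \<open>c\<close> remain.\<close>
  also have "\<dots> = (\<Sum>c\<in>B. sw (\<lambda>x y. sw (\<lambda>z1 z2. e c (h * S (S z2)) * \<beta> (x * S z1)) y) c)"
  proof (intro sum.cong refl)
    fix c
    note [simp] = linD[OF e[of c]]
    have "(\<Sum>b\<in>B. e b y * sw (\<lambda>z1 z2. e c (h * S (S z2)) * \<beta> (x * S z1)) b)
        = sw (\<lambda>z1 z2. e c (h * S (S z2)) * \<beta> (x * S z1)) y" for x y
      by (rule dual) (simp add: multilinear_simps)
    then show "(\<Sum>b\<in>B. sw (\<lambda>x y. e b y * sw (\<lambda>z1 z2. e c (h * S (S z2)) * \<beta> (x * S z1)) b) c)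
        = sw (\<lambda>x y. sw (\<lambda>z1 z2. e c (h * S (S z2)) * \<beta> (x * S z1)) y) c"
      by (simp add: sw_sum[symmetric])
  qed
  also have "\<dots> = (\<Sum>c\<in>B. \<beta> 1 * e c (h * S (S c)))"
  proof (intro sum.cong refl)
    fix c
    note [simp] = linD[OF e[of c]]
    have "sw (\<lambda>x y. sw (\<lambda>z1 z2. e c (h * S (S z2)) * \<beta> (x * S z1)) y) c
        = sw (\<lambda>p z2. sw (\<lambda>x z1. e c (h * S (S z2)) * \<beta> (x * S z1)) p) c"
      by (rule sw_coassoc[symmetric]) (simp add: multilinear_simps)
    also have "\<dots> = sw (\<lambda>p z2. \<epsilon> p * (\<beta> 1 * e c (h * S (S z2)))) c"
      by (simp only: sw_mult_left sw_antipode_right[OF \<beta>], simp only: mult_ac)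
    also have "\<dots> = \<beta> 1 * e c (h * S (S c))"
      by (rule sw_counit_left) (simp add: multilinear_simps)
    finally show "sw (\<lambda>x y. sw (\<lambda>z1 z2. e c (h * S (S z2)) * \<beta> (x * S z1)) y) c
        = \<beta> 1 * e c (h * S (S c))" .
  qed
  also have "\<dots> = \<beta> 1 * trace_integral B e h"
    by (simp add: trace_integral_def sum_distrib_left)
  finally show "sw (\<lambda>x y. \<beta> x * trace_integral B e y) h = \<beta> 1 * trace_integral B e h" .
qed

text \<open>In \<Lambda>1 x1 \<otimes> \<Lambda>2 x2 S(x3), either \<Lambda> absorbs x1 and x2 as a
  right integral, or x2 S(x3) cancels.\<close>

lemma right_integral_antipode:
  assumes \<Lambda>: "\<And>h. \<Lambda> * h = hscale H (\<epsilon> h) \<Lambda>" and b: "bil b"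
  shows "sw (\<lambda>u v. b u (v * S x)) \<Lambda> = sw (\<lambda>u v. b (u * x) v) \<Lambda>"
proof -
  note [simp] = bilD[OF b]
  let ?F = "\<lambda>u v k1 k2 w. b (u * k1) (v * (k2 * S w))"
  have "sw (\<lambda>u v. sw (\<lambda>k1 k2. ?F u v k1 k2 w) k) \<Lambda> = \<epsilon> k * sw (\<lambda>u v. b u (v * S w)) \<Lambda>" for k w
    using sw_mult[of "\<lambda>u v. b u (v * S w)" \<Lambda> k]
    by (simp add: multilinear_simps \<Lambda>)
  moreover have "sw (\<lambda>k w. \<epsilon> k * sw (\<lambda>u v. b u (v * S w)) \<Lambda>) x = sw (\<lambda>u v. b u (v * S x)) \<Lambda>"
    by (rule sw_counit_left) (simp add: multilinear_simps)
  moreover have "sw (\<lambda>k w. sw (\<lambda>u v. sw (\<lambda>k1 k2. ?F u v k1 k2 w) k) \<Lambda>) x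
      = sw (\<lambda>u v. sw (\<lambda>k w. sw (\<lambda>k1 k2. ?F u v k1 k2 w) k) x) \<Lambda>"
    by (rule sw_swap)
  moreover have "sw (\<lambda>k w. sw (\<lambda>k1 k2. ?F u v k1 k2 w) k) x = b (u * x) v" for u v
  proof -
    have "sw (\<lambda>k w. sw (\<lambda>k1 k2. ?F u v k1 k2 w) k) x
        = sw (\<lambda>k1 q. sw (\<lambda>k2 w. ?F u v k1 k2 w) q) x"
      by (rule sw_coassoc) (simp add: multilinear_simps)
    moreover have "sw (\<lambda>k2 w. ?F u v k1 k2 w) q = \<epsilon> q * b (u * k1) v" for k1 q
      using sw_antipode_right[of "\<lambda>z. b (u * k1) (v * z)" q] by (simp add: multilinear_simps)
    moreover have "sw (\<lambda>k1 q. \<epsilon> q * b (u * k1) v) x = b (u * x) v"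
      by (rule sw_counit_right) (simp add: multilinear_simps)
    ultimately show ?thesis by simp
  qed
  ultimately show ?thesis by simp
qed

text \<open>Moving S(S(b)) from the second leg to the first by
  \<open>right_integral_antipode\<close> gives \<Lambda>1 S(b) paired with e_b(\<Lambda>2). Summing
  over the basis leaves \<Lambda>1 S(\<Lambda>2) = \<epsilon>(\<Lambda>) 1.\<close>

lemma trace_integral_dual:
  assumes e: "\<And>b. lin (e b)" and dual: "\<And>\<alpha> x. lin \<alpha> \<Longrightarrow> (\<Sum>b\<in>B. e b x * \<alpha> b) = \<alpha> x"
    and \<Lambda>: "\<And>h. \<Lambda> * h = hscale H (\<epsilon> h) \<Lambda>" and \<alpha>: "lin \<alpha>"
  shows "sw (\<lambda>u v. \<alpha> u * trace_integral B e v) \<Lambda> = \<epsilon> \<Lambda> * \<alpha> 1"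
proof -
  note [simp] = linD[OF \<alpha>] linD[OF e]
  have "sw (\<lambda>u v. \<alpha> u * trace_integral B e v) \<Lambda>
      = (\<Sum>b\<in>B. sw (\<lambda>u v. \<alpha> u * e b (v * S (S b))) \<Lambda>)"
    by (simp add: trace_integral_def sum_distrib_left sw_sum)
  also have "\<dots> = (\<Sum>b\<in>B. sw (\<lambda>u v. e b v * \<alpha> (u * S b)) \<Lambda>)"
    using right_integral_antipode[OF \<Lambda>, of "\<lambda>u v. \<alpha> u * e b v" "S b" for b]
    by (simp add: multilinear_simps mult.commute)
  also have "\<dots> = sw (\<lambda>u v. \<alpha> (u * S v)) \<Lambda>"
    using dual[of "\<lambda>z. \<alpha> (u * S z)" for u] by (simp add: sw_sum[symmetric] multilinear_simps)
  also have "\<dots> = \<epsilon> \<Lambda> * \<alpha> 1"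
    by (rule sw_antipode_right[OF \<alpha>])
  finally show ?thesis .
qed

text \<open>The formula \<epsilon>(\<Lambda>) x = \<Lambda>1 l(\<Lambda>2 S(x)) recovers
  \<open>x\<close> from the values l(v S(x)). In particular \<open>S\<close> is injective, hence
  surjective in finite dimension, and every \<open>h\<close> has the form S(z).\<close>

lemma dual_integral_nondegenerate:
  assumes fin: "finite_dimensional (hscale H)"
    and \<Lambda>: "\<And>h. \<Lambda> * h = hscale H (\<epsilon> h) \<Lambda>" "\<epsilon> \<Lambda> \<noteq> 0"
    and l: "lin l" "\<And>\<alpha>. lin \<alpha> \<Longrightarrow> sw (\<lambda>u v. \<alpha> u * l v) \<Lambda> = \<epsilon> \<Lambda> * \<alpha> 1"
    and h: "\<And>x. l (x * h) = 0"
  shows "h = 0"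
proof -
  have key: "\<epsilon> \<Lambda> * \<alpha> x = sw (\<lambda>u v. \<alpha> u * l (v * S x)) \<Lambda>" if \<alpha>: "lin \<alpha>" for \<alpha> x
  proof -
    note [simp] = linD[OF \<alpha>] linD[OF l(1)]
    have "\<epsilon> \<Lambda> * \<alpha> x = sw (\<lambda>u v. \<alpha> (u * x) * l v) \<Lambda>"
      using l(2)[of "\<lambda>z. \<alpha> (z * x)"] by (simp add: multilinear_simps)
    also have "\<dots> = sw (\<lambda>u v. \<alpha> u * l (v * S x)) \<Lambda>"
      using right_integral_antipode[OF \<Lambda>(1), of "\<lambda>u v. \<alpha> u * l v" x]
      by (simp add: multilinear_simps)
    finally show ?thesis .
  qed
  have zero: "x = 0" if "\<And>v. l (v * S x) = 0" for x
  proof (rule lin_eqI)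
    fix \<alpha> assume "lin \<alpha>"
    then show "\<alpha> x = \<alpha> 0"
      using key[of \<alpha> x] \<Lambda>(2) that sw_mult_left[of 0] by (simp add: lin_zero)
  qed
  obtain B :: "'h set" where B: "finite B" "HS.independent B" "HS.span B = UNIV"
    using finite_dual_basis[OF fin] by metis
  interpret F: finite_dimensional_vector_space "hscale H" B
    using B by unfold_locales auto
  have "inj S"
  proof (rule injI)
    fix x y assume "S x = S y"
    moreover have "S (x - y) + S y = S x"
      by (simp add: antipode_add[symmetric])
    ultimately have "S (x - y) = 0" by simp
    then have "x - y = 0" by (intro zero) (simp add: lin_zero[OF l(1)])
    then show "x = y" by simp
  qed
  then have "surj S"
    using F.linear_inj_imp_surj antipode_linear by blast
  then obtain z where "h = S z" by (metis surjD)
  with zero[of z] h show ?thesis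
    using antipode_add[of 0 0] by simp
qed

section \<open>Moving a factor across an integral of the dual\<close>

text \<open>The expression S(x1) x2 h1 l(x3 h2) is evaluated twice: by left invariance of
  \<open>l\<close> at the product of \<open>h\<close> with a leg of \<open>x\<close>, or by
  cancelling S(x1) x2.\<close>

lemma dual_left_integral_shift:
  assumes l: "dual_left_integral H l" and \<alpha>: "lin \<alpha>"
  shows "sw (\<lambda>u v. \<alpha> u * l (x * v)) h = sw (\<lambda>x1 x2. \<alpha> (S x1) * l (x2 * h)) x"
proof -
  note l' = l[unfolded dual_left_integral_iff]
  note [simp] = linD[OF \<alpha>] linD[OF conjunct1[OF l']]
  let ?F = "\<lambda>x1 y1 y2 u v. \<alpha> (S x1 * (y1 * u)) * l (y2 * v)"
  have "sw (\<lambda>y1 y2. sw (\<lambda>u v. ?F x1 y1 y2 u v) h) x2 = \<alpha> (S x1) * l (x2 * h)" for x1 x2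
    using conjunct2[OF l', rule_format, of "\<lambda>z. \<alpha> (S x1 * z)" "x2 * h"]
      sw_mult[of "\<lambda>p q. \<alpha> (S x1 * p) * l q" x2 h]
    by (simp add: multilinear_simps)
  then have "sw (\<lambda>x1 x2. \<alpha> (S x1) * l (x2 * h)) x
      = sw (\<lambda>x1 x2. sw (\<lambda>y1 y2. sw (\<lambda>u v. ?F x1 y1 y2 u v) h) x2) x"
    by simp
  also have "\<dots> = sw (\<lambda>p y2. sw (\<lambda>x1 y1. sw (\<lambda>u v. ?F x1 y1 y2 u v) h) p) x"
    by (rule sw_coassoc[symmetric]) (simp add: multilinear_simps)
  also have "\<dots> = sw (\<lambda>p y2. sw (\<lambda>u v. sw (\<lambda>x1 y1. ?F x1 y1 y2 u v) p) h) x"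
    by (subst (2) sw_swap) (rule refl)
  also have "\<dots> = sw (\<lambda>p y2. \<epsilon> p * sw (\<lambda>u v. \<alpha> u * l (y2 * v)) h) x"
  proof -
    have "sw (\<lambda>x1 y1. ?F x1 y1 y2 u v) p = \<epsilon> p * (\<alpha> u * l (y2 * v))" for p y2 u v
      using sw_antipode_left[of "\<lambda>z. \<alpha> (z * u) * l (y2 * v)" p] by (simp add: multilinear_simps)
    then show ?thesis by (simp add: sw_mult_left)
  qed
  also have "\<dots> = sw (\<lambda>u v. \<alpha> u * l (x * v)) h"
    by (rule sw_counit_left) (simp add: multilinear_simps)
  finally show ?thesis ..
qed

text \<open>Mirror image of the left shift: right invariance of \<open>l\<close> is applied to l(x1
  h1) S(h2) S(x2) x3, where S(x2) x3 can be cancelled instead.\<close>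

lemma dual_right_integral_shift:
  assumes l: "lin l" and r: "\<And>\<beta> h. lin \<beta> \<Longrightarrow> sw (\<lambda>x y. l x * \<beta> y) h = \<beta> 1 * l h" and \<alpha>: "lin \<alpha>"
  shows "sw (\<lambda>u v. l (x * u) * \<alpha> (S v)) h = sw (\<lambda>x1 x2. l (x1 * h) * \<alpha> x2) x"
proof -
  note [simp] = linD[OF \<alpha>] linD[OF l]
  let ?F = "\<lambda>y1 y2 u v x2. l (y1 * u) * \<alpha> (S v * (S y2 * x2))"
  have "sw (\<lambda>y1 y2. sw (\<lambda>u v. ?F y1 y2 u v x2) h) x1 = l (x1 * h) * \<alpha> x2" for x1 x2
    using r[of "\<lambda>z. \<alpha> (S z * x2)" "x1 * h"] sw_mult[of "\<lambda>p q. l p * \<alpha> (S q * x2)" x1 h]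
    by (simp add: multilinear_simps antipode_one antipode_mult)
  then have "sw (\<lambda>x1 x2. l (x1 * h) * \<alpha> x2) x
      = sw (\<lambda>x1 x2. sw (\<lambda>y1 y2. sw (\<lambda>u v. ?F y1 y2 u v x2) h) x1) x"
    by simp
  also have "\<dots> = sw (\<lambda>y1 q. sw (\<lambda>y2 x2. sw (\<lambda>u v. ?F y1 y2 u v x2) h) q) x"
    by (rule sw_coassoc) (simp add: multilinear_simps)
  also have "\<dots> = sw (\<lambda>y1 q. sw (\<lambda>u v. sw (\<lambda>y2 x2. ?F y1 y2 u v x2) q) h) x"
    by (subst (2) sw_swap) (rule refl)
  also have "\<dots> = sw (\<lambda>y1 q. \<epsilon> q * sw (\<lambda>u v. l (y1 * u) * \<alpha> (S v)) h) x"
  proof -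
    have "sw (\<lambda>y2 x2. ?F y1 y2 u v x2) q = \<epsilon> q * (l (y1 * u) * \<alpha> (S v))" for q y1 u v
      using sw_antipode_left[of "\<lambda>z. l (y1 * u) * \<alpha> (S v * z)" q] by (simp add: multilinear_simps)
    then show ?thesis by (simp only:, simp only: sw_mult_left)
  qed
  also have "\<dots> = sw (\<lambda>u v. l (x * u) * \<alpha> (S v)) h"
    by (rule sw_counit_right) (simp add: multilinear_simps)
  finally show ?thesis ..
qed

text \<open>In Sweedler notation, \<open>\<Lambda>\<^sub>(\<^sub>1\<^sub>) S(\<Lambda>\<^sub>(\<^sub>3\<^sub>)) \<otimes> \<Lambda>\<^sub>(\<^sub>2\<^sub>) = 1 \<otimes> \<Lambda>\<close>.\<close>

lemma semisimple_integral_coadjoint: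
  assumes fin: "finite_dimensional (hscale H)" and ss: "semisimple_ring TYPE('h)"
    and \<Lambda>: "left_integral H \<Lambda>" "\<Lambda> \<noteq> 0" and a: "distinguished_group_like H 1" and g: "bil g"
  shows "sw (\<lambda>p w. sw (\<lambda>u v. g (u * S w) v) p) \<Lambda> = g 1 \<Lambda>"
proof -
  obtain B and e :: "'h \<Rightarrow> 'h \<Rightarrow> 'k" where B: "finite B"
    and e: "\<And>b. lin (e b)" and dual: "\<And>\<alpha> x. lin \<alpha> \<Longrightarrow> (\<Sum>b\<in>B. e b x * \<alpha> b) = \<alpha> x"
    using finite_dual_basis[OF fin] by metis
  let ?l = "trace_integral B e"
  note right = semisimple_right_integral[OF ss \<Lambda>(1)]
  have \<epsilon>: "\<epsilon> \<Lambda> \<noteq> 0"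
    using semisimple_left_integral_counit[OF ss \<Lambda>(1)] \<Lambda>(2) by blast
  have l: "dual_left_integral H ?l"
    using e dual by (rule trace_integral_left)
  then have linl: "lin ?l" by (simp add: dual_left_integral_iff)
  \<comment> \<open>The distinguished group-like element being 1 makes the left integral of the dual
    a right integral too.\<close>
  have r: "sw (\<lambda>x y. ?l x * \<beta> y) h = \<beta> 1 * ?l h" if "lin \<beta>" for \<beta> h
    using a l that by (auto simp: distinguished_group_like_def conv_def sw_def lin_dual fun_eq_iff)
  have nondeg: "h = 0" if "\<And>x. ?l (x * h) = 0" for h
    using fin right \<epsilon> linl trace_integral_dual[OF e dual right] that
    by (rule dual_integral_nondegenerate)
  have tensor: "sw (\<lambda>p w. sw (\<lambda>u v. \<alpha> (u * S w) * \<beta> v) p) \<Lambda> = \<alpha> 1 * \<beta> \<Lambda>"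
    if \<alpha>: "lin \<alpha>" and \<beta>: "lin \<beta>" for \<alpha> \<beta>
  proof -
    note [simp] = linD[OF \<alpha>] linD[OF linl]
    \<comment> \<open>\<open>d\<close> is \<alpha> applied to the first factor of \<Lambda>1
      S(\<Lambda>3) \<otimes> \<Lambda>2. Nondegeneracy will show that it equals \<alpha>(1)
      \<Lambda>.\<close>
    define d where "d = lin_ext (hscale H) (\<lambda>(u, v, w). hscale H (\<alpha> (u * S w)) v) (comult3 H \<Lambda>)"
    have d: "\<gamma> d = sw (\<lambda>p w. sw (\<lambda>u v. \<alpha> (u * S w) * \<gamma> v) p) \<Lambda>" if "lin \<gamma>" for \<gamma>
      unfolding d_def lin_lin_ext[OF that] sw_comult3[symmetric]
      by (simp add: case_prod_unfold linD[OF that])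
    have "?l (x * d) = \<alpha> 1 * ?l (x * \<Lambda>)" for x
    proof -
      \<comment> \<open>The left shift takes \<open>x\<close> off \<Lambda>2, leaving S(x1) in
        front; the right shift then turns S(\<Lambda>3) into a leg of \<open>x\<close>. Finally
        \<Lambda> absorbs a leg of \<open>x\<close>, and S(x1) x2 cancels.\<close>
      have "?l (x * d) = sw (\<lambda>p w. sw (\<lambda>u v. \<alpha> (u * S w) * ?l (x * v)) p) \<Lambda>"
        by (rule d) (simp add: multilinear_simps)
      also have "\<dots> = sw (\<lambda>p w. sw (\<lambda>x1 x2. \<alpha> (S x1 * S w) * ?l (x2 * p)) x) \<Lambda>"
        using dual_left_integral_shift[OF l, of "\<lambda>z. \<alpha> (z * S w)" x for w]
        by (simp add: multilinear_simps)
      also have "\<dots> = sw (\<lambda>x1 x2. sw (\<lambda>p w. \<alpha> (S x1 * S w) * ?l (x2 * p)) \<Lambda>) x"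
        by (rule sw_swap)
      also have "\<dots> = sw (\<lambda>x1 x2. sw (\<lambda>y1 y2. ?l (y1 * \<Lambda>) * \<alpha> (S x1 * y2)) x2) x"
        using dual_right_integral_shift[OF linl r, of "\<lambda>z. \<alpha> (S x1 * z)" _ \<Lambda> for x1]
        by (simp add: multilinear_simps mult.commute)
      also have "\<dots> = sw (\<lambda>x1 x2. ?l \<Lambda> * \<alpha> (S x1 * x2)) x"
      proof -
        have "sw (\<lambda>y1 y2. ?l (y1 * \<Lambda>) * \<alpha> (S x1 * y2)) x2 = ?l \<Lambda> * \<alpha> (S x1 * x2)" for x1 x2
          using sw_counit_left[of "\<lambda>z. ?l \<Lambda> * \<alpha> (S x1 * z)" x2]
          by (simp add: multilinear_simps left_integralD[OF \<Lambda>(1)])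
        then show ?thesis by simp
      qed
      also have "\<dots> = \<alpha> 1 * ?l (x * \<Lambda>)"
        by (simp add: sw_mult_left sw_antipode_left[OF \<alpha>] left_integralD[OF \<Lambda>(1)] mult_ac)
      finally show ?thesis .
    qed
    then have "?l (x * (d - hscale H (\<alpha> 1) \<Lambda>)) = 0" for x
      by (simp add: right_diff_distrib scale_mult_right lin_diff[OF linl])
    then have "d - hscale H (\<alpha> 1) \<Lambda> = 0" by (rule nondeg)
    then have "d = hscale H (\<alpha> 1) \<Lambda>" by simp
    then show ?thesis using d[OF \<beta>] by (simp add: linD[OF \<beta>])
  qed
  note [simp] = bilD[OF g]
  \<comment> \<open>Expanding the second argument in the basis reduces a general bilinear form to
    products of two functionals.\<close>
  have "g u v = (\<Sum>b\<in>B. g u b * e b v)" for u v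
    using dual[of "g u" v] g by (simp add: bil_def mult.commute)
  then have "(\<lambda>u v. g (u * S w) v) = (\<lambda>u v. \<Sum>b\<in>B. g (u * S w) b * e b v)" for w
    by (intro ext)
  then have "sw (\<lambda>p w. sw (\<lambda>u v. g (u * S w) v) p) \<Lambda>
      = sw (\<lambda>p w. sw (\<lambda>u v. \<Sum>b\<in>B. g (u * S w) b * e b v) p) \<Lambda>"
    by (simp only:)
  also have "\<dots> = (\<Sum>b\<in>B. sw (\<lambda>p w. sw (\<lambda>u v. g (u * S w) b * e b v) p) \<Lambda>)"
    by (simp add: sw_sum)
  also have "\<dots> = (\<Sum>b\<in>B. g 1 b * e b \<Lambda>)"
    using tensor[of "\<lambda>u. g u b" "e b" for b] e by (simp add: multilinear_simps)
  also have "\<dots> = g 1 \<Lambda>"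
    using dual[of "g 1" \<Lambda>] g by (simp add: bil_def mult.commute)
  finally show ?thesis .
qed

end


section \<open>The bitensor product with a one-dimensional module-comodule\<close>

text \<open>The canonical identification of \<bbbk> \<otimes> N with \<open>N\<close>, on
  representatives.\<close>

definition contract :: "('k::field, 'h, 'v::ab_group_add) left_mc \<Rightarrow> ('k \<times> 'v \<Rightarrow>\<^sub>0 'k) \<Rightarrow> 'v" where
  "contract N t = lin_ext (scl N) (\<lambda>(x, n). scl N x n) t"

lemma right_char_simps [simp]:
  "rcar (right_char \<zeta> g) = UNIV" "rscl (right_char \<zeta> g) = (*)"
  "ract (right_char \<zeta> g) x h = \<zeta> h * x" "rcoact (right_char \<zeta> g) x = gen (x, g)"
  by (simp_all add: right_char_def)

lemma left_char_simps [simp]: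
  "car (left_char \<zeta> g) = UNIV" "scl (left_char \<zeta> g) = (*)"
  "act (left_char \<zeta> g) h x = \<zeta> h * x" "coact (left_char \<zeta> g) x = gen (g, x)"
  by (simp_all add: left_char_def)

lemma ball_Collect_triple:
  "(\<forall>r\<in>{F x h n |x h n. x \<in> A \<and> n \<in> C}. Q r) \<longleftrightarrow> (\<forall>x\<in>A. \<forall>n\<in>C. \<forall>h. Q (F x h n))"
  by blast

text \<open>The two nested spans merge into one, and the functions killing all its generators are
  the bilinear forms balanced over \<open>H\<close>. This is the counterpart of
  \<open>null2_iff\<close> for the tensor product over \<open>H\<close>.\<close>

lemma null_over_iff:
  "t \<in> null_over X N \<longleftrightarrow>
     (\<forall>b. (\<forall>n\<in>car N. linear_on (rscl X) (rcar X) (*) (\<lambda>x. b x n)) \<longrightarrow>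
          (\<forall>x\<in>rcar X. linear_on (scl N) (car N) (*) (b x)) \<longrightarrow>
          (\<forall>x\<in>rcar X. \<forall>n\<in>car N. \<forall>h. b (ract X x h) n = b x (act N h n)) \<longrightarrow>
        lin_ext (*) (\<lambda>(x, n). b x n) t = 0)"
proof -
  note E = lin_ext_simps[OF vector_space_field] lin_ext_gen[OF vector_space_field]
  let ?A = "(\<Union>w\<in>car N. slot_rels (rscl X) (rcar X) (\<lambda>v. (v, w))) \<union>
    (\<Union>v\<in>rcar X. slot_rels (scl N) (car N) (\<lambda>w. (v, w)))"
  let ?B = "{gen (ract X x h, n) - gen (x, act N h n) |x h n. x \<in> rcar X \<and> n \<in> car N}"
  have "free.span (free.span ?A \<union> ?B) = free.span (?A \<union> ?B)"
  proof (rule antisym)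
    have "free.span ?A \<subseteq> free.span (?A \<union> ?B)"
      by (rule free.span_mono) (rule Un_upper1)
    moreover have "?B \<subseteq> free.span (?A \<union> ?B)"
      by (rule order_trans[OF Un_upper2 free.span_superset])
    ultimately have "free.span ?A \<union> ?B \<subseteq> free.span (?A \<union> ?B)"
      by (rule Un_least)
    then show "free.span (free.span ?A \<union> ?B) \<subseteq> free.span (?A \<union> ?B)"
      by (rule free.span_minimal) (rule free.subspace_span)
    show "free.span (?A \<union> ?B) \<subseteq> free.span (free.span ?A \<union> ?B)"
      by (intro free.span_mono Un_mono free.span_superset order_refl)
  qed
  then have *: "null_over X N = free.span (?A \<union> ?B)"
    by (simp add: null_over_def null2_def)
  have B: "(\<forall>r\<in>?B. lin_ext (*) f r = 0) \<longleftrightarrow>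
      (\<forall>x\<in>rcar X. \<forall>n\<in>car N. \<forall>h. f (ract X x h, n) = f (x, act N h n))" for f
    by (subst ball_Collect_triple) (simp only: E right_minus_eq)
  show ?thesis
    unfolding * span_iff_lin_ext ball_Un ball_UN lin_ext_slot_rels B
  proof (intro iffI allI impI; (elim conjE)?)
    fix f
    assume "\<forall>b. (\<forall>n\<in>car N. linear_on (rscl X) (rcar X) (*) (\<lambda>x. b x n)) \<longrightarrow>
          (\<forall>x\<in>rcar X. linear_on (scl N) (car N) (*) (b x)) \<longrightarrow>
          (\<forall>x\<in>rcar X. \<forall>n\<in>car N. \<forall>h. b (ract X x h) n = b x (act N h n)) \<longrightarrow>
        lin_ext (*) (\<lambda>(x, n). b x n) t = 0"
      "\<forall>n\<in>car N. linear_on (rscl X) (rcar X) (*) (\<lambda>x. f (x, n))"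
      "\<forall>x\<in>rcar X. linear_on (scl N) (car N) (*) (\<lambda>n. f (x, n))"
      "\<forall>x\<in>rcar X. \<forall>n\<in>car N. \<forall>h. f (ract X x h, n) = f (x, act N h n)"
    from this(1)[rule_format, of "\<lambda>x n. f (x, n)"] this(2-4) show "lin_ext (*) f t = 0"
      by simp
  qed simp
qed

lemma subspace_null_over: "free.subspace (null_over X N)"
  by (simp add: null_over_def)

lemma tensor_class_eq_iff: "tensor_class X N t = tensor_class X N u \<longleftrightarrow> t - u \<in> null_over X N"
proof
  assume eq: "tensor_class X N t = tensor_class X N u"
  have "t \<in> tensor_class X N t"
    using free.subspace_0[OF subspace_null_over[of X N]] by (force simp: tensor_class_def)
  then obtain r where "t = u + r" "r \<in> null_over X N"
    unfolding eq by (auto simp: tensor_class_def)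
  then show "t - u \<in> null_over X N" by simp
next
  have sub: "tensor_class X N v \<subseteq> tensor_class X N w" if "v - w \<in> null_over X N" for v w
  proof
    fix y assume "y \<in> tensor_class X N v"
    then obtain r where r: "y = v + r" "r \<in> null_over X N" by (auto simp: tensor_class_def)
    have "y = w + ((v - w) + r)" using r by simp
    with free.subspace_add[OF subspace_null_over that r(2)] show "y \<in> tensor_class X N w"
      unfolding tensor_class_def by blast
  qed
  assume *: "t - u \<in> null_over X N"
  then have "u - t \<in> null_over X N"
    using free.subspace_neg[OF subspace_null_over *] by simp
  then show "tensor_class X N t = tensor_class X N u"
    using sub * by blast
qed

text \<open>Pulling a balanced form back along \<open>f\<close> gives a balanced form, so id
  \<otimes> f preserves the relations, and all sets in the union defining \<open>bit_map\<close>
  agree.\<close>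

lemma bit_map_class:
  assumes f: "linear_on (scl N) (car N) (scl N') f" "\<And>n. n \<in> car N \<Longrightarrow> f n \<in> car N'"
    and act: "\<And>h n. n \<in> car N \<Longrightarrow> f (act N h n) = act N' h (f n)"
    and N: "\<And>h n. n \<in> car N \<Longrightarrow> act N h n \<in> car N"
  shows "bit_map X N' f (tensor_class X N t)
    = tensor_class X N' (lin_ext fs_scale (\<lambda>(x, n). gen (x, f n)) t)" (is "_ = tensor_class X N' (?f t)")
proof -
  have null: "?f r \<in> null_over X N'" if r: "r \<in> null_over X N" for r
    unfolding null_over_iff
  proof (intro allI impI)
    fix b assume b: "\<forall>n\<in>car N'. linear_on (rscl X) (rcar X) (*) (\<lambda>x. b x n)"
      "\<forall>x\<in>rcar X. linear_on (scl N') (car N') (*) (b x)"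
      "\<forall>x\<in>rcar X. \<forall>n\<in>car N'. \<forall>h. b (ract X x h) n = b x (act N' h n)"
    have "lin_ext (*) (\<lambda>(x, n). b x (f n)) r = 0"
      by (rule r[unfolded null_over_iff, rule_format, of "\<lambda>x n. b x (f n)"])
        (use b f act in \<open>auto simp: linear_on_iff\<close>)
    then show "lin_ext (*) (\<lambda>(x, n). b x n) (?f r) = 0"
      by (simp add: lin_ext_comp[OF vector_space_field] lin_ext_gen[OF vector_space_field]
          case_prod_unfold)
  qed
  have "tensor_class X N' (?f u) = tensor_class X N' (?f t)" if u: "u \<in> tensor_class X N t" for u
  proof -
    obtain r where r: "u = t + r" "r \<in> null_over X N" using u by (auto simp: tensor_class_def)
    have "?f u - ?f t = ?f r" using r(1) by (simp add: lin_ext_simps[OF vector_space_fs_scale])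
    then show ?thesis using null[OF r(2)] by (simp add: tensor_class_eq_iff)
  qed
  then have "bit_map X N' f (tensor_class X N t)
      = (\<Union>u\<in>tensor_class X N t. tensor_class X N' (?f t))"
    unfolding bit_map_def by (rule SUP_cong[OF refl])
  moreover have "t \<in> tensor_class X N t"
    using free.subspace_0[OF subspace_null_over[of X N]] by (force simp: tensor_class_def)
  ultimately show ?thesis by blast
qed

context hopf_algebra
begin

section \<open>Coinvariants, classes and morphisms from the trivial module\<close>

lemma null_HN_iff:
  "t \<in> null_HN H N \<longleftrightarrow>
     (\<forall>b. (\<forall>n\<in>car N. lin (\<lambda>x. b x n)) \<longrightarrow> (\<forall>x. linear_on (scl N) (car N) (*) (b x)) \<longrightarrow>
        lin_ext (*) (\<lambda>(x, n). b x n) t = 0)"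
  unfolding null2_iff lin_def linear_on_iff by simp

lemma left_moduleD:
  assumes "left_module H N"
  shows "vector_space (scl N)" "module.subspace (scl N) (car N)"
    "n \<in> car N \<Longrightarrow> act N h n \<in> car N" "linear_on (scl N) (car N) (scl N) (act N h)"
    "n \<in> car N \<Longrightarrow> act N (g + h) n = act N g n + act N h n"
    "n \<in> car N \<Longrightarrow> act N (hscale H c h) n = scl N c (act N h n)"
    "n \<in> car N \<Longrightarrow> act N 1 n = n"
    "n \<in> car N \<Longrightarrow> act N (g * h) n = act N g (act N h n)"
  using assms by (simp_all add: left_module_def linear_on_iff)

text \<open>The coaction is linear only modulo relations; a bilinear form kills these, so the
  composite is linear in the strict sense.\<close>

lemma linear_on_coact:
  assumes N: "left_comodule H N"
    and b: "\<And>n. n \<in> car N \<Longrightarrow> lin (\<lambda>x. b x n)" "\<And>x. linear_on (scl N) (car N) (*) (b x)"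
  shows "linear_on (scl N) (car N) (*) (\<lambda>n. lin_ext (*) (\<lambda>(x, m). b x m) (coact N n))"
proof -
  have "linear_mod (scl N) (car N) fs_scale (null_HN H N) (coact N)"
    using N by (simp add: left_comodule_def)
  with b show ?thesis
    unfolding linear_mod_def null_HN_iff
    by (auto simp: lin_ext_field_simps)
qed

text \<open>Together with \<open>gen_cotensor\<close>, this identifies the cotensor product with the
  vectors whose coaction is g \<otimes> n.\<close>

lemma cotensor_coinvariant:
  assumes N: "left_comodule H N" and t: "t \<in> cotensor H (right_char \<zeta> g) N"
  shows "contract N t \<in> car N" "coact N (contract N t) - gen (g, contract N t) \<in> null_HN H N"
proof -
  have vs: "vector_space (scl N)" and sub: "module.subspace (scl N) (car N)"
    using N by (simp_all add: left_comodule_def)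
  interpret vector_space "scl N" by fact
  have keys: "snd p \<in> car N" if "p \<in> Poly_Mapping.keys t" for p
    using t that by (auto simp: cotensor_def)
  then have mem: "(\<lambda>(x, n). scl N x n) p \<in> car N" if "p \<in> Poly_Mapping.keys t" for p
    using that subspace_scale[OF sub] by (auto simp: case_prod_unfold)
  show "contract N t \<in> car N"
    unfolding contract_def by (rule lin_ext_in[OF vs sub mem])
  have push: "f (contract N t) = lin_ext (*) (\<lambda>(x, n). x * f n) t"
    if f: "linear_on (scl N) (car N) (*) f" for f
  proof -
    have "f (contract N t) = lin_ext (*) (\<lambda>p. f ((\<lambda>(x, n). scl N x n) p)) t"
      unfolding contract_def by (rule linear_on_lin_ext[OF vs vector_space_field sub f mem])
    also have "\<dots> = lin_ext (*) (\<lambda>(x, n). x * f n) t"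
      using f keys by (intro lin_ext_cong) (auto simp: linear_on_iff)
    finally show ?thesis .
  qed
  show "coact N (contract N t) - gen (g, contract N t) \<in> null_HN H N"
    unfolding null_HN_iff
  proof (intro allI impI)
    fix b assume b: "\<forall>n\<in>car N. lin (\<lambda>x. b x n)" "\<forall>x. linear_on (scl N) (car N) (*) (b x)"
    let ?T = "\<lambda>n. lin_ext (*) (\<lambda>(x, m). b x m) (coact N n)"
    \<comment> \<open>The cotensor relation is tested on forms that multiply by the scalar factor;
      after contraction only \<open>b\<close> remains.\<close>
    have "lin_ext (*) (\<lambda>(x, h, n). x * b h n)
       (lin_ext fs_scale (\<lambda>(x, n). lin_ext fs_scale (\<lambda>(x0, h). gen (x0, h, n)) (gen (x, g))) t
        - lin_ext fs_scale (\<lambda>(x, n). lin_ext fs_scale (\<lambda>(h, n0). gen (x, h, n0)) (coact N n)) t) = 0"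
    proof -
      have "lin_ext fs_scale (\<lambda>(x, n). lin_ext fs_scale (\<lambda>(x0, h). gen (x0, h, n)) (gen (x, g))) t
        - lin_ext fs_scale (\<lambda>(x, n). lin_ext fs_scale (\<lambda>(h, n0). gen (x, h, n0)) (coact N n)) t
        \<in> null3 (*) UNIV (hscale H) UNIV (scl N) (car N)"
        using t by (simp add: cotensor_def)
      then show ?thesis
        unfolding null3_iff
        by (elim allE[of _ "\<lambda>x h n. x * b h n"])
          (use b in \<open>auto simp: linear_on_iff lin_def algebra_simps\<close>)
    qed
    then have "lin_ext (*) (\<lambda>(x, n). x * b g n) t = lin_ext (*) (\<lambda>(x, n). x * ?T n) t"
      by (simp add: lin_ext_field_simps lin_ext_gen[OF vector_space_fs_scale] case_prod_unfold
          lin_ext_scale_fun[OF vector_space_field])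
    then have "b g (contract N t) = ?T (contract N t)"
      using push[of "b g"] push[of ?T] linear_on_coact[OF N] b by auto
    then show "lin_ext (*) (\<lambda>(x, n). b x n) (coact N (contract N t) - gen (g, contract N t)) = 0"
      by (simp add: lin_ext_field_simps)
  qed
qed

lemma gen_cotensor:
  assumes n: "n \<in> car N" "coact N n - gen (g, n) \<in> null_HN H N"
  shows "gen (1, n) \<in> cotensor H (right_char \<zeta> g) N"
proof -
  have "gen (1, g, n) - lin_ext fs_scale (\<lambda>(h, n0). gen (1, h, n0)) (coact N n)
      \<in> null3 (*) UNIV (hscale H) UNIV (scl N) (car N)"
    unfolding null3_iff
  proof (intro allI impI)
    fix b assume b: "\<forall>w\<in>UNIV. \<forall>z\<in>car N. linear_on (*) UNIV (*) (\<lambda>v. b v w z)"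
      "\<forall>v\<in>UNIV. \<forall>z\<in>car N. linear_on (hscale H) UNIV (*) (\<lambda>w. b v w z)"
      "\<forall>v\<in>UNIV. \<forall>w\<in>UNIV. linear_on (scl N) (car N) (*) (b v w)"
    have "lin_ext (*) (\<lambda>(x, m). b 1 x m) (coact N n - gen (g, n)) = 0"
      by (rule n(2)[unfolded null_HN_iff, rule_format, of "b 1"])
        (use b in \<open>auto simp: linear_on_iff lin_def\<close>)
    then show "lin_ext (*) (\<lambda>(v, w, z). b v w z)
        (gen (1, g, n) - lin_ext fs_scale (\<lambda>(h, n0). gen (1, h, n0)) (coact N n)) = 0"
      by (simp add: lin_ext_field_simps case_prod_unfold)
  qed
  then show ?thesis
    using n(1) by (simp add: cotensor_def lin_ext_gen[OF vector_space_fs_scale])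
qed

text \<open>Linearity in the scalar slot gives \<open>b x n = x * b 1 n\<close>, so no form
  distinguishes \<open>t\<close> from a pure tensor with first factor 1.\<close>

lemma class_gen_contract:
  assumes N: "left_module H N" and t: "Poly_Mapping.keys t \<subseteq> UNIV \<times> car N"
  shows "t - gen (1, contract N t) \<in> null_over (right_char \<zeta> g) N"
  unfolding null_over_iff
proof (intro allI impI)
  fix b
  assume 1: "\<forall>n\<in>car N. linear_on (rscl (right_char \<zeta> g)) (rcar (right_char \<zeta> g)) (*) (\<lambda>x. b x n)"
    and "\<forall>x\<in>rcar (right_char \<zeta> g). linear_on (scl N) (car N) (*) (b x)"
  then have b1: "linear_on (scl N) (car N) (*) (b 1)" by simp
  have b: "b x n = x * b 1 n" if "n \<in> car N" for x n
  proof -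
    have "b (x * 1) n = x * b 1 n"
      using 1 that unfolding linear_on_iff right_char_simps by blast
    then show ?thesis by simp
  qed
  interpret vector_space "scl N" by (rule left_moduleD[OF N])
  have mem: "(\<lambda>(x, n). scl N x n) p \<in> car N" if "p \<in> Poly_Mapping.keys t" for p
    using t that subspace_scale[OF left_moduleD(2)[OF N]] by (auto simp: case_prod_unfold)
  have "b 1 (contract N t) = lin_ext (*) (\<lambda>p. b 1 ((\<lambda>(x, n). scl N x n) p)) t"
    unfolding contract_def
    by (rule linear_on_lin_ext[OF left_moduleD(1)[OF N] vector_space_field left_moduleD(2)[OF N] b1 mem])
  also have "\<dots> = lin_ext (*) (\<lambda>(x, n). b x n) t"
  proof (rule lin_ext_cong)
    fix p assume p: "p \<in> Poly_Mapping.keys t"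
    obtain x n where xn: "p = (x, n)" by (cases p)
    then have "n \<in> car N" using p t by auto
    with xn b1 b[of n x] show "b 1 ((\<lambda>(x, n). scl N x n) p) = (\<lambda>(x, n). b x n) p"
      by (simp add: linear_on_iff)
  qed
  finally show "lin_ext (*) (\<lambda>(x, n). b x n) (t - gen (1, contract N t)) = 0"
    by (simp add: lin_ext_field_simps)
qed

text \<open>A linear map that turns the action into \<epsilon> factors through N/(ker \<epsilon>)N.
  It is applied to the action of the integral and to the identity of a trivial module.\<close>

lemma null_over_contract:
  assumes N: "left_module H N" and r: "r \<in> null_over (right_char \<epsilon> g) N"
    and s: "vector_space s" and \<phi>: "linear_on (scl N) (car N) s \<phi>"
    and inv: "\<And>h n. n \<in> car N \<Longrightarrow> \<phi> (act N h n) = s (\<epsilon> h) (\<phi> n)"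
  shows "contract N r \<in> car N" "\<phi> (contract N r) = 0"
proof -
  interpret s: vector_space s by fact
  interpret V: vector_space "scl N" by (rule left_moduleD[OF N])
  note sub = left_moduleD(2)[OF N] and mod = left_moduleD[OF N]
  note C = lin_ext_simps[OF mod(1)] lin_ext_gen[OF mod(1)]
  have \<phi>0: "\<phi> 0 = 0"
    using \<phi> V.subspace_0[OF sub] by (metis linear_on_iff s.scale_zero_left V.scale_zero_left)
  have "free.subspace {r. contract N r = 0}"
    by (rule free.subspaceI) (simp_all add: contract_def C)
  then have null2: "null2 (*) UNIV (scl N) (car N) \<subseteq> {r. contract N r = 0}"
    unfolding null2_def
    by (intro free.span_minimal) (auto simp: slot_rels_def contract_def C V.scale_left_distrib
        V.scale_right_distrib V.scale_scale mult.commute)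
  let ?K = "{r. contract N r \<in> car N \<and> \<phi> (contract N r) = 0}"
  have "free.subspace ?K"
    by (rule free.subspaceI)
      (use \<phi> V.subspace_0[OF sub] V.subspace_add[OF sub] V.subspace_scale[OF sub] \<phi>0 in
        \<open>auto simp: contract_def C linear_on_iff\<close>)
  moreover have "null2 (*) UNIV (scl N) (car N) \<subseteq> ?K"
    using null2 V.subspace_0[OF sub] \<phi>0 by auto
  moreover have "gen (\<epsilon> h * x, n) - gen (x, act N h n) \<in> ?K" if n: "n \<in> car N" for x h n
  proof -
    have c: "contract N (gen (\<epsilon> h * x, n) - gen (x, act N h n))
        = scl N (\<epsilon> h * x) n - scl N x (act N h n)" (is "_ = ?d")
      by (simp add: contract_def C)
    have mem: "?d \<in> car N" "scl N x (act N h n) \<in> car N"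
      using n mod(3) V.subspace_diff[OF sub] V.subspace_scale[OF sub] by auto
    have "\<phi> ?d + \<phi> (scl N x (act N h n)) = \<phi> (scl N (\<epsilon> h * x) n)"
      using \<phi> mem by (simp add: linear_on_iff) (metis diff_add_cancel)
    then have "\<phi> ?d = 0"
      using \<phi> n mod(3) inv[OF n] by (simp add: linear_on_iff mult.commute)
    with mem c show ?thesis by simp
  qed
  ultimately have "null_over (right_char \<epsilon> g) N \<subseteq> ?K"
    unfolding null_over_def by (intro free.span_minimal) auto
  with r show "contract N r \<in> car N" "\<phi> (contract N r) = 0" by auto
qed

text \<open>A morphism is determined by its value at 1. Only a comodule is assumed, so compatibility
  of the action with scalars on the line through \<open>m\<close> is listed separately.\<close>

lemma yd_hom_trivial_iff:
  assumes N: "left_comodule H N"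
  shows "f \<in> yd_hom H (left_char \<epsilon> 1) N \<longleftrightarrow>
    (\<exists>m\<in>car N. (\<forall>h. act N h m = scl N (\<epsilon> h) m) \<and> coact N m - gen (1, m) \<in> null_HN H N \<and>
      (\<forall>h x. act N h (scl N x m) = scl N x (act N h m)) \<and> f = (\<lambda>x. scl N x m))"
    (is "?L \<longleftrightarrow> ?R")
proof
  interpret vector_space "scl N" using N by (simp add: left_comodule_def)
  assume f: ?L
  then have lin: "f (c * x) = scl N c (f x)" for c x
    by (simp add: yd_hom_def linear_on_iff)
  have f1: "f x = scl N x (f 1)" for x
    using lin[of x 1] by simp
  have mem: "f 1 \<in> car N" and act: "f (\<epsilon> h * x) = act N h (f x)"
    and co: "coact N (f 1) - gen (1, f 1) \<in> null_HN H N" for h x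
    using f by (simp_all add: yd_hom_def lin_ext_gen[OF vector_space_fs_scale])
  have "act N h (f 1) = scl N (\<epsilon> h) (f 1)" for h
    using act[of h 1] lin[of "\<epsilon> h" 1] by simp
  moreover have "act N h (scl N x (f 1)) = scl N x (act N h (f 1))" for h x
    using act[of h x] act[of h 1] f1[of x] f1[of "\<epsilon> h * x"] lin[of "\<epsilon> h" 1]
    by (simp add: scale_scale mult.commute)
  moreover have "f = (\<lambda>x. scl N x (f 1))"
    using f1 by (intro ext)
  ultimately show ?R using mem co by blast
next
  interpret vector_space "scl N" using N by (simp add: left_comodule_def)
  have sub: "subspace (car N)" using N by (simp add: left_comodule_def)
  assume ?R
  then obtain m where m: "m \<in> car N" "\<And>h. act N h m = scl N (\<epsilon> h) m"
    "coact N m - gen (1, m) \<in> null_HN H N" "\<And>h x. act N h (scl N x m) = scl N x (act N h m)"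
    and f: "f = (\<lambda>x. scl N x m)" by blast
  have "coact N (scl N x m) - gen (1, scl N x m) \<in> null_HN H N" for x
    unfolding null_HN_iff
  proof (intro allI impI)
    fix b assume b: "\<forall>n\<in>car N. lin (\<lambda>x. b x n)" "\<forall>x. linear_on (scl N) (car N) (*) (b x)"
    have "lin_ext (*) (\<lambda>(x, n). b x n) (coact N m - gen (1, m)) = 0"
      using m(3) b unfolding null_HN_iff by blast
    moreover have "lin_ext (*) (\<lambda>(x, n). b x n) (coact N (scl N x m))
        = x * lin_ext (*) (\<lambda>(x, n). b x n) (coact N m)"
      using linear_on_coact[OF N, of b] b m(1) by (simp add: linear_on_iff)
    ultimately show "lin_ext (*) (\<lambda>(x, n). b x n) (coact N (scl N x m) - gen (1, scl N x m)) = 0"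
      using b m(1) by (simp add: lin_ext_field_simps linear_on_iff)
  qed
  then show ?L
    using m subspace_scale[OF sub m(1)]
    by (simp add: f yd_hom_def linear_on_iff lin_ext_gen[OF vector_space_fs_scale]
        scale_left_distrib scale_scale mult.commute)
qed


section \<open>The natural isomorphism in the semisimple case\<close>

text \<open>Classes are sets of formal sums, so a representative is chosen; the following lemma
  gives independence of the choice. The factor \<open>x\<close> turns the vector \<Lambda> n into a
  map on \<bbbk>.\<close>

definition integral_map ::
  "'h \<Rightarrow> ('k, 'h, 'v::ab_group_add) left_mc \<Rightarrow> ('k \<times> 'v \<Rightarrow>\<^sub>0 'k) set \<Rightarrow> 'k \<Rightarrow> 'v" where
  "integral_map \<Lambda> N C = (\<lambda>x. scl N x (act N \<Lambda> (contract N (SOME t. t \<in> C))))"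

text \<open>Two representatives differ by a relation over \<open>H\<close>, and \<Lambda> h =
  \<epsilon>(h) \<Lambda> makes the action of \<Lambda> vanish on its contraction.\<close>

lemma integral_map_class:
  assumes N: "left_module H N" and t: "Poly_Mapping.keys t \<subseteq> UNIV \<times> car N"
    and \<Lambda>: "\<And>h. \<Lambda> * h = hscale H (\<epsilon> h) \<Lambda>"
  shows "integral_map \<Lambda> N (tensor_class (right_char \<epsilon> g) N t)
    = (\<lambda>x. scl N x (act N \<Lambda> (contract N t)))"
proof -
  note mod = left_moduleD[OF N]
  interpret vector_space "scl N" by (rule mod)
  let ?C = "tensor_class (right_char \<epsilon> g) N t"
  have "t \<in> ?C"
    using free.subspace_0[OF subspace_null_over[of "right_char \<epsilon> g" N]]
    by (force simp: tensor_class_def)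
  then have "(SOME t. t \<in> ?C) \<in> ?C" by (rule someI)
  then obtain r where r: "(SOME t. t \<in> ?C) = t + r" "r \<in> null_over (right_char \<epsilon> g) N"
    by (auto simp: tensor_class_def)
  have "contract N r \<in> car N" "act N \<Lambda> (contract N r) = 0"
    using null_over_contract[OF N r(2) mod(1) mod(4)[of \<Lambda>]] mod(6,8) \<Lambda> by metis+
  moreover have "contract N t \<in> car N"
    unfolding contract_def using t subspace_scale[OF mod(2)]
    by (intro lin_ext_in[OF mod(1,2)]) auto
  moreover have "contract N (t + r) = contract N t + contract N r"
    by (simp add: contract_def lin_ext_simps[OF mod(1)])
  ultimately show ?thesis
    using mod(4)[of \<Lambda>] by (simp add: integral_map_def r(1) linear_on_iff)
qed

text \<open>For a coinvariant \<open>n\<close> the Yetter--Drinfeld condition makes the coaction of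
  \<Lambda> n equal to \<Lambda>1 S(\<Lambda>3) \<otimes> \<Lambda>2 n, which the hypothesis on
  \<Lambda> collapses.\<close>

lemma integral_coinvariant:
  assumes N: "yetter_drinfeld H N" and n: "n \<in> car N" "coact N n - gen (1, n) \<in> null_HN H N"
    and \<Lambda>: "\<And>g. bil g \<Longrightarrow> sw (\<lambda>p w. sw (\<lambda>u v. g (u * S w) v) p) \<Lambda> = g 1 \<Lambda>"
  shows "coact N (act N \<Lambda> n) - gen (1, act N \<Lambda> n) \<in> null_HN H N"
  unfolding null_HN_iff
proof (intro allI impI)
  fix b assume b: "\<forall>n\<in>car N. lin (\<lambda>x. b x n)" "\<forall>x. linear_on (scl N) (car N) (*) (b x)"
  have mod: "left_module H N" using N by (simp add: yetter_drinfeld_def)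
  note modD = left_moduleD[OF mod]
  have *: "lin_ext (*) (\<lambda>(x, m). b (u * x * S w) (act N v m)) (coact N n) = b (u * S w) (act N v n)"
    for u v w
  proof -
    have "lin_ext (*) (\<lambda>(x, m). b (u * x * S w) (act N v m)) (coact N n - gen (1, n)) = 0"
      by (rule n(2)[unfolded null_HN_iff, rule_format, of "\<lambda>x m. b (u * x * S w) (act N v m)"])
        (use b modD(3,4) in \<open>auto simp: lin_def linear_on_iff distrib_left distrib_right
            scale_mult_left scale_mult_right\<close>)
    then show ?thesis by (simp add: lin_ext_field_simps)
  qed
  have "lin_ext (*) (\<lambda>(x, m). b x m) (coact N (act N \<Lambda> n)
      - lin_ext fs_scale (\<lambda>(h1, h2, h3). lin_ext fs_scale
             (\<lambda>(x, m). gen (h1 * x * S h3, act N h2 m)) (coact N n)) (comult3 H \<Lambda>)) = 0"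
    using N n(1) b unfolding yetter_drinfeld_def null_HN_iff by blast
  then have "lin_ext (*) (\<lambda>(x, m). b x m) (coact N (act N \<Lambda> n))
      = lin_ext (*) (\<lambda>(u, v, w). b (u * S w) (act N v n)) (comult3 H \<Lambda>)"
    using * by (simp add: lin_ext_field_simps case_prod_unfold)
  also have "\<dots> = sw (\<lambda>p w. sw (\<lambda>u v. b (u * S w) (act N v n)) p) \<Lambda>"
    by (rule sw_comult3)
  also have "\<dots> = b 1 (act N \<Lambda> n)"
    using b modD(3,5,6) n(1) by (intro \<Lambda>) (auto simp: bil_def lin_def linear_on_iff)
  finally show "lin_ext (*) (\<lambda>(x, m). b x m) (coact N (act N \<Lambda> n) - gen (1, act N \<Lambda> n)) = 0"
    by (simp add: lin_ext_field_simps)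
qed

lemma cotensor_keys: "t \<in> cotensor H (right_char \<zeta> g) N \<Longrightarrow> Poly_Mapping.keys t \<subseteq> UNIV \<times> car N"
  by (simp add: cotensor_def)

lemma cotensor_add:
  assumes "s \<in> cotensor H X N" "t \<in> cotensor H X N"
  shows "s + t \<in> cotensor H X N"
proof -
  note E = lin_ext_simps[OF vector_space_fs_scale]
  have "free.subspace (null3 (rscl X) (rcar X) (hscale H) UNIV (scl N) (car N))"
    by (simp add: null3_def)
  from free.subspace_add[OF this] assms show ?thesis
    using Poly_Mapping.keys_add[of s t]
    by (fastforce simp: cotensor_def E algebra_simps)
qed

lemma cotensor_scale:
  assumes "t \<in> cotensor H X N"
  shows "fs_scale c t \<in> cotensor H X N"
proof -
  note E = lin_ext_simps[OF vector_space_fs_scale]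
  have "free.subspace (null3 (rscl X) (rcar X) (hscale H) UNIV (scl N) (car N))"
    by (simp add: null3_def)
  from free.subspace_scale[OF this] assms show ?thesis
    by (auto simp: cotensor_def E in_keys_iff free.scale_right_diff_distrib[symmetric])
qed

lemma integral_map_iso:
  assumes N: "yetter_drinfeld H N"
    and \<Lambda>: "left_integral H \<Lambda>" "\<And>h. \<Lambda> * h = hscale H (\<epsilon> h) \<Lambda>" "\<epsilon> \<Lambda> \<noteq> 0"
      "\<And>g. bil g \<Longrightarrow> sw (\<lambda>p w. sw (\<lambda>u v. g (u * S w) v) p) \<Lambda> = g 1 \<Lambda>"
  shows "bit_hom_iso H (right_char \<epsilon> 1) N (integral_map \<Lambda> N)"
proof -
  let ?X = "right_char \<epsilon> 1"
  have mod: "left_module H N" and com: "left_comodule H N"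
    using N by (simp_all add: yetter_drinfeld_def)
  note modD = left_moduleD[OF mod]
  interpret vector_space "scl N" by (rule modD)
  note cls = integral_map_class[OF mod cotensor_keys \<Lambda>(2)]
  note mem = cotensor_coinvariant[OF com]
  have add: "contract N (s + t) = contract N s + contract N t"
    and scale: "contract N (fs_scale c t) = scl N c (contract N t)"
    and diff: "contract N (s - t) = contract N s - contract N t" for s t c
    by (simp_all add: contract_def lin_ext_simps[OF modD(1)])
  have act_simps: "act N h (x + y) = act N h x + act N h y" "act N h (scl N c x) = scl N c (act N h x)"
    if "x \<in> car N" "y \<in> car N" for h x y c
    using modD(4)[of h] that by (simp_all add: linear_on_iff)
  have eq_iff: "tensor_class ?X N s = tensor_class ?X N t"
    if s: "s \<in> cotensor H ?X N" and t: "t \<in> cotensor H ?X N"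
      and eq: "act N \<Lambda> (contract N s) = act N \<Lambda> (contract N t)" for s t
  proof -
    let ?n = "contract N s - contract N t"
    have n: "?n \<in> car N" using mem s t subspace_diff[OF modD(2)] by blast
    have "act N \<Lambda> ?n + act N \<Lambda> (contract N t) = act N \<Lambda> (contract N s)"
      using act_simps(1)[OF n mem(1)[OF t], of \<Lambda>] by simp
    then have "act N \<Lambda> ?n = 0" using eq by simp
    \<comment> \<open>Over \<open>H\<close>, the tensor \<epsilon>(\<Lambda>) \<otimes> n equals 1
      \<otimes> \<Lambda> n, which is zero here. As \<epsilon>(\<Lambda>) is invertible, the class
      of 1 \<otimes> n is zero, which is injectivity.\<close>
    moreover have "gen (\<epsilon> \<Lambda> * 1, ?n) - gen (1, act N \<Lambda> ?n) \<in> null_over ?X N"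
      unfolding null_over_def
      by (rule free.span_base, rule UnI2, unfold mem_Collect_eq right_char_simps) (use n in blast)
    ultimately have 1: "gen (\<epsilon> \<Lambda>, ?n) - gen (1, 0) \<in> null_over ?X N" by simp
    have "s - t \<in> null_over ?X N"
      unfolding null_over_iff
    proof (intro allI impI)
      fix b assume b: "\<forall>n\<in>car N. linear_on (rscl ?X) (rcar ?X) (*) (\<lambda>x. b x n)"
        "\<forall>x\<in>rcar ?X. linear_on (scl N) (car N) (*) (b x)"
        "\<forall>x\<in>rcar ?X. \<forall>n\<in>car N. \<forall>h. b (ract ?X x h) n = b x (act N h n)"
      have keys: "Poly_Mapping.keys (s - t) \<subseteq> UNIV \<times> car N"
        using cotensor_keys[OF s] cotensor_keys[OF t] Poly_Mapping.keys_diff[of s t] by blast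
      have "lin_ext (*) (\<lambda>(x, n). b x n) (gen (\<epsilon> \<Lambda>, ?n) - gen (1, 0)) = 0"
        using 1[unfolded null_over_iff] b by blast
      then have "b (\<epsilon> \<Lambda>) ?n = b 1 0" by (simp add: lin_ext_field_simps)
      moreover have "b 1 0 = 0"
        using b(2) subspace_0[OF modD(2)]
        by (metis UNIV_I linear_on_iff mult_zero_left right_char_simps(1) scale_zero_left)
      moreover have "b (\<epsilon> \<Lambda> * 1) ?n = \<epsilon> \<Lambda> * b 1 ?n"
        using b(1) n unfolding linear_on_iff right_char_simps by blast
      ultimately have "b 1 ?n = 0" using \<Lambda>(3) by simp
      moreover have "lin_ext (*) (\<lambda>(x, n). b x n) (s - t - gen (1, contract N (s - t))) = 0"
        using class_gen_contract[OF mod keys, of \<epsilon> 1, unfolded null_over_iff] b by blast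
      ultimately show "lin_ext (*) (\<lambda>(x, n). b x n) (s - t) = 0"
        by (simp add: lin_ext_field_simps diff)
    qed
    then show ?thesis by (simp add: tensor_class_eq_iff)
  qed
  have inj: "inj_on (integral_map \<Lambda> N) (bit H ?X N)"
  proof (rule inj_onI)
    fix C D assume C: "C \<in> bit H ?X N" and D: "D \<in> bit H ?X N"
      and eq: "integral_map \<Lambda> N C = integral_map \<Lambda> N D"
    obtain s t where s: "C = tensor_class ?X N s" "s \<in> cotensor H ?X N"
      and t: "D = tensor_class ?X N t" "t \<in> cotensor H ?X N"
      using C D by (auto simp: bit_def)
    have "scl N 1 (act N \<Lambda> (contract N s)) = scl N 1 (act N \<Lambda> (contract N t))"
      using eq unfolding s(1) t(1) cls[OF s(2)] cls[OF t(2)] by (rule fun_cong)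
    then show "C = D" using eq_iff[OF s(2) t(2)] s(1) t(1) by simp
  qed
  have into: "integral_map \<Lambda> N (tensor_class ?X N t) \<in> yd_hom H (left_char \<epsilon> 1) N"
    if t: "t \<in> cotensor H ?X N" for t
  proof -
    let ?m = "act N \<Lambda> (contract N t)"
    have m: "?m \<in> car N" using modD(3) mem(1)[OF t] by blast
    moreover have "act N h ?m = scl N (\<epsilon> h) ?m" for h
      using modD(6,8)[OF mem(1)[OF t]] left_integralD[OF \<Lambda>(1), of h] by metis
    moreover have "coact N ?m - gen (1, ?m) \<in> null_HN H N"
      by (rule integral_coinvariant[OF N mem[OF t] \<Lambda>(4)])
    moreover have "act N h (scl N x ?m) = scl N x (act N h ?m)" for h x
      using act_simps(2)[OF m m] .
    ultimately show ?thesis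
      unfolding cls[OF t] yd_hom_trivial_iff[OF com] by blast
  qed
  have onto: "f \<in> integral_map \<Lambda> N ` bit H ?X N" if f: "f \<in> yd_hom H (left_char \<epsilon> 1) N" for f
  proof -
    obtain m where m: "m \<in> car N" "\<And>h. act N h m = scl N (\<epsilon> h) m"
      "coact N m - gen (1, m) \<in> null_HN H N" and f: "f = (\<lambda>x. scl N x m)"
      using f unfolding yd_hom_trivial_iff[OF com] by blast
    \<comment> \<open>On an invariant vector \<Lambda> acts as the scalar \<epsilon>(\<Lambda>),
      which the inverse factor compensates.\<close>
    let ?t = "fs_scale (inverse (\<epsilon> \<Lambda>)) (gen (1, m))"
    have t: "?t \<in> cotensor H ?X N"
      by (intro cotensor_scale gen_cotensor m)
    have "contract N ?t = scl N (inverse (\<epsilon> \<Lambda>)) m"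
      unfolding scale by (simp add: contract_def lin_ext_gen[OF modD(1)])
    then have "act N \<Lambda> (contract N ?t) = m"
      using act_simps(2)[OF m(1) m(1)] m(2) \<Lambda>(3) by (simp add: scale_scale)
    then have "integral_map \<Lambda> N (tensor_class ?X N ?t) = f"
      unfolding cls[OF t] f by simp
    with t show ?thesis by (auto simp: bit_def)
  qed
  have "integral_map \<Lambda> N ` bit H ?X N = yd_hom H (left_char \<epsilon> 1) N"
    using into onto by (auto simp: bit_def)
  then have "bij_betw (integral_map \<Lambda> N) (bit H ?X N) (yd_hom H (left_char \<epsilon> 1) N)"
    using inj by (simp add: bij_betw_def)
  moreover have "integral_map \<Lambda> N (tensor_class ?X N (s + t)) =
        (\<lambda>x. integral_map \<Lambda> N (tensor_class ?X N s) x + integral_map \<Lambda> N (tensor_class ?X N t) x)"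
    if s: "s \<in> cotensor H ?X N" and t: "t \<in> cotensor H ?X N" for s t
    unfolding cls[OF s] cls[OF t] cls[OF cotensor_add[OF s t]] add
      act_simps(1)[OF mem(1)[OF s] mem(1)[OF t]] scale_right_distrib ..
  moreover have "integral_map \<Lambda> N (tensor_class ?X N (fs_scale c t)) =
        (\<lambda>x. scl N c (integral_map \<Lambda> N (tensor_class ?X N t) x))"
    if t: "t \<in> cotensor H ?X N" for c t
    unfolding cls[OF t] cls[OF cotensor_scale[OF t]] scale act_simps(2)[OF mem(1)[OF t] mem(1)[OF t]]
    by (simp add: scale_scale mult.commute)
  ultimately show ?thesis
    unfolding bit_hom_iso_def by blast
qed

lemma integral_map_natural:
  assumes N: "yetter_drinfeld H N" and N': "yetter_drinfeld H N'" and f: "f \<in> yd_hom H N N'"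
    and \<Lambda>: "\<And>h. \<Lambda> * h = hscale H (\<epsilon> h) \<Lambda>" and C: "C \<in> bit H (right_char \<epsilon> g) N"
  shows "integral_map \<Lambda> N' (bit_map (right_char \<epsilon> g) N' f C) = f \<circ> integral_map \<Lambda> N C"
proof -
  let ?X = "right_char \<epsilon> g"
  have mod: "left_module H N" and mod': "left_module H N'" and com: "left_comodule H N"
    using N N' by (simp_all add: yetter_drinfeld_def)
  note modD = left_moduleD[OF mod] and modD' = left_moduleD[OF mod']
  interpret vector_space "scl N" by (rule modD)
  obtain t where t: "C = tensor_class ?X N t" "t \<in> cotensor H ?X N"
    using C by (auto simp: bit_def)
  note keys = cotensor_keys[OF t(2)]
  have f: "\<And>n. n \<in> car N \<Longrightarrow> f n \<in> car N'" "linear_on (scl N) (car N) (scl N') f"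
    "\<And>h n. n \<in> car N \<Longrightarrow> f (act N h n) = act N' h (f n)"
    using f by (simp_all add: yd_hom_def)
  let ?u = "lin_ext fs_scale (\<lambda>(x, n). gen (x, f n)) t"
  have u: "bit_map ?X N' f C = tensor_class ?X N' ?u"
    unfolding t(1) by (rule bit_map_class[OF f(2,1,3) modD(3)])
  have keys_u: "Poly_Mapping.keys ?u \<subseteq> UNIV \<times> car N'"
    by (rule order_trans[OF keys_lin_ext]) (use keys f(1) in \<open>auto split: if_splits\<close>)
  have c: "contract N t \<in> car N" by (rule cotensor_coinvariant[OF com t(2)])
  have keysp: "(\<lambda>(x, n). scl N x n) p \<in> car N" if "p \<in> Poly_Mapping.keys t" for p
    using that keys subspace_scale[OF modD(2)] by auto
  have "f (contract N t) = lin_ext (scl N') (\<lambda>p. f ((\<lambda>(x, n). scl N x n) p)) t"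
    unfolding contract_def by (rule linear_on_lin_ext[OF modD(1) modD'(1) modD(2) f(2) keysp])
  also have "\<dots> = lin_ext (scl N') (\<lambda>(x, n). scl N' x (f n)) t"
    by (rule lin_ext_cong) (use keys f(2) in \<open>auto simp: linear_on_iff\<close>)
  also have "\<dots> = contract N' ?u"
    by (simp add: contract_def lin_ext_comp[OF modD'(1)] lin_ext_gen[OF modD'(1)] case_prod_unfold)
  finally have fc: "contract N' ?u = f (contract N t)" ..
  have "integral_map \<Lambda> N' (bit_map ?X N' f C) = (\<lambda>x. scl N' x (act N' \<Lambda> (f (contract N t))))"
    unfolding u integral_map_class[OF mod' keys_u \<Lambda>] fc ..
  moreover have "integral_map \<Lambda> N C = (\<lambda>x. scl N x (act N \<Lambda> (contract N t)))"
    unfolding t(1) by (rule integral_map_class[OF mod keys \<Lambda>])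
  ultimately show ?thesis
    using f(2,3) c modD(3)[OF c, of \<Lambda>] by (simp add: fun_eq_iff linear_on_iff)
qed

lemma semisimple_natural_iso:
  assumes fin: "finite_dimensional (hscale H)" and ss: "semisimple_ring TYPE('h)"
    and \<Lambda>: "left_integral H \<Lambda>" "\<Lambda> \<noteq> 0" and a: "distinguished_group_like H 1"
  shows "natural_bit_hom_iso H (right_char \<epsilon> 1)
    (integral_map \<Lambda> :: ('k, 'h, 'v::ab_group_add) left_mc \<Rightarrow> _)"
proof -
  have \<epsilon>: "\<epsilon> \<Lambda> \<noteq> 0"
    using semisimple_left_integral_counit[OF ss \<Lambda>(1)] \<Lambda>(2) by blast
  show ?thesis
    unfolding natural_bit_hom_iso_def
    using integral_map_iso[OF _ \<Lambda>(1) semisimple_right_integral[OF ss \<Lambda>(1)] \<epsilon>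
        semisimple_integral_coadjoint[OF fin ss \<Lambda> a]]
      integral_map_natural[OF _ _ _ semisimple_right_integral[OF ss \<Lambda>(1)]]
    by blast
qed

end


section \<open>Yetter--Drinfeld modules separating the functors\<close>

text \<open>A finite basis is matched with part of an infinite one. This supplies a copy of
  \<open>H\<close> inside the type that carries the Yetter--Drinfeld modules.\<close>

lemma finite_dimensional_embedding:
  fixes s :: "'k::field \<Rightarrow> 'v::ab_group_add \<Rightarrow> 'v" and s' :: "'k \<Rightarrow> 'u::ab_group_add \<Rightarrow> 'u"
  assumes s: "vector_space s" "finite_dimensional s"
    and s': "vector_space s'" "\<not> finite_dimensional s'"
  obtains \<iota> where "Vector_Spaces.linear s s' \<iota>" "inj \<iota>"
proof -
  interpret V: vector_space s by fact
  interpret U: vector_space s' by fact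
  interpret P: vector_space_pair s s' by (simp add: vector_space_pair_def s s')
  obtain C where C: "finite C" "V.span C = UNIV"
    using s(2) by (auto simp: finite_dimensional_def)
  obtain B where B: "B \<subseteq> C" "V.independent B" "C \<subseteq> V.span B"
    using V.maximal_independent_subset[of C] by metis
  have fin: "finite B" using B(1) C(1) finite_subset by blast
  have sp: "V.span B = UNIV"
    using C(2) B(3) V.span_minimal[OF B(3) V.subspace_span] by auto
  obtain D where D: "U.independent D" "U.span D = UNIV"
    using U.basis_exists[of UNIV] by (metis top.extremum_unique)
  have "infinite D" using s'(2) D(2) by (auto simp: finite_dimensional_def)
  then obtain E where E: "E \<subseteq> D" "finite E" "card E = card B"
    using infinite_arbitrarily_large by blast
  then obtain g where g: "bij_betw g B E"
    using fin finite_same_card_bij by metis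
  obtain \<iota> where \<iota>: "Vector_Spaces.linear s s' \<iota>" "\<forall>b\<in>B. \<iota> b = g b"
    using P.linear_independent_extend[OF B(2)] by blast
  have "\<iota> ` B = E" "inj_on \<iota> B"
    using g \<iota>(2) by (auto simp: bij_betw_def inj_on_def)
  then have "inj_on \<iota> (V.span B)"
    using P.linear_inj_on_span_independent_image[OF \<iota>(1)] U.independent_mono[OF D(1) E(1)] by simp
  then show ?thesis using that \<iota>(1) sp by simp
qed

text \<open>The one-dimensional module \<open>\<^sub>\<epsilon>\<^sup>1\<bbbk>\<close> carried by the line through \<open>u\<close>.\<close>

definition trivial_yd ::
  "('k::field, 'h::ring_1) hopf \<Rightarrow> ('k \<Rightarrow> 'u \<Rightarrow> 'u::ab_group_add) \<Rightarrow> 'u \<Rightarrow> ('k, 'h, 'u) left_mc" where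
  "trivial_yd H s u = \<lparr>car = range (\<lambda>c. s c u), scl = s, act = (\<lambda>h v. s (counit H h) v),
     coact = (\<lambda>v. gen (1, v))\<rparr>"

text \<open>The regular module with coaction \<open>h \<mapsto> h\<^sub>(\<^sub>1\<^sub>) S(h\<^sub>(\<^sub>3\<^sub>)) \<otimes> h\<^sub>(\<^sub>2\<^sub>)\<close>, transported along \<open>\<iota>\<close>.\<close>

definition regular_yd ::
  "('k::field, 'h::ring_1) hopf \<Rightarrow> ('k \<Rightarrow> 'u \<Rightarrow> 'u::ab_group_add) \<Rightarrow> ('h \<Rightarrow> 'u) \<Rightarrow> ('k, 'h, 'u) left_mc"
  where "regular_yd H s \<iota> = \<lparr>car = range \<iota>, scl = s, act = (\<lambda>h v. \<iota> (h * inv \<iota> v)),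
     coact = (\<lambda>v. lin_ext fs_scale (\<lambda>(x, y, z). gen (x * antipode H z, \<iota> y)) (comult3 H (inv \<iota> v)))\<rparr>"

section \<open>Yetter--Drinfeld structures on the trivial and the regular module\<close>

context hopf_algebra
begin

interpretation HS: vector_space "hscale H" by (rule vector_space_H)

text \<open>The identity h1 \<epsilon>(h2) S(h3) = \<epsilon>(h) 1 is both the Yetter--Drinfeld
  condition of the trivial module and the colinearity of \<epsilon> on the regular one.\<close>

lemma sw_counit_middle:
  assumes \<alpha>: "lin \<alpha>"
  shows "sw (\<lambda>p z. sw (\<lambda>x y. \<epsilon> y * \<alpha> (x * S z)) p) h = \<epsilon> h * \<alpha> 1"
proof -
  note [simp] = linD[OF \<alpha>]
  have "sw (\<lambda>x y. \<epsilon> y * \<alpha> (x * S z)) p = \<alpha> (p * S z)" for p z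
    by (rule sw_counit_right) (simp add: multilinear_simps)
  then show ?thesis using sw_antipode_right[OF \<alpha>] by simp
qed

lemma yetter_drinfeld_trivial:
  assumes s: "vector_space s"
  shows "yetter_drinfeld H (trivial_yd H s u)"
proof -
  interpret vector_space s by fact
  let ?N = "trivial_yd H s u"
  have N: "car ?N = range (\<lambda>c. s c u)" "scl ?N = s" "act ?N h v = s (\<epsilon> h) v"
    "coact ?N = (\<lambda>v. gen (1, v))" for h v
    by (simp_all add: trivial_yd_def)
  have coact: "linear_mod (scl ?N) (car ?N) fs_scale (null_HN H ?N) (coact ?N)"
    unfolding linear_mod_def null_HN_iff
    by (auto simp: lin_ext_field_simps linear_on_iff N simp del: scale_scale)
  have sub: "subspace (range (\<lambda>c. s c u))"
  proof (rule subspaceI)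
    show "0 \<in> range (\<lambda>c. s c u)" by (rule range_eqI[of _ _ 0]) simp
    show "x + y \<in> range (\<lambda>c. s c u)" if "x \<in> range (\<lambda>c. s c u)" "y \<in> range (\<lambda>c. s c u)" for x y
      using that by (auto simp: scale_left_distrib[symmetric])
    show "s c x \<in> range (\<lambda>c. s c u)" if "x \<in> range (\<lambda>c. s c u)" for c x
      using that by auto
  qed
  have "left_module H ?N"
    unfolding left_module_def N
    using s sub subspace_scale[OF sub]
    by (auto simp: linear_on_iff scale_right_distrib scale_left_distrib counit_simps mult.commute)
  moreover have "left_comodule H ?N"
    unfolding left_comodule_def N
  proof (intro conjI ballI s sub)
    fix n assume n: "n \<in> range (\<lambda>c. s c u)"
    show "Poly_Mapping.keys (gen (1, n)) \<subseteq> UNIV \<times> range (\<lambda>c. s c u)"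
      using n by simp
    show "lin_ext s (\<lambda>(x, m). s (\<epsilon> x) m) (gen (1, n)) = n"
      by (simp add: lin_ext_gen[OF s] counit_simps)
    show "lin_ext fs_scale (\<lambda>(x, m). lin_ext fs_scale (\<lambda>(x1, x2). gen (x1, x2, m)) (comult H x)) (gen (1, n))
      - lin_ext fs_scale (\<lambda>(x, m). lin_ext fs_scale (\<lambda>(y, l). gen (x, y, l)) (gen (1, m))) (gen (1, n))
      \<in> null3 (hscale H) UNIV (hscale H) UNIV s (range (\<lambda>c. s c u))"
      unfolding null3_iff
    proof (intro allI impI)
      fix b assume "\<forall>w\<in>UNIV. \<forall>z\<in>range (\<lambda>c. s c u). linear_on (hscale H) UNIV (*) (\<lambda>v. b v w z)"
        "\<forall>v\<in>UNIV. \<forall>z\<in>range (\<lambda>c. s c u). linear_on (hscale H) UNIV (*) (\<lambda>w. b v w z)"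
      then have "bil (\<lambda>x y. b x y n)"
        using n unfolding bil_def lin_def linear_on_iff by blast
      from sw_one[OF this] show "lin_ext (*) (\<lambda>(v, w, z). b v w z)
        (lin_ext fs_scale (\<lambda>(x, m). lin_ext fs_scale (\<lambda>(x1, x2). gen (x1, x2, m)) (comult H x)) (gen (1, n))
         - lin_ext fs_scale (\<lambda>(x, m). lin_ext fs_scale (\<lambda>(y, l). gen (x, y, l)) (gen (1, m))) (gen (1, n))) = 0"
        by (simp add: lin_ext_field_simps lin_ext_gen[OF vector_space_fs_scale] sw_def case_prod_unfold)
    qed
  next
    show "linear_mod s (range (\<lambda>c. s c u)) fs_scale (null2 (hscale H) UNIV s (range (\<lambda>c. s c u)))
        (\<lambda>v. gen (1, v))"
      using coact unfolding N .
  qed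
  moreover have "coact ?N (act ?N h n) - lin_ext fs_scale
      (\<lambda>(h1, h2, h3). lin_ext fs_scale (\<lambda>(x, m). gen (h1 * x * S h3, act ?N h2 m)) (coact ?N n))
      (comult3 H h) \<in> null_HN H ?N" if n: "n \<in> car ?N" for h n
    unfolding null_HN_iff
  proof (intro allI impI)
    fix b assume b: "\<forall>n\<in>car ?N. lin (\<lambda>x. b x n)" "\<forall>x. linear_on (scl ?N) (car ?N) (*) (b x)"
    have sc: "b x (s c n) = c * b x n" for x c
      using b(2) n unfolding linear_on_iff N by blast
    have "lin (\<lambda>x. b x n)" using b(1) n by blast
    from sw_counit_middle[OF this, of h]
    show "lin_ext (*) (\<lambda>(x, n). b x n) (coact ?N (act ?N h n) - lin_ext fs_scale
      (\<lambda>(h1, h2, h3). lin_ext fs_scale (\<lambda>(x, m). gen (h1 * x * S h3, act ?N h2 m)) (coact ?N n))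
      (comult3 H h)) = 0"
      unfolding sw_comult3[symmetric]
      by (simp add: N lin_ext_field_simps lin_ext_gen[OF vector_space_fs_scale] sc case_prod_unfold)
  qed
  ultimately show ?thesis
    unfolding yetter_drinfeld_def by blast
qed

context
  fixes s :: "'k \<Rightarrow> 'u \<Rightarrow> 'u::ab_group_add" and \<iota> :: "'h \<Rightarrow> 'u"
  assumes \<iota>: "Vector_Spaces.linear (hscale H) s \<iota>" "inj \<iota>"
begin

interpretation VS: vector_space s using \<iota>(1) by (simp add: Vector_Spaces.linear_iff)

lemma embedding_simps:
  "\<iota> (x + y) = \<iota> x + \<iota> y" "\<iota> (hscale H c x) = s c (\<iota> x)" "inv \<iota> (\<iota> x) = x" "\<iota> x = \<iota> y \<longleftrightarrow> x = y"
  using \<iota> by (simp_all add: Vector_Spaces.linear_iff inj_eq)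

lemma regular_yd_simps:
  "car (regular_yd H s \<iota>) = range \<iota>" "scl (regular_yd H s \<iota>) = s"
  "act (regular_yd H s \<iota>) h (\<iota> x) = \<iota> (h * x)"
  "coact (regular_yd H s \<iota>) (\<iota> x)
    = lin_ext fs_scale (\<lambda>(x, y, z). gen (x * S z, \<iota> y)) (comult3 H x)"
  by (simp_all add: regular_yd_def embedding_simps)

lemma regular_yd_coact:
  "lin_ext (*) (\<lambda>(x, m). b x m) (coact (regular_yd H s \<iota>) (\<iota> h))
    = sw (\<lambda>p z. sw (\<lambda>x y. b (x * S z) (\<iota> y)) p) h"
  unfolding sw_comult3[symmetric] by (simp add: regular_yd_simps lin_ext_field_simps case_prod_unfold)

lemma regular_yd_form:
  assumes "\<forall>n\<in>range \<iota>. lin (\<lambda>x. b x n)" "\<forall>x. linear_on s (range \<iota>) (*) (b x)"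
  shows "b (x + x') (\<iota> y) = b x (\<iota> y) + b x' (\<iota> y)" "b (hscale H c x) (\<iota> y) = c * b x (\<iota> y)"
    "b x (\<iota> y + \<iota> y') = b x (\<iota> y) + b x (\<iota> y')" "b x (s c (\<iota> y)) = c * b x (\<iota> y)"
  using assms by (simp_all add: linear_on_iff lin_def)

text \<open>Both sides are h1 S(h5) \<otimes> h2 S(h4) \<otimes> h3. On the left this uses that
  \<open>S\<close> reverses coproducts.\<close>

lemma regular_yd_coassoc:
  assumes [simp]: "\<And>x x' y z. b (x + x') y (\<iota> z) = b x y (\<iota> z) + b x' y (\<iota> z)"
    "\<And>x y y' z. b x (y + y') (\<iota> z) = b x y (\<iota> z) + b x y' (\<iota> z)"
    "\<And>x y z z'. b x y (\<iota> z + \<iota> z') = b x y (\<iota> z) + b x y (\<iota> z')"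
    "\<And>c x y z. b (hscale H c x) y (\<iota> z) = c * b x y (\<iota> z)"
    "\<And>c x y z. b x (hscale H c y) (\<iota> z) = c * b x y (\<iota> z)"
    "\<And>c x y z. b x y (s c (\<iota> z)) = c * b x y (\<iota> z)"
  shows "sw (\<lambda>p z. sw (\<lambda>x y. sw (\<lambda>v w. b v w (\<iota> y)) (x * S z)) p) h
    = sw (\<lambda>p z. sw (\<lambda>x y. sw (\<lambda>q w. sw (\<lambda>u v. b (x * S z) (u * S w) (\<iota> v)) q) y) p) h"
proof -
  let ?F = "\<lambda>x1 x2 y z1 z2. b (x1 * S z2) (x2 * S z1) (\<iota> y)"
  note ms = multilinear_simps embedding_simps
  have 1: "sw (\<lambda>x y. sw (\<lambda>v w. b v w (\<iota> y)) (x * S z)) p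
      = sw (\<lambda>z1 z2. sw (\<lambda>x y. sw (\<lambda>x1 x2. ?F x1 x2 y z1 z2) x) p) z" for p z
  proof -
    have "sw (\<lambda>v w. b v w (\<iota> y)) (x * S z) = sw (\<lambda>x1 x2. sw (\<lambda>z1 z2. ?F x1 x2 y z1 z2) z) x" for x y
      by (simp add: ms sw_mult sw_antipode)
    moreover have "sw (\<lambda>x1 x2. sw (\<lambda>z1 z2. ?F x1 x2 y z1 z2) z) x
        = sw (\<lambda>z1 z2. sw (\<lambda>x1 x2. ?F x1 x2 y z1 z2) x) z" for x y
      by (rule sw_swap)
    moreover have "sw (\<lambda>x y. sw (\<lambda>z1 z2. sw (\<lambda>x1 x2. ?F x1 x2 y z1 z2) x) z) p
        = sw (\<lambda>z1 z2. sw (\<lambda>x y. sw (\<lambda>x1 x2. ?F x1 x2 y z1 z2) x) p) z"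
      by (rule sw_swap)
    ultimately show ?thesis by (simp only:)
  qed
  have 2: "sw (\<lambda>x y. sw (\<lambda>q z1. sw (\<lambda>x2 y. ?F x x2 y z1 z2) q) y) p
      = sw (\<lambda>r z1. sw (\<lambda>x y. sw (\<lambda>x1 x2. ?F x1 x2 y z1 z2) x) r) p" for p z2
  proof -
    have "sw (\<lambda>x y. sw (\<lambda>q z1. sw (\<lambda>x2 y. ?F x x2 y z1 z2) q) y) p
        = sw (\<lambda>r z1. sw (\<lambda>x q. sw (\<lambda>x2 y. ?F x x2 y z1 z2) q) r) p"
      by (rule sw_coassoc[symmetric]) (simp add: ms)
    moreover have "sw (\<lambda>x q. sw (\<lambda>x2 y. ?F x x2 y z1 z2) q) r
        = sw (\<lambda>x y. sw (\<lambda>x1 x2. ?F x1 x2 y z1 z2) x) r" for r z1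
      by (rule sw_coassoc[symmetric]) (simp add: ms)
    ultimately show ?thesis by simp
  qed
  show ?thesis
    unfolding 1 2 by (rule sw_coassoc[symmetric]) (simp add: ms)
qed

text \<open>Multiplicativity of the coproduct and S(g h) = S(h) S(g) give the coaction g1 h1 S(h3)
  S(g3) \<otimes> g2 h2 of g h, as the Yetter--Drinfeld condition demands.\<close>

lemma yetter_drinfeld_regular: "yetter_drinfeld H (regular_yd H s \<iota>)"
proof -
  let ?N = "regular_yd H s \<iota>"
  note ms = multilinear_simps embedding_simps
  have sub: "VS.subspace (range \<iota>)"
  proof (rule VS.subspaceI)
    show "0 \<in> range \<iota>" using embedding_simps(2)[of 0 0] by (metis VS.scale_zero_left rangeI)
  qed (auto simp: embedding_simps(1,2)[symmetric])
  have coact: "linear_mod (scl ?N) (car ?N) fs_scale (null_HN H ?N) (coact ?N)"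
    unfolding linear_mod_def unfolding null_HN_iff unfolding regular_yd_simps
  proof (intro conjI ballI allI impI)
    fix b v w assume b: "\<forall>n\<in>range \<iota>. lin (\<lambda>x. b x n)" "\<forall>x. linear_on s (range \<iota>) (*) (b x)"
      and "v \<in> range \<iota>" "w \<in> range \<iota>"
    then obtain x y where v: "v = \<iota> x" "w = \<iota> y" by blast
    note [simp] = regular_yd_form[OF b]
    show "lin_ext (*) (\<lambda>(x, n). b x n) (coact ?N (v + w) - (coact ?N v + coact ?N w)) = 0"
      unfolding v embedding_simps(1)[symmetric]
      by (simp only: lin_ext_field_simps regular_yd_coact) (simp add: ms)
  next
    fix b c v assume b: "\<forall>n\<in>range \<iota>. lin (\<lambda>x. b x n)" "\<forall>x. linear_on s (range \<iota>) (*) (b x)"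
      and "v \<in> range \<iota>"
    then obtain x where v: "v = \<iota> x" by blast
    note [simp] = regular_yd_form[OF b]
    show "lin_ext (*) (\<lambda>(x, n). b x n) (coact ?N (s c v) - fs_scale c (coact ?N v)) = 0"
      unfolding v embedding_simps(2)[symmetric]
      by (simp only: lin_ext_field_simps regular_yd_coact) (simp add: ms)
  qed
  have "left_module H ?N"
    unfolding left_module_def regular_yd_simps
    using VS.vector_space_axioms sub
    by (auto simp: linear_on_iff embedding_simps(1,2)[symmetric] regular_yd_simps distrib_left
        distrib_right scale_mult_left scale_mult_right mult.assoc)
  moreover have "left_comodule H ?N"
    unfolding left_comodule_def regular_yd_simps
  proof (intro conjI ballI VS.vector_space_axioms sub)
    fix n assume "n \<in> range \<iota>"
    then obtain h where n: "n = \<iota> h" by blast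
    show "Poly_Mapping.keys (coact ?N n) \<subseteq> UNIV \<times> range \<iota>"
      unfolding n regular_yd_simps by (rule order_trans[OF keys_lin_ext]) (auto split: if_splits)
    show "lin_ext s (\<lambda>(x, m). s (\<epsilon> x) m) (coact ?N n) = n"
    proof -
      have "lin_ext s (\<lambda>(x, m). s (\<epsilon> x) m) (coact ?N n)
          = lin_ext s (\<lambda>p. \<iota> ((\<lambda>(x, y, z). hscale H (\<epsilon> (x * S z)) y) p)) (comult3 H h)"
        unfolding n regular_yd_simps
        by (simp add: lin_ext_comp[OF VS.vector_space_axioms] lin_ext_gen[OF VS.vector_space_axioms]
            case_prod_unfold embedding_simps)
      also have "\<dots> = \<iota> (lin_ext (hscale H) (\<lambda>(x, y, z). hscale H (\<epsilon> (x * S z)) y) (comult3 H h))"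
        by (rule linear_on_lin_ext[OF vector_space_H VS.vector_space_axioms HS.subspace_UNIV, symmetric])
          (simp_all add: linear_on_iff embedding_simps)
      also have "lin_ext (hscale H) (\<lambda>(x, y, z). hscale H (\<epsilon> (x * S z)) y) (comult3 H h) = h"
      proof (rule lin_eqI)
        fix \<alpha> assume \<alpha>: "lin \<alpha>"
        have "sw (\<lambda>x y. \<epsilon> x * (\<epsilon> z * \<alpha> y)) p = \<epsilon> z * \<alpha> p" for p z
          by (rule sw_counit_left) (use \<alpha> in \<open>simp add: multilinear_simps\<close>)
        moreover have "sw (\<lambda>p z. \<epsilon> z * \<alpha> p) h = \<alpha> h"
          by (rule sw_counit_right[OF \<alpha>])
        ultimately have "sw (\<lambda>p z. sw (\<lambda>x y. \<epsilon> x * (\<epsilon> z * \<alpha> y)) p) h = \<alpha> h"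
          by simp
        then show "\<alpha> (lin_ext (hscale H) (\<lambda>(x, y, z). hscale H (\<epsilon> (x * S z)) y) (comult3 H h)) = \<alpha> h"
          unfolding sw_comult3[symmetric]
          by (simp add: lin_lin_ext[OF \<alpha>] case_prod_unfold linD[OF \<alpha>] counit_simps counit_antipode
              mult.assoc)
      qed
      finally show ?thesis unfolding n .
    qed
    show "lin_ext fs_scale (\<lambda>(x, m). lin_ext fs_scale (\<lambda>(x1, x2). gen (x1, x2, m)) (comult H x)) (coact ?N n)
      - lin_ext fs_scale (\<lambda>(x, m). lin_ext fs_scale (\<lambda>(y, l). gen (x, y, l)) (coact ?N m)) (coact ?N n)
      \<in> null3 (hscale H) UNIV (hscale H) UNIV s (range \<iota>)" (is "?c \<in> _")
      unfolding null3_iff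
    proof (intro allI impI)
      fix b assume b: "\<forall>w\<in>UNIV. \<forall>z\<in>range \<iota>. linear_on (hscale H) UNIV (*) (\<lambda>v. b v w z)"
        "\<forall>v\<in>UNIV. \<forall>z\<in>range \<iota>. linear_on (hscale H) UNIV (*) (\<lambda>w. b v w z)"
        "\<forall>v\<in>UNIV. \<forall>w\<in>UNIV. linear_on s (range \<iota>) (*) (b v w)"
      have "lin_ext (*) (\<lambda>(v, w, z). b v w z) ?c
        = lin_ext (*) (\<lambda>(x, m). sw (\<lambda>v w. b v w m) x) (coact ?N n)
        - lin_ext (*) (\<lambda>(x, m). lin_ext (*) (\<lambda>(y, l). b x y l) (coact ?N m)) (coact ?N n)"
        by (simp add: lin_ext_field_simps sw_def case_prod_unfold)
      also have "\<dots> = 0"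
        unfolding n regular_yd_coact right_minus_eq
        by (rule regular_yd_coassoc) (use b in \<open>auto simp: linear_on_iff\<close>)
      finally show "lin_ext (*) (\<lambda>(v, w, z). b v w z) ?c = 0" .
    qed
  next
    show "linear_mod s (range \<iota>) fs_scale (null2 (hscale H) UNIV s (range \<iota>)) (coact ?N)"
      using coact unfolding regular_yd_simps .
  qed
  moreover have "coact ?N (act ?N g n) - lin_ext fs_scale
      (\<lambda>(h1, h2, h3). lin_ext fs_scale (\<lambda>(x, m). gen (h1 * x * S h3, act ?N h2 m)) (coact ?N n))
      (comult3 H g) \<in> null_HN H ?N" (is "?c \<in> _") if "n \<in> car ?N" for g n
    unfolding null_HN_iff unfolding regular_yd_simps
  proof (intro allI impI)
    fix b assume b: "\<forall>n\<in>range \<iota>. lin (\<lambda>x. b x n)" "\<forall>x. linear_on s (range \<iota>) (*) (b x)"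
    note [simp] = regular_yd_form[OF b]
    obtain h where n: "n = \<iota> h" using \<open>n \<in> car ?N\<close> by (auto simp: regular_yd_simps)
    \<comment> \<open>The unprimed letters are the legs of \<open>g\<close>, the primed ones those
      of \<open>h\<close>.\<close>
    let ?F = "\<lambda>x y z x' y' z'. b (x * (x' * (S z' * S z))) (\<iota> (y * y'))"
    have K: "sw (\<lambda>x y. b (x * S (z * z')) (\<iota> y)) (p * p')
        = sw (\<lambda>x y. sw (\<lambda>x' y'. ?F x y z x' y' z') p') p" for p z p' z'
      by (subst sw_mult) (simp_all add: ms antipode_mult)
    have "sw (\<lambda>p z. sw (\<lambda>x y. b (x * S z) (\<iota> y)) p) (g * h)
        = sw (\<lambda>p z. sw (\<lambda>p' z'. sw (\<lambda>x y. sw (\<lambda>x' y'. ?F x y z x' y' z') p') p) h) g"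
      by (subst sw_mult) (simp_all only: K, simp add: ms)
    also have "\<dots> = sw (\<lambda>p z. sw (\<lambda>x y. sw (\<lambda>p' z'. sw (\<lambda>x' y'. ?F x y z x' y' z') p') h) p) g"
    proof -
      have "sw (\<lambda>p' z'. sw (\<lambda>x y. sw (\<lambda>x' y'. ?F x y z x' y' z') p') p) h
        = sw (\<lambda>x y. sw (\<lambda>p' z'. sw (\<lambda>x' y'. ?F x y z x' y' z') p') h) p" for p z
        by (rule sw_swap)
      then show ?thesis by (simp only:)
    qed
    finally have "sw (\<lambda>p z. sw (\<lambda>x y. b (x * S z) (\<iota> y)) p) (g * h)
        = sw (\<lambda>p z. sw (\<lambda>x y. sw (\<lambda>p' z'. sw (\<lambda>x' y'. ?F x y z x' y' z') p') h) p) g" .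
    moreover have "lin_ext (*) (\<lambda>(x, m). b (u * x * S w) (act ?N v m)) (coact ?N n)
        = sw (\<lambda>p' z'. sw (\<lambda>x' y'. ?F u v w x' y' z') p') h" for u v w
      unfolding n regular_yd_coact by (simp add: regular_yd_simps mult.assoc)
    ultimately show "lin_ext (*) (\<lambda>(x, n). b x n) ?c = 0"
      using sw_comult3[of "\<lambda>u v w. lin_ext (*) (\<lambda>(x, m). b (u * x * S w) (act ?N v m)) (coact ?N n)" g]
      by (simp add: lin_ext_field_simps case_prod_unfold n regular_yd_simps(3)
          regular_yd_coact[unfolded case_prod_unfold])
  qed
  ultimately show ?thesis
    unfolding yetter_drinfeld_def by blast
qed

end

section \<open>Obstructions to an isomorphism\<close>

lemma trivial_yd_simps:
  "car (trivial_yd H s u) = range (\<lambda>c. s c u)" "scl (trivial_yd H s u) = s"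
  "act (trivial_yd H s u) h v = s (\<epsilon> h) v" "coact (trivial_yd H s u) v = gen (1, v)"
  by (simp_all add: trivial_yd_def)

text \<open>On a trivial module the identity turns the action into \<epsilon>, so
  \<open>null_over_contract\<close> would force \<open>u\<close> to be zero.\<close>

lemma gen_not_null_over_trivial:
  assumes s: "vector_space s" and u: "u \<noteq> 0"
  shows "gen (1, u) \<notin> null_over (right_char \<epsilon> g) (trivial_yd H s u)"
proof
  interpret vector_space s by fact
  assume "gen (1, u) \<in> null_over (right_char \<epsilon> g) (trivial_yd H s u)"
  then have "contract (trivial_yd H s u) (gen (1, u)) = 0"
    by (rule null_over_contract(2)[where \<phi> = "\<lambda>x. x" and s = s, rotated])
      (use s yetter_drinfeld_trivial[OF s, of u] in
        \<open>auto simp: trivial_yd_simps linear_on_iff yetter_drinfeld_def\<close>)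
  then show False
    using u by (simp add: contract_def trivial_yd_simps lin_ext_gen[OF s])
qed

lemma yd_hom_trivial_yd:
  assumes s: "vector_space s"
  shows "(\<lambda>x. s (c * x) u) \<in> yd_hom H (left_char \<epsilon> 1) (trivial_yd H s u)"
proof -
  interpret vector_space s by fact
  have "0 \<in> null_HN H (trivial_yd H s u)" by (simp add: null2_def free.span_zero)
  then show ?thesis
    by (auto simp: yd_hom_def trivial_yd_simps linear_on_iff lin_ext_gen[OF vector_space_fs_scale]
        distrib_left scale_left_distrib mult_ac)
qed

text \<open>A vector with both coactions 1 \<otimes> v and a \<otimes> v is zero when a differs from
  1. The bitensor product then has a single element, while the multiples of \<open>u\<close> give at
  least two morphisms.\<close>

lemma no_iso_distinguished:
  assumes s: "vector_space s" and u: "u \<noteq> 0" and a: "a \<noteq> 1"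
  shows "\<not> bit_hom_iso H (right_char \<epsilon> a) (trivial_yd H s u) \<phi>"
proof
  interpret vector_space s by fact
  let ?N = "trivial_yd H s u" and ?X = "right_char \<epsilon> a"
  assume iso: "bit_hom_iso H ?X ?N \<phi>"
  have N: "left_module H ?N" "left_comodule H ?N"
    using yetter_drinfeld_trivial[OF s, of u] by (simp_all add: yetter_drinfeld_def)
  obtain \<alpha> where \<alpha>: "lin \<alpha>" "\<alpha> 1 \<noteq> \<alpha> a"
    using a lin_eqI by metis
  obtain \<psi> where \<psi>: "Vector_Spaces.linear s (*) \<psi>" "\<psi> u = 1"
    using separating_functional[OF subspace_single_0, of u] u by blast
  have zero: "contract ?N t = 0" if t: "t \<in> cotensor H ?X ?N" for t
  proof -
    note c = cotensor_coinvariant[OF N(2) t]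
    let ?v = "contract ?N t"
    have "gen (1, ?v) - gen (a, ?v) \<in> null_HN H ?N"
      using c(2) by (simp add: trivial_yd_simps)
    \<comment> \<open>The product of \<alpha>, which separates 1 from \<open>a\<close>, and \<psi>,
      which detects multiples of \<open>u\<close>, is the testing form.\<close>
    then have "lin_ext (*) (\<lambda>(x, n). \<alpha> x * \<psi> n) (gen (1, ?v) - gen (a, ?v)) = 0"
      unfolding null_HN_iff
      by (elim allE[of _ "\<lambda>x n. \<alpha> x * \<psi> n"])
        (use \<alpha>(1) \<psi>(1) in \<open>auto simp: lin_def linear_on_iff Vector_Spaces.linear_iff trivial_yd_simps
            algebra_simps\<close>)
    then have "\<psi> ?v = 0"
      using \<alpha>(2) by (simp add: lin_ext_field_simps)
    moreover obtain c where "?v = s c u" using c(1) by (auto simp: trivial_yd_simps)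
    ultimately show ?thesis
      using \<psi> by (simp add: Vector_Spaces.linear_iff)
  qed
  have "tensor_class ?X ?N t = tensor_class ?X ?N (gen (1, 0))" if t: "t \<in> cotensor H ?X ?N" for t
    using class_gen_contract[OF N(1) cotensor_keys[OF t], of \<epsilon> a] zero[OF t]
    by (simp add: tensor_class_eq_iff)
  then have single: "C = D" if "C \<in> bit H ?X ?N" "D \<in> bit H ?X ?N" for C D
    using that by (auto simp: bit_def)
  have "\<phi> ` bit H ?X ?N = yd_hom H (left_char \<epsilon> 1) ?N"
    using iso by (simp add: bit_hom_iso_def bij_betw_def)
  then have "(\<lambda>x. s (c * x) u) \<in> \<phi> ` bit H ?X ?N" for c
    using yd_hom_trivial_yd[OF s] by simp
  then obtain C D where "C \<in> bit H ?X ?N" "(\<lambda>x. s (0 * x) u) = \<phi> C"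
    "D \<in> bit H ?X ?N" "(\<lambda>x. s (1 * x) u) = \<phi> D"
    by (meson imageE)
  with single[of C D] have "(\<lambda>x. s (0 * x) u) = (\<lambda>x. s (1 * x) u)" by simp
  then show False
    using u by (auto dest: fun_cong[of _ _ 1])
qed

text \<open>Naturality is applied to \<epsilon>, as a morphism from the regular to the trivial
  module, and to the class of 1. The square forces the nonzero class of 1 \<otimes> u to have image
  zero, against injectivity.\<close>

lemma no_natural_iso_nonsemisimple:
  fixes s :: "'k \<Rightarrow> 'u::ab_group_add \<Rightarrow> 'u"
    and \<upsilon> :: "('k, 'h, 'u) left_mc \<Rightarrow> ('k \<times> 'u \<Rightarrow>\<^sub>0 'k) set \<Rightarrow> 'k \<Rightarrow> 'u"
  assumes \<iota>: "Vector_Spaces.linear (hscale H) s \<iota>" "inj \<iota>"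
    and ns: "\<not> semisimple_ring TYPE('h)"
  shows "\<not> natural_bit_hom_iso H (right_char \<epsilon> 1) \<upsilon>"
proof
  have s: "vector_space s" using \<iota>(1) by (simp add: Vector_Spaces.linear_iff)
  interpret vector_space s by fact
  note emb = embedding_simps[OF \<iota>]
  define u where "u = \<iota> 1"
  have "\<iota> 0 = 0" using emb(2)[of 0 0] by simp
  then have u: "u \<noteq> 0" using emb(4)[of 1 0] by (auto simp: u_def)
  let ?M = "regular_yd H s \<iota>" and ?N = "trivial_yd H s u" and ?X = "right_char \<epsilon> 1"
  \<comment> \<open>This is \<epsilon>, read on the embedded copy of \<open>H\<close> and with
    values in the line through \<open>u\<close>.\<close>
  let ?f = "\<lambda>v. s (\<epsilon> (inv \<iota> v)) u"
  note reg = regular_yd_simps[OF \<iota>]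
  assume nat: "natural_bit_hom_iso H ?X \<upsilon>"
  have M: "yetter_drinfeld H ?M" and N: "yetter_drinfeld H ?N"
    using yetter_drinfeld_regular[OF \<iota>] yetter_drinfeld_trivial[OF s] by blast+
  have isoM: "bit_hom_iso H ?X ?M (\<upsilon> ?M)" and isoN: "bit_hom_iso H ?X ?N (\<upsilon> ?N)"
    using nat M N by (simp_all add: natural_bit_hom_iso_def)
  have f: "?f \<in> yd_hom H ?M ?N"
  proof -
    have "coact ?N (?f v) - lin_ext fs_scale (\<lambda>(x, l). gen (x, ?f l)) (coact ?M v) \<in> null_HN H ?N"
      if v_in: "v \<in> car ?M" for v
      unfolding null_HN_iff
    proof (intro allI impI)
      fix b assume b: "\<forall>n\<in>car ?N. lin (\<lambda>x. b x n)" "\<forall>x. linear_on (scl ?N) (car ?N) (*) (b x)"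
      obtain h where v: "v = \<iota> h" using v_in by (auto simp: reg)
      have u': "u \<in> car ?N" unfolding trivial_yd_simps by (rule range_eqI[of _ _ 1]) simp
      then have bu: "lin (\<lambda>x. b x u)" using b(1) by blast
      have sc: "b x (s c u) = c * b x u" for x c
        using b(2) u' unfolding linear_on_iff trivial_yd_simps by blast
      have "lin_ext (*) (\<lambda>(x, n). b x n) (lin_ext fs_scale (\<lambda>(x, l). gen (x, ?f l)) (coact ?M v))
          = lin_ext (*) (\<lambda>(x, l). b x (?f l)) (coact ?M v)"
        by (simp add: lin_ext_field_simps case_prod_unfold)
      also have "\<dots> = \<epsilon> h * b 1 u"
        unfolding v regular_yd_coact[OF \<iota>] sc emb(3) by (rule sw_counit_middle[OF bu])
      finally show "lin_ext (*) (\<lambda>(x, n). b x n)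
          (coact ?N (?f v) - lin_ext fs_scale (\<lambda>(x, l). gen (x, ?f l)) (coact ?M v)) = 0"
        by (simp add: lin_ext_field_simps trivial_yd_simps v emb(3) sc)
    qed
    moreover have "\<forall>v\<in>car ?M. ?f v \<in> car ?N" "linear_on (scl ?M) (car ?M) (scl ?N) ?f"
      "\<forall>h. \<forall>v\<in>car ?M. ?f (act ?M h v) = act ?N h (?f v)"
      by (auto simp: linear_on_iff reg(1-3) trivial_yd_simps emb(3) emb(1,2)[symmetric]
          counit_simps scale_left_distrib)
    ultimately show ?thesis
      unfolding yd_hom_def by blast
  qed
  \<comment> \<open>The unit is coinvariant because \<Delta>(1) = 1 \<otimes> 1 and S(1) =
    1.\<close>
  have one: "gen (1, \<iota> 1) \<in> cotensor H ?X ?M"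
  proof (rule gen_cotensor)
    show "coact ?M (\<iota> 1) - gen (1, \<iota> 1) \<in> null_HN H ?M"
      unfolding null_HN_iff unfolding reg(1,2)
    proof (intro allI impI)
      fix b assume b: "\<forall>n\<in>range \<iota>. lin (\<lambda>x. b x n)" "\<forall>x. linear_on s (range \<iota>) (*) (b x)"
      note [simp] = regular_yd_form[OF \<iota> b]
      have "sw (\<lambda>p z. sw (\<lambda>x y. b (x * S z) (\<iota> y)) p) 1 = b 1 (\<iota> 1)"
        by (simp add: sw_one multilinear_simps emb antipode_one)
      then show "lin_ext (*) (\<lambda>(x, n). b x n) (coact ?M (\<iota> 1) - gen (1, \<iota> 1)) = 0"
        by (simp only: lin_ext_field_simps regular_yd_coact[OF \<iota>]) simp
    qed
  qed (simp add: reg)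
  let ?C = "tensor_class ?X ?M (gen (1, \<iota> 1))"
  have C: "?C \<in> bit H ?X ?M" using one by (simp add: bit_def)
  have "\<upsilon> ?M ?C \<in> yd_hom H (left_char \<epsilon> 1) ?M"
    using isoM C by (auto simp: bit_hom_iso_def bij_betw_def)
  then obtain m where m: "m \<in> car ?M" "\<And>h. act ?M h m = scl ?M (\<epsilon> h) m"
    "\<upsilon> ?M ?C = (\<lambda>x. scl ?M x m)"
    using M unfolding yetter_drinfeld_def by (auto simp: yd_hom_trivial_iff)
  then obtain k where k: "m = \<iota> k" by (auto simp: reg)
  \<comment> \<open>Invariant vectors of the regular module are left integrals, and without
    semisimplicity \<open>maschke\<close> gives them counit zero.\<close>
  have "left_integral H k"
    using m(2) by (simp add: left_integral_def k reg emb(2)[symmetric] emb(4))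
  then have "\<epsilon> k = 0" using maschke ns by blast
  then have zero: "?f \<circ> \<upsilon> ?M ?C = (\<lambda>x. 0)"
    by (simp add: fun_eq_iff m(3) reg k emb(2)[symmetric] emb(3) counit_simps)
  have "bit_map ?X ?N ?f ?C = tensor_class ?X ?N (lin_ext fs_scale (\<lambda>(x, n). gen (x, ?f n)) (gen (1, \<iota> 1)))"
    using f M by (intro bit_map_class)
      (auto simp: yd_hom_def yetter_drinfeld_def left_module_def)
  also have "\<dots> = tensor_class ?X ?N (gen (1, u))"
    by (simp add: lin_ext_gen[OF vector_space_fs_scale] emb(3) counit_simps)
  finally have map: "bit_map ?X ?N ?f ?C = tensor_class ?X ?N (gen (1, u))" .
  have gu: "gen (1, u) \<in> cotensor H ?X ?N"
  proof (rule gen_cotensor)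
    show "u \<in> car ?N" unfolding trivial_yd_simps by (rule range_eqI[of _ _ 1]) simp
  qed (simp add: trivial_yd_simps null2_def free.span_zero)
  have "\<upsilon> ?N (bit_map ?X ?N ?f ?C) = ?f \<circ> \<upsilon> ?M ?C"
    using nat M N f C unfolding natural_bit_hom_iso_def by blast
  then have "\<upsilon> ?N (tensor_class ?X ?N (gen (1, u))) = (\<lambda>x. 0)"
    using zero map by simp
  \<comment> \<open>The zero class is treated as the 0-multiple of a cotensor element, where
    homogeneity of \<upsilon> applies.\<close>
  moreover have "\<upsilon> ?N (tensor_class ?X ?N 0) = (\<lambda>x. 0)"
  proof -
    have "\<upsilon> ?N (tensor_class ?X ?N (fs_scale 0 (gen (1, u))))
        = (\<lambda>x. scl ?N 0 (\<upsilon> ?N (tensor_class ?X ?N (gen (1, u))) x))"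
      using isoN gu unfolding bit_hom_iso_def by blast
    then show ?thesis by (simp add: trivial_yd_simps)
  qed
  moreover have "inj_on (\<upsilon> ?N) (bit H ?X ?N)"
    using isoN by (simp add: bit_hom_iso_def bij_betw_def)
  ultimately have "tensor_class ?X ?N (gen (1, u)) = tensor_class ?X ?N 0"
    using gu cotensor_scale[OF gu, of 0] by (auto simp: inj_on_def bit_def)
  then show False
    using gen_not_null_over_trivial[OF s u] by (simp add: tensor_class_eq_iff)
qed

end

section \<open>The two cases combined\<close>

theorem theorem7p12:
  fixes H :: "('k::field, 'h::ring_1) hopf" and \<Lambda> a :: 'h
  assumes "hopf_algebra H" and "finite_dimensional (hscale H)"
    and "left_integral H \<Lambda>" and "\<Lambda> \<noteq> 0"
    and "distinguished_group_like H a"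
  shows
    "(semisimple_ring TYPE('h) \<and> a = 1 \<longrightarrow>
       (\<exists>\<upsilon> :: ('k, 'h, 'u::ab_group_add) left_mc \<Rightarrow> ('k \<times> 'u \<Rightarrow>\<^sub>0 'k) set \<Rightarrow> ('k \<Rightarrow> 'u).
          natural_bit_hom_iso H (right_char (counit H) a) \<upsilon> \<and>
          (\<forall>N. yetter_drinfeld H N \<longrightarrow>
             (\<forall>n\<in>car N. gen (1, n) \<in> cotensor H (right_char (counit H) a) N \<longrightarrow>
                \<upsilon> N (tensor_class (right_char (counit H) a) N (gen (1, n)))
                = (\<lambda>x. scl N x (act N \<Lambda> n)))))) \<and>
     (\<not> (semisimple_ring TYPE('h) \<and> a = 1) \<longrightarrow>
       (\<exists>s :: 'k \<Rightarrow> 'u \<Rightarrow> 'u. vector_space s \<and> \<not> finite_dimensional s) \<longrightarrow>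
       \<not> (\<exists>\<upsilon> :: ('k, 'h, 'u) left_mc \<Rightarrow> ('k \<times> 'u \<Rightarrow>\<^sub>0 'k) set \<Rightarrow> ('k \<Rightarrow> 'u).
             natural_bit_hom_iso H (right_char (counit H) a) \<upsilon>))"
proof -
  interpret hopf_algebra H by fact
  show ?thesis
  proof (intro conjI impI)
    assume ss: "semisimple_ring TYPE('h) \<and> a = 1"
    have "integral_map \<Lambda> N (tensor_class (right_char (counit H) a) N (gen (1, n)))
        = (\<lambda>x. scl N x (act N \<Lambda> n))"
      if N: "yetter_drinfeld H N" and n: "n \<in> car N" for N :: "('k, 'h, 'u) left_mc" and n
    proof -
      have mod: "left_module H N" using N by (simp add: yetter_drinfeld_def)
      interpret vector_space "scl N" using mod by (rule left_moduleD)
      have "contract N (gen (1, n)) = n"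
        by (simp add: contract_def lin_ext_gen[OF left_moduleD(1)[OF mod]])
      then show ?thesis
        using integral_map_class[OF mod _ semisimple_right_integral, of "gen (1, n)" \<Lambda> a] n ss assms(3)
        by simp
    qed
    moreover have "natural_bit_hom_iso H (right_char (counit H) a)
        (integral_map \<Lambda> :: ('k, 'h, 'u) left_mc \<Rightarrow> _)"
      using semisimple_natural_iso assms ss by blast
    ultimately show "\<exists>\<upsilon> :: ('k, 'h, 'u) left_mc \<Rightarrow> ('k \<times> 'u \<Rightarrow>\<^sub>0 'k) set \<Rightarrow> ('k \<Rightarrow> 'u).
          natural_bit_hom_iso H (right_char (counit H) a) \<upsilon> \<and>
          (\<forall>N. yetter_drinfeld H N \<longrightarrow>
             (\<forall>n\<in>car N. gen (1, n) \<in> cotensor H (right_char (counit H) a) N \<longrightarrow>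
                \<upsilon> N (tensor_class (right_char (counit H) a) N (gen (1, n)))
                = (\<lambda>x. scl N x (act N \<Lambda> n))))"
      by blast
  next
    assume ns: "\<not> (semisimple_ring TYPE('h) \<and> a = 1)"
    \<comment> \<open>An infinite-dimensional structure on the universe type leaves room for a copy
      of \<open>H\<close>, hence for both separating modules.\<close>
    assume "\<exists>s :: 'k \<Rightarrow> 'u \<Rightarrow> 'u. vector_space s \<and> \<not> finite_dimensional s"
    then obtain s :: "'k \<Rightarrow> 'u \<Rightarrow> 'u" and \<iota> :: "'h \<Rightarrow> 'u"
      where s: "vector_space s" and \<iota>: "Vector_Spaces.linear (hscale H) s \<iota>" "inj \<iota>"
      using finite_dimensional_embedding[OF vector_space_H assms(2)] by metis
    show "\<nexists>\<upsilon> :: ('k, 'h, 'u) left_mc \<Rightarrow> ('k \<times> 'u \<Rightarrow>\<^sub>0 'k) set \<Rightarrow> ('k \<Rightarrow> 'u).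
             natural_bit_hom_iso H (right_char (counit H) a) \<upsilon>"
    proof (cases "a = 1")
      case True
      then show ?thesis using no_natural_iso_nonsemisimple[OF \<iota>] ns by blast
    next
      case False
      \<comment> \<open>Only a nonzero vector is taken from the embedding; the trivial module on its
        line already excludes a bijection.\<close>
      have "\<iota> 1 \<noteq> \<iota> 0" using \<iota>(2) by (simp add: inj_eq)
      then obtain u :: 'u where "u \<noteq> 0" by (metis)
      then show ?thesis
        using no_iso_distinguished[OF s _ False] yetter_drinfeld_trivial[OF s]
        by (auto simp: natural_bit_hom_iso_def)
    qed
  qed
qed

end
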